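(* Let $d\ge 2$, $K\ge 2$ be integers and $\alpha>\beta>0$ be constants with $\frac{(\sqrt{\alpha}-\sqrt{\beta})^2}{K^{d-1}(d-1)!}>1$. Let $\mathcal{A}$ be the adjacency tensor of a random hypergraph generated according to the symmetric $d$-HSBM with parameters $(n,d,K,p,q)$ and planted partition $\boldsymbol{H}^*\in\mathcal{H}$, where $p=\alpha\log n/n^{d-1}$ and $q=\beta\log n/n^{d-1}$, and suppose that $n$ is sufficiently large. Then there exists a constant $\gamma>0$, whose value depends only on $\alpha,\beta,d$ and $K$, such that the following holds with probability at least $1-n^{-\Omega(1)}$: if the initial point $\boldsymbol{H}^0$ satisfies the partial recovery condition $$\boldsymbol{H}^0\in\mathbb{M}_{n,K},\qquad \min_{\boldsymbol{Q}\in\Pi_K}\|\boldsymbol{H}^0-\boldsymbol{H}^*\boldsymbol{Q}\|_F\le\theta\sqrt{n}$$ with $$\theta=\frac14\min\left\{\frac{1}{\sqrt{K(d-1)}},\ \frac{\gamma K^{d-3/2}}{16(d-1)(\alpha-\beta)}\right\},$$ then the projected tensor power method (PTPM) started from $\boldsymbol{H}^0$ outputs a true partition (i.e. $\boldsymbol{H}^*\boldsymbol{Q}$ for some $\boldsymbol{Q}\in\Pi_K$) in $\left(\lceil 2\log\log n\rceil+\left\lceil\frac{2\log n}{\log\log n}\right\rceil+2\right)$ projected tensor power iterations. Moreover, PTPM outputs a true partition in $O(n\log^2 n/\log\log n)$ time.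
   Context: Notation: $[n]=\{1,\dots,n\}$; $\boldsymbol{1}_n$ is the all-one vector in $\mathbb{R}^n$; $\Pi_K$ is the set of $K\times K$ permutation matrices; $\mathbf{Bern}(p)$ is the Bernoulli distribution; $\|\cdot\|_F$ is the Frobenius norm. $K$ divides $n$ and $m=n/K$. The set of balanced assignments is $\mathcal{H}=\{\boldsymbol{H}\in\{0,1\}^{n\times K}:\boldsymbol{H}\boldsymbol{1}_K=\boldsymbol{1}_n,\ \boldsymbol{H}^\top\boldsymbol{1}_n=m\boldsymbol{1}_K\}$; nodes $i,j$ are in the same community of $\boldsymbol{H}$ if rows $i$ and $j$ of $\boldsymbol{H}$ are equal. $\mathbb{M}_{n,K}$ is the set of $n\times K$ matrices each of whose rows is all zero except for one entry equal to $1$. Symmetric $d$-HSBM with parameters $(n,d,K,p,q)$ and $\boldsymbol{H}^*\in\mathcal{H}$: a random symmetric order-$d$ tensor $\mathcal{A}$ of size $n\times\cdots\times n$ (invariant under permutations of indices) whose entries $\mathcal{A}_{i_1,\dots,i_d}$, $1\le i_1<\dots<i_d\le n$, are independent, with $\mathcal{A}_{i_1,\dots,i_d}\sim\mathbf{Bern}(p)$ if $i_1,\dots,i_d$ all belong to the same community of $\boldsymbol{H}^*$ and $\sim\mathbf{Bern}(q)$ otherwise; entries with two equal indices are $0$. For $\boldsymbol{H}\in\mathbb{R}^{n\times K}$, $\mathcal{A}[\boldsymbol{H}^{\otimes(d-1)}]$ is the $n\times K$ matrix with $(i,k)$ entry $\sum_{1\le i_2,\dots,i_d\le n}\mathcal{A}_{i,i_2,\dots,i_d}H_{i_2k}\cdots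 H_{i_dk}$. For $\boldsymbol{C}\in\mathbb{R}^{n\times K}$, $\mathcal{T}(\boldsymbol{C})=\arg\min\{\|\boldsymbol{H}-\boldsymbol{C}\|_F:\boldsymbol{H}\in\mathcal{H}\}$ (set-valued). PTPM: given $\mathcal{A}$, a positive integer $N$ and an initial point $\boldsymbol{H}^0$, choose $\boldsymbol{H}^1\in\mathcal{T}(\boldsymbol{H}^0)$, then for $t=1,\dots,N$ choose $\boldsymbol{H}^{t+1}\in\mathcal{T}(\mathcal{A}[(\boldsymbol{H}^t)^{\otimes(d-1)}])$ (one projected tensor power iteration), and output $\boldsymbol{H}^{N+1}$. Time counts elementary operations of PTPM given $\boldsymbol{H}^0$ and given $\mathcal{A}$ through its list of nonzero entries. $n^{-\Omega(1)}$ denotes a quantity at most $n^{-c}$ with a constant $c>0$; constants, including those hidden in $O(\cdot)$, do not depend on $n$ (the quantities $d,K,\alpha,\beta$ are fixed). *)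

theory Defs
  imports "HOL-Probability.Probability" "Jordan_Normal_Form.Matrix"
begin

(* Matrices are those of Jordan_Normal_Form, so all indices are 0-based: the node set [n]
   is {..<n} and the communities are {..<K}. *)

section \<open>Assignments and permutation matrices\<close>

definition ones_vec :: "nat \<Rightarrow> real vec" where
  "ones_vec n = vec n (\<lambda>_. 1)"

definition frob_norm :: "real mat \<Rightarrow> real" where
  "frob_norm C = sqrt (\<Sum>i<dim_row C. \<Sum>j<dim_col C. (C $$ (i, j))\<^sup>2)"

definition balanced :: "nat \<Rightarrow> nat \<Rightarrow> real mat set" where
  "balanced n K = {H \<in> carrier_mat n K. elements_mat H \<subseteq> {0, 1} \<and>
     H *\<^sub>v ones_vec K = ones_vec n \<and>
     transpose_mat H *\<^sub>v ones_vec n = real (n div K) \<cdot>\<^sub>v ones_vec K}"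

definition assignments :: "nat \<Rightarrow> nat \<Rightarrow> real mat set" where
  "assignments n K = {H \<in> carrier_mat n K. \<forall>i<n. \<exists>k<K. row H i = unit_vec K k}"

definition perm_mats :: "nat \<Rightarrow> real mat set" where
  "perm_mats K =
     (\<lambda>\<pi>. mat K K (\<lambda>(i, j). if j = \<pi> i then 1 else 0)) ` {\<pi>. \<pi> permutes {..<K}}"

lemma finite_perm_mats: "finite (perm_mats K)"
  unfolding perm_mats_def by (intro finite_imageI finite_permutations) simp

lemma perm_mats_nonempty: "perm_mats K \<noteq> {}"
  unfolding perm_mats_def using permutes_id by blast

definition true_partitions :: "nat \<Rightarrow> real mat \<Rightarrow> real mat set" where
  "true_partitions K Hs = (\<lambda>Q. Hs * Q) ` perm_mats K"


section \<open>Tensors and the symmetric hypergraph stochastic block model\<close>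

(* An order-d tensor is a function of the index tuple, given as a list of length d; it is 0
   on every list that is not a d-tuple over {..<n}. *)
type_synonym tensor = "nat list \<Rightarrow> real"

definition adjacency_tensor :: "nat \<Rightarrow> nat \<Rightarrow> tensor \<Rightarrow> bool" where
  "adjacency_tensor n d A \<longleftrightarrow>
     range A \<subseteq> {0, 1} \<and>
     (\<forall>is. A is \<noteq> 0 \<longrightarrow> length is = d \<and> distinct is \<and> set is \<subseteq> {..<n}) \<and>
     (\<forall>is js. mset is = mset js \<longrightarrow> A is = A js)"

definition increasing_tuples :: "nat \<Rightarrow> nat \<Rightarrow> nat list set" where
  "increasing_tuples n d = {is. length is = d \<and> sorted_wrt (<) is \<and> set is \<subseteq> {..<n}}"

definition same_community :: "real mat \<Rightarrow> nat list \<Rightarrow> bool" where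
  "same_community H is \<longleftrightarrow> (\<forall>i\<in>set is. \<forall>j\<in>set is. row H i = row H j)"

(* The law of the random tensor: independent Bernoulli entries at the strictly increasing
   index tuples, extended symmetrically, with 0 at tuples with a repeated index. *)
definition hsbm :: "nat \<Rightarrow> nat \<Rightarrow> real \<Rightarrow> real \<Rightarrow> real mat \<Rightarrow> tensor pmf" where
  "hsbm n d p q Hs =
     map_pmf
       (\<lambda>X is. if length is = d \<and> distinct is \<and> set is \<subseteq> {..<n}
               then of_bool (X (sort is)) else 0)
       (Pi_pmf (increasing_tuples n d) False
          (\<lambda>is. bernoulli_pmf (if same_community Hs is then p else q)))"

(* The entry at (i, k) is the sum over (i_2, ..., i_d) of
   A(i, i_2, ..., i_d) H(i_2, k) ... H(i_d, k); the number of rows n and of columns K are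
   those of H. *)
definition tensor_apply :: "nat \<Rightarrow> tensor \<Rightarrow> real mat \<Rightarrow> real mat" where
  "tensor_apply d A H = mat (dim_row H) (dim_col H) (\<lambda>(i, k).
     \<Sum>js | length js = d - 1 \<and> set js \<subseteq> {..<dim_row H}.
       A (i # js) * (\<Prod>j\<leftarrow>js. H $$ (j, k)))"


section \<open>The projected tensor power method\<close>

definition proj :: "nat \<Rightarrow> nat \<Rightarrow> real mat \<Rightarrow> real mat set" where
  "proj n K C = {H. is_arg_min (\<lambda>H. frob_norm (H - C)) (\<lambda>H. H \<in> balanced n K) H}"

(* All possible outputs, over all choices of a minimiser in the projections. *)
definition ptpm_outputs ::
    "nat \<Rightarrow> nat \<Rightarrow> nat \<Rightarrow> tensor \<Rightarrow> nat \<Rightarrow> real mat \<Rightarrow> real mat set" where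
  "ptpm_outputs n d K A N H0 = {H (N + 1) | H.
     H 1 \<in> proj n K H0 \<and>
     (\<forall>t\<in>{1..N}. H (t + 1) \<in> proj n K (tensor_apply d A (H t)))}"


section \<open>Elementary operations\<close>

(* Running time is measured on a random access machine with structured control flow. A
   program uses finitely many integer arrays (a scalar variable is an array of which only
   one cell is used), and every constant, array access, addition, subtraction and
   comparison takes one step. Multiplication is deliberately not a unit-cost operation:
   it would allow numbers of exponential length to be built and manipulated cheaply. *)

type_synonym store = "nat \<Rightarrow> int \<Rightarrow> int"

datatype expr = Const int | Cell nat expr | Add expr expr | Sub expr expr

datatype prog =
    Skip
  | Put nat expr expr             (* Put a i e: cell i of array a becomes e *)
  | Seq prog prog
  | Cond expr expr prog prog      (* Cond e f P Q: if e < f then P else Q *)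
  | Loop expr expr prog           (* Loop e f P: while e < f do P *)

fun val :: "store \<Rightarrow> expr \<Rightarrow> int" where
  "val s (Const c) = c"
| "val s (Cell a i) = s a (val s i)"
| "val s (Add e f) = val s e + val s f"
| "val s (Sub e f) = val s e - val s f"

fun ops :: "expr \<Rightarrow> nat" where
  "ops (Const c) = 1"
| "ops (Cell a i) = ops i + 1"
| "ops (Add e f) = ops e + ops f + 1"
| "ops (Sub e f) = ops e + ops f + 1"

(* exec P s T s': started in store s, the program P halts after T steps in store s'. *)
inductive exec :: "prog \<Rightarrow> store \<Rightarrow> nat \<Rightarrow> store \<Rightarrow> bool" where
  exec_skip: "exec Skip s 1 s"
| exec_put: "exec (Put a i e) s (ops i + ops e + 1) (s(a := (s a)(val s i := val s e)))"
| exec_seq: "exec P s T s' \<Longrightarrow> exec Q s' T' s'' \<Longrightarrow> exec (Seq P Q) s (T + T') s''"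
| exec_cond_true:
    "val s e < val s f \<Longrightarrow> exec P s T s' \<Longrightarrow> exec (Cond e f P Q) s (ops e + ops f + 1 + T) s'"
| exec_cond_false:
    "\<not> val s e < val s f \<Longrightarrow> exec Q s T s' \<Longrightarrow>
     exec (Cond e f P Q) s (ops e + ops f + 1 + T) s'"
| exec_loop_true:
    "val s e < val s f \<Longrightarrow> exec P s T s' \<Longrightarrow> exec (Loop e f P) s' T' s'' \<Longrightarrow>
     exec (Loop e f P) s (ops e + ops f + 1 + T + T') s''"
| exec_loop_false:
    "\<not> val s e < val s f \<Longrightarrow> exec (Loop e f P) s (ops e + ops f + 1) s"

(* es lists the index tuples of the nonzero entries of A, in any order. *)
definition lists_nonzeros :: "tensor \<Rightarrow> nat list list \<Rightarrow> bool" where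
  "lists_nonzeros A es \<longleftrightarrow> distinct es \<and> set es = {is. A is \<noteq> 0}"

(* Input: n, N and the number of nonzero entries in cells 0, 1, 2 of array 0; H0 row by row
   in array 1; the index tuples of the nonzero entries (all of value 1) one after the other
   in array 2. All other cells are 0. *)
definition ptpm_input ::
    "nat \<Rightarrow> nat \<Rightarrow> nat \<Rightarrow> nat \<Rightarrow> nat list list \<Rightarrow> real mat \<Rightarrow> store" where
  "ptpm_input n d K N es H0 = (\<lambda>a x.
     if x < 0 then 0
     else if a = 0 \<and> x < 3 then [int n, int N, int (length es)] ! nat x
     else if a = 1 \<and> x < int (n * K) then \<lfloor>H0 $$ (nat x div K, nat x mod K)\<rfloor>
     else if a = 2 \<and> x < int (length es * d) then int (es ! (nat x div d) ! (nat x mod d))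
     else 0)"

(* The output matrix is found row by row in array 3. *)
definition ptpm_result :: "nat \<Rightarrow> nat \<Rightarrow> store \<Rightarrow> real mat" where
  "ptpm_result n K s = mat n K (\<lambda>(i, k). of_int (s 3 (int (i * K + k))))"

(* P implements PTPM for tensors of order d and K communities: on every admissible input
   it halts, and its output is one that PTPM can produce. *)
definition implements_ptpm :: "nat \<Rightarrow> nat \<Rightarrow> prog \<Rightarrow> bool" where
  "implements_ptpm d K P \<longleftrightarrow>
     (\<forall>n N A es H0. 0 < n \<longrightarrow> K dvd n \<longrightarrow> 0 < N \<longrightarrow> adjacency_tensor n d A \<longrightarrow>
        lists_nonzeros A es \<longrightarrow> H0 \<in> assignments n K \<longrightarrow>
        (\<exists>T s. exec P (ptpm_input n d K N es H0) T s \<and>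
               ptpm_result n K s \<in> ptpm_outputs n d K A N H0))"

end

theory Submission
  imports Defs "HOL-Combinatorics.Multiset_Permutations" "HOL-Real_Asymp.Real_Asymp"
begin

text \<open>
The proof has a probabilistic half, which shows that the iterates contract to the planted
partition, and an algorithmic half, which shows that one iteration costs O(n log n).

Contraction. Let g be the planted assignment with its communities renamed to match the initial
point, and let S and S' be the sets of nodes on which the iterates before and after one
iteration disagree with g. As the new iterate has a score at least that of g, the score lost by
moving the nodes of S' away from g has to be made up by tuples that meet S. If at g every node
prefers its own community by at least a multiple of log n (has_gap), then |S'| log n is
bounded by a constant times the number of tuples with their first node in S' and another node in S
(maximizer_errors). In a sparse random hypergraph that is impossible for all pairs of sets with
|S| at most a small fraction of n and |S'| at least |S| / (c log n) (expands). So every iteration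
divides the number of errors by a multiple of log n (maximizer_contracts), and about
log n / log log n of them leave no error at all (ptpm_outputs_subset). The initial radius is
allowed to be small because the constant that bounds it may be chosen small.

Probability. The gap, the expansion and a logarithmic bound for the degrees all come from one
exponential moment estimate (bernoulli_chernoff). For the gap, the optimal exponent is the
squared difference of the roots of the two densities, and the hypothesis says that it beats the
union bound over the nodes. For the expansion, a deviation factor of n / |S| makes each failure
probability small enough for the union bound over all pairs of sets.

Running time. Projecting onto the balanced assignments is a transportation problem with K
communities. It is solved by an auction: communities have integer prices, a node in an
overfull community moves to a community where its score minus price is best, and overfull
communities in which all nodes are content raise their price. Scores are multiplied by
K + 1, so that the slack of one unit per move cannot add up to a real loss
(almost_stable_optimal), and so that the possible moves at fixed prices form no cycle, whence K
sweeps over the nodes suffice between two price changes (sweeps_settle). While a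
community is overfull, another one is underfull and still has price zero, so prices exceed the
largest score by at most one, and the largest score is at most a constant times the largest
degree. So a projection takes O(n times degree) steps; the program is correct for every input,
and the degree bound is what makes it fast.
\<close>

section \<open>Balanced assignment by an auction\<close>

definition members :: "nat \<Rightarrow> (nat \<Rightarrow> nat) \<Rightarrow> nat \<Rightarrow> nat set" where
  "members n h a = {i. i < n \<and> h i = a}"

definition gain :: "(nat \<Rightarrow> nat \<Rightarrow> int) \<Rightarrow> (nat \<Rightarrow> int) \<Rightarrow> nat \<Rightarrow> nat \<Rightarrow> int" where
  "gain C \<pi> i k = C i k - \<pi> k"

text \<open>A left-to-right scan that starts with the value a and replaces it only by strictly better
indices below k. So a is kept if it is optimal already.\<close>

primrec best :: "(nat \<Rightarrow> int) \<Rightarrow> nat \<Rightarrow> nat \<Rightarrow> nat" where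
  "best g a 0 = a"
| "best g a (Suc k) = (if g (best g a k) < g k then k else best g a k)"

definition overfull :: "nat \<Rightarrow> nat \<Rightarrow> (nat \<Rightarrow> nat) \<Rightarrow> nat \<Rightarrow> bool" where
  "overfull n m h a \<longleftrightarrow> m < card (members n h a)"

definition move_item ::
    "nat \<Rightarrow> nat \<Rightarrow> nat \<Rightarrow> (nat \<Rightarrow> nat \<Rightarrow> int) \<Rightarrow> (nat \<Rightarrow> int) \<Rightarrow> nat \<Rightarrow> (nat \<Rightarrow> nat) \<Rightarrow> nat \<Rightarrow> nat" where
  "move_item n m K C \<pi> i h =
     (if overfull n m h (h i) then h(i := best (gain C \<pi> i) (h i) K) else h)"

primrec sweep ::
    "nat \<Rightarrow> nat \<Rightarrow> nat \<Rightarrow> (nat \<Rightarrow> nat \<Rightarrow> int) \<Rightarrow> (nat \<Rightarrow> int) \<Rightarrow> nat \<Rightarrow> (nat \<Rightarrow> nat) \<Rightarrow> nat \<Rightarrow> nat" where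
  "sweep n m K C \<pi> 0 h = h"
| "sweep n m K C \<pi> (Suc i) h = move_item n m K C \<pi> i (sweep n m K C \<pi> i h)"

definition raise_prices :: "nat \<Rightarrow> nat \<Rightarrow> (nat \<Rightarrow> nat) \<Rightarrow> (nat \<Rightarrow> int) \<Rightarrow> nat \<Rightarrow> int" where
  "raise_prices n m h \<pi> k = (if overfull n m h k then \<pi> k + 1 else \<pi> k)"

text \<open>Complementary slackness up to one unit: the complete form would force ties to be broken
globally, whereas this form is kept by local moves.\<close>

definition almost_stable ::
    "nat \<Rightarrow> nat \<Rightarrow> (nat \<Rightarrow> nat \<Rightarrow> int) \<Rightarrow> (nat \<Rightarrow> int) \<Rightarrow> (nat \<Rightarrow> nat) \<Rightarrow> bool" where
  "almost_stable n K C \<pi> h \<longleftrightarrow>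
     (\<forall>i<n. h i < K \<and> (\<forall>k<K. gain C \<pi> i k \<le> gain C \<pi> i (h i) + 1))"

text \<open>The condition under which the price of a may rise by one unit without destroying the slack
of at most one.\<close>

definition settled ::
    "nat \<Rightarrow> nat \<Rightarrow> nat \<Rightarrow> (nat \<Rightarrow> nat \<Rightarrow> int) \<Rightarrow> (nat \<Rightarrow> int) \<Rightarrow> (nat \<Rightarrow> nat) \<Rightarrow> nat \<Rightarrow> bool" where
  "settled n m K C \<pi> h a \<longleftrightarrow> overfull n m h a \<longrightarrow>
     (\<forall>i\<in>members n h a. \<forall>k<K. gain C \<pi> i k \<le> gain C \<pi> i a)"

definition balanced_fun :: "nat \<Rightarrow> nat \<Rightarrow> (nat \<Rightarrow> nat) \<Rightarrow> bool" where
  "balanced_fun n K h \<longleftrightarrow>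
     (\<forall>i<n. h i < K) \<and> (\<forall>k<K. card (members n h k) = n div K)"

lemma finite_members [simp]: "finite (members n h a)"
  by (simp add: members_def)

lemma best_ge: "j < k \<Longrightarrow> g j \<le> g (best g a k)" "g a \<le> g (best g a k)"
proof (induction k)
  case (Suc k)
  { case 1 then show ?case using Suc by (cases "j = k") auto }
  { case 2 then show ?case using Suc by auto }
qed auto

lemma best_range: "best g a k = a \<or> best g a k < k \<and> g a < g (best g a k)"
  by (induction k) auto

lemma best_less: "a < K \<Longrightarrow> best g a K < K"
  using best_range[of g a K] by auto

text \<open>Any charge per community sums over a balanced assignment to the same total. This is why prices
do not influence which balanced assignments are optimal.\<close>

lemma sum_over_members:
  fixes f :: "nat \<Rightarrow> 'b::comm_semiring_1"
  assumes "\<forall>i<n. h i < K"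
  shows "(\<Sum>i<n. f (h i)) = (\<Sum>k<K. of_nat (card (members n h k)) * f k)"
proof -
  have "(\<Sum>i<n. f (h i)) = (\<Sum>k<K. \<Sum>i\<in>{i. i \<in> {..<n} \<and> h i = k}. f (h i))"
    using assms by (intro sum.group[symmetric]) auto
  also have "\<dots> = (\<Sum>k<K. of_nat (card (members n h k)) * f k)"
    by (intro sum.cong) (auto simp: members_def)
  finally show ?thesis .
qed

lemma sum_card_members:
  assumes "\<forall>i<n. h i < K"
  shows "(\<Sum>k<K. card (members n h k)) = n"
  using sum_over_members[OF assms, of "\<lambda>_. 1::nat"] by simp

lemma members_upd:
  "i < n \<Longrightarrow> members n (h(i := b)) c =
     (if c = b then insert i (members n h c) else members n h c - {i})"
  by (auto simp: members_def)

lemma card_members_upd: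
  assumes "i < n" "b \<noteq> h i"
  shows "card (members n (h(i := b)) b) = card (members n h b) + 1"
    and "card (members n (h(i := b)) (h i)) = card (members n h (h i)) - 1"
    and "c \<noteq> b \<Longrightarrow> c \<noteq> h i \<Longrightarrow> members n (h(i := b)) c = members n h c"
  using assms by (auto simp: members_upd) (auto simp: members_def)

text \<open>Scores are multiples of K + 1, which exceeds the number of communities. This makes room for
a slack of one unit for each of up to K moves.\<close>

locale auction =
  fixes n m K :: nat and C :: "nat \<Rightarrow> nat \<Rightarrow> int" and M :: int
  assumes K_pos: "0 < K" and n_eq: "n = K * m" and m_pos: "0 < m"
    and C_dvd: "i < n \<Longrightarrow> k < K \<Longrightarrow> int (K + 1) dvd C i k"
    and C_nonneg: "i < n \<Longrightarrow> k < K \<Longrightarrow> 0 \<le> C i k"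
    and C_le: "i < n \<Longrightarrow> k < K \<Longrightarrow> C i k \<le> M"
begin

text \<open>K prices cannot occupy all K + 1 residue classes.\<close>

lemma unused_residue:
  "\<exists>e. \<forall>k<K. (\<pi> k - e) mod int (K + 1) \<noteq> (0::int)"
proof -
  let ?R = "(\<lambda>k. \<pi> k mod int (K + 1)) ` {..<K}"
  have "card ?R \<le> K" using card_image_le[of "{..<K}"] by fastforce
  then have "card ?R < card {0..int K}" by simp
  then have "\<not> {0..int K} \<subseteq> ?R" using card_mono[of ?R "{0..int K}"] by auto
  then obtain e where "e \<in> {0..int K}" and e3: "e \<notin> ?R" by blast
  then have e: "0 \<le> e" "e \<le> int K" by auto
  have "(\<pi> k - e) mod int (K + 1) \<noteq> 0" if "k < K" for k
  proof
    assume "(\<pi> k - e) mod int (K + 1) = 0"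
    then have "\<pi> k mod int (K + 1) = e mod int (K + 1)"
      by (simp add: mod_eq_dvd_iff mod_0_imp_dvd)
    also have "\<dots> = e" using e by (intro mod_pos_pos_trivial) auto
    finally show False using e3 that by blast
  qed
  then show ?thesis by blast
qed

text \<open>A move leads to a community whose price is one less modulo K + 1, because all scores vanish
modulo K + 1. So the depth, which counts the residue classes downwards from the class e, grows
by one with every move as long as no price lies in the class e. Hence moves at fixed prices
cannot run in circles.\<close>

definition depth :: "(nat \<Rightarrow> int) \<Rightarrow> int \<Rightarrow> nat \<Rightarrow> nat" where
  "depth \<pi> e a = nat ((e - 1 - \<pi> a) mod int (K + 1))"

lemma depth_less:
  assumes "(\<pi> a - e) mod int (K + 1) \<noteq> 0"
  shows "depth \<pi> e a < K"
proof -
  let ?x = "(e - 1 - \<pi> a) mod int (K + 1)"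
  have "?x \<noteq> int K"
  proof
    assume "?x = int K"
    then have "(e - 1 - \<pi> a) mod int (K + 1) = (-1) mod int (K + 1)"
      by (simp add: zmod_minus1)
    then have "int (K + 1) dvd e - \<pi> a" by (simp add: mod_eq_dvd_iff)
    then have "int (K + 1) dvd \<pi> a - e" by (simp only: dvd_diff_commute)
    then show False using assms by (simp add: dvd_eq_mod_eq_0)
  qed
  moreover have "0 \<le> ?x" "?x < int (K + 1)"
    by (simp_all del: of_nat_add of_nat_Suc)
  ultimately have "0 \<le> ?x" "?x < int K" by linarith+
  then show ?thesis unfolding depth_def by linarith
qed

lemma depth_Suc:
  assumes "\<forall>k<K. (\<pi> k - e) mod int (K + 1) \<noteq> 0" "a < K"
    "int (K + 1) dvd \<pi> b - (\<pi> a - 1)"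
  shows "depth \<pi> e b = Suc (depth \<pi> e a)"
proof -
  let ?x = "(e - 1 - \<pi> a) mod int (K + 1)"
  have "?x < int K" "0 \<le> ?x"
    using depth_less[of \<pi> a e] assms by (auto simp: depth_def nat_less_iff)
  have "(e - 1 - \<pi> b) mod int (K + 1) = (?x + 1) mod int (K + 1)"
  proof -
    have "int (K + 1) dvd (e - 1 - \<pi> b) - (e - 1 - \<pi> a + 1)"
      using assms(3) by (metis (no_types, opaque_lifting) diff_diff_eq2 diff_add_eq add_diff_cancel_right'
        diff_diff_add dvd_diff_commute add.commute minus_diff_eq diff_minus_eq_add uminus_add_conv_diff)
    then have "(e - 1 - \<pi> b) mod int (K + 1) = (e - 1 - \<pi> a + 1) mod int (K + 1)"
      by (simp only: mod_eq_dvd_iff)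
    then show ?thesis by (simp only: mod_add_left_eq)
  qed
  also have "\<dots> = ?x + 1" using \<open>?x < int K\<close> \<open>0 \<le> ?x\<close>
    by (intro mod_pos_pos_trivial) auto
  finally show ?thesis unfolding depth_def using \<open>0 \<le> ?x\<close> by (simp add: nat_add_distrib)
qed

text \<open>As no profit exceeds the current one by more than one unit, a move gains exactly one unit, and
that fixes the price difference modulo K + 1.\<close>

lemma move_item_cases:
  assumes st: "almost_stable n K C \<pi> h" and i: "i < n"
  obtains (stay) "move_item n m K C \<pi> i h = h"
      "overfull n m h (h i) \<longrightarrow> (\<forall>k<K. gain C \<pi> i k \<le> gain C \<pi> i (h i))"
  | (move) b where "move_item n m K C \<pi> i h = h(i := b)" "b < K" "b \<noteq> h i"
      "overfull n m h (h i)" "gain C \<pi> i b = gain C \<pi> i (h i) + 1"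
      "\<forall>k<K. gain C \<pi> i k \<le> gain C \<pi> i b"
      "int (K + 1) dvd \<pi> b - (\<pi> (h i) - 1)"
proof (cases "overfull n m h (h i) \<and> best (gain C \<pi> i) (h i) K \<noteq> h i")
  case False
  show thesis
  proof (rule stay)
    show "move_item n m K C \<pi> i h = h" using False by (auto simp: move_item_def)
    show "overfull n m h (h i) \<longrightarrow> (\<forall>k<K. gain C \<pi> i k \<le> gain C \<pi> i (h i))"
      using False best_ge(1)[of _ K "gain C \<pi> i" "h i"] by auto
  qed
next
  case True
  define b where "b = best (gain C \<pi> i) (h i) K"
  have hK: "h i < K" using st i by (auto simp: almost_stable_def)
  have b: "b < K" "gain C \<pi> i (h i) < gain C \<pi> i b"
    using True best_range[of "gain C \<pi> i" "h i" K] by (auto simp: b_def)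
  have eq: "gain C \<pi> i b = gain C \<pi> i (h i) + 1"
    using st i b by (force simp: almost_stable_def)
  show thesis
  proof (rule move)
    show "move_item n m K C \<pi> i h = h(i := b)" using True by (auto simp: move_item_def b_def)
    show "int (K + 1) dvd \<pi> b - (\<pi> (h i) - 1)"
    proof -
      have "\<pi> b - (\<pi> (h i) - 1) = C i b - C i (h i)" using eq by (simp add: gain_def)
      then show ?thesis using C_dvd[OF i b(1)] C_dvd[OF i hK] by (simp only: dvd_diff)
    qed
    show "\<forall>k<K. gain C \<pi> i k \<le> gain C \<pi> i b" unfolding b_def using best_ge by blast
  qed (use b eq True in auto)
qed

lemma move_item_almost_stable:
  assumes "almost_stable n K C \<pi> h" "i < n"
  shows "almost_stable n K C \<pi> (move_item n m K C \<pi> i h)"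
  using assms(1)
proof (rule move_item_cases[OF _ assms(2)])
  fix b assume "move_item n m K C \<pi> i h = h(i := b)" "b < K"
    "\<forall>k<K. gain C \<pi> i k \<le> gain C \<pi> i b"
  then show ?thesis using assms(1) by (force simp: almost_stable_def)
qed (use assms in simp)

text \<open>Only overfull communities lose a node, so none ever becomes underfull.\<close>

lemma move_item_underfull:
  assumes "almost_stable n K C \<pi> h" "i < n"
    "card (members n (move_item n m K C \<pi> i h) c) < m"
  shows "card (members n h c) < m"
  using assms(1)
proof (rule move_item_cases[OF _ assms(2)])
  fix b assume *: "move_item n m K C \<pi> i h = h(i := b)" "b \<noteq> h i" "overfull n m h (h i)"
  show ?thesis
    using card_members_upd[where h = h and b = b, OF assms(2) *(2)] assms(3) *
    by (cases "c = b"; cases "c = h i") (auto simp: overfull_def)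
qed (use assms in simp)

lemma sweep_almost_stable:
  assumes "almost_stable n K C \<pi> h" "i \<le> n"
  shows "almost_stable n K C \<pi> (sweep n m K C \<pi> i h)"
  using assms by (induction i) (auto intro: move_item_almost_stable)

lemma sweep_underfull:
  assumes "almost_stable n K C \<pi> h" "i \<le> n"
    "card (members n (sweep n m K C \<pi> i h) c) < m"
  shows "card (members n h c) < m"
  using assms(2,3)
proof (induction i)
  case (Suc i)
  then have "card (members n (sweep n m K C \<pi> i h) c) < m"
    using move_item_underfull[OF sweep_almost_stable[OF assms(1)], of i i c] by simp
  then show ?case using Suc by simp
qed simp

text \<open>If all communities of depth less than t are settled, they send out nothing. So a community of
depth t receives nothing during the next sweep: it either drops to its capacity and stays
there, or it is overfull all the time and each of its nodes is inspected and found content.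
Deeper communities may still be in disorder.\<close>

lemma sweep_settles:
  assumes e: "\<forall>k<K. (\<pi> k - e) mod int (K + 1) \<noteq> 0"
    and st: "almost_stable n K C \<pi> h"
    and set: "\<forall>a<K. depth \<pi> e a < t \<longrightarrow> settled n m K C \<pi> h a"
  shows "\<forall>a<K. depth \<pi> e a < Suc t \<longrightarrow> settled n m K C \<pi> (sweep n m K C \<pi> n h) a"
proof -
  have "(\<forall>a<K. depth \<pi> e a < t \<longrightarrow> settled n m K C \<pi> (sweep n m K C \<pi> j h) a) \<and>
    (\<forall>a<K. depth \<pi> e a = t \<longrightarrow> overfull n m (sweep n m K C \<pi> j h) a \<longrightarrow>
       (\<forall>i<j. sweep n m K C \<pi> j h i = a \<longrightarrow> (\<forall>k<K. gain C \<pi> i k \<le> gain C \<pi> i a)))"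
    if "j \<le> n" for j
    using that
  proof (induction j)
    case (Suc j)
    define g where "g = sweep n m K C \<pi> j h"
    have j: "j < n" using Suc.prems by simp
    have stg: "almost_stable n K C \<pi> g"
      unfolding g_def using sweep_almost_stable st Suc.prems by simp
    have IH1: "\<And>a. a < K \<Longrightarrow> depth \<pi> e a < t \<Longrightarrow> settled n m K C \<pi> g a"
      and IH2: "\<And>a i k. a < K \<Longrightarrow> depth \<pi> e a = t \<Longrightarrow> overfull n m g a \<Longrightarrow> i < j \<Longrightarrow> g i = a
         \<Longrightarrow> k < K \<Longrightarrow> gain C \<pi> i k \<le> gain C \<pi> i a"
      using Suc by (auto simp: g_def)
    from stg show ?case
    proof (rule move_item_cases[OF _ j])
      assume *: "move_item n m K C \<pi> j g = g"
        "overfull n m g (g j) \<longrightarrow> (\<forall>k<K. gain C \<pi> j k \<le> gain C \<pi> j (g j))"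
      have "sweep n m K C \<pi> (Suc j) h = g" using * by (simp add: g_def)
      then show ?thesis using IH1 IH2 *(2) by (auto simp: less_Suc_eq)
    next
      fix b assume *: "move_item n m K C \<pi> j g = g(j := b)" "b < K" "b \<noteq> g j"
        "overfull n m g (g j)" "gain C \<pi> j b = gain C \<pi> j (g j) + 1"
        "\<forall>k<K. gain C \<pi> j k \<le> gain C \<pi> j b" "int (K + 1) dvd \<pi> b - (\<pi> (g j) - 1)"
      have gj: "g j < K" using stg j by (auto simp: almost_stable_def)
      have eq: "sweep n m K C \<pi> (Suc j) h = g(j := b)" using * by (simp add: g_def)
      have "\<not> settled n m K C \<pi> g (g j)"
        using *(2,4,5) j by (force simp: settled_def members_def)
      then have da: "t \<le> depth \<pi> e (g j)" using IH1 gj by force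
      have db: "depth \<pi> e b = Suc (depth \<pi> e (g j))"
        using depth_Suc[OF e gj *(7)] .
      note mem = card_members_upd[where h = g and b = b, OF j *(3)]
      have "settled n m K C \<pi> (g(j := b)) a" if "a < K" "depth \<pi> e a < t" for a
      proof -
        have "members n (g(j := b)) a = members n g a" using mem(3)[of a] that da db by fastforce
        then show ?thesis using IH1[OF that] by (simp add: settled_def overfull_def)
      qed
      moreover have "gain C \<pi> i k \<le> gain C \<pi> i a"
        if a: "a < K" "depth \<pi> e a = t" and ov: "overfull n m (g(j := b)) a"
          and i: "i < Suc j" "(g(j := b)) i = a" and k: "k < K" for a i k
      proof -
        have "a \<noteq> b" using da db a by auto
        then have "i \<noteq> j" using i by auto
        then have ij: "i < j" "g i = a" using i by auto
        have "overfull n m g a"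
        proof (cases "a = g j")
          case False
          then show ?thesis using ov mem(3)[of a] \<open>a \<noteq> b\<close> by (simp add: overfull_def)
        qed (use * in simp)
        then show ?thesis using IH2 a ij k by blast
      qed
      ultimately show ?thesis unfolding eq by blast
    qed
  qed (use set in auto)
  from this[of n] show ?thesis
    by (auto simp: less_Suc_eq settled_def members_def)
qed

lemma sweeps_settle:
  assumes st: "almost_stable n K C \<pi> h" and a: "a < K"
  shows "settled n m K C \<pi> ((sweep n m K C \<pi> n ^^ K) h) a"
proof -
  obtain e where e: "\<forall>k<K. (\<pi> k - e) mod int (K + 1) \<noteq> 0" using unused_residue by blast
  have "almost_stable n K C \<pi> ((sweep n m K C \<pi> n ^^ t) h) \<and>
     (\<forall>a<K. depth \<pi> e a < t \<longrightarrow> settled n m K C \<pi> ((sweep n m K C \<pi> n ^^ t) h) a)" for t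
  proof (induction t)
    case (Suc t)
    then show ?case using sweep_settles[OF e, of "(sweep n m K C \<pi> n ^^ t) h" t]
      sweep_almost_stable[of \<pi> "(sweep n m K C \<pi> n ^^ t) h" n] by simp
  qed (use st in simp)
  then show ?thesis using depth_less e a by blast
qed

lemma sweeps_almost_stable:
  assumes "almost_stable n K C \<pi> h"
  shows "almost_stable n K C \<pi> ((sweep n m K C \<pi> n ^^ t) h)"
  using assms by (induction t) (auto intro: sweep_almost_stable)

lemma sweeps_underfull:
  assumes "almost_stable n K C \<pi> h"
    "card (members n ((sweep n m K C \<pi> n ^^ t) h) c) < m"
  shows "card (members n h c) < m"
  using assms(2)
proof (induction t)
  case (Suc t)
  then show ?case using sweep_underfull[OF sweeps_almost_stable[OF assms(1)], of n t c] by simp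
qed simp

lemma raise_almost_stable:
  assumes st: "almost_stable n K C \<pi> h" and "\<forall>a<K. settled n m K C \<pi> h a"
  shows "almost_stable n K C (raise_prices n m h \<pi>) h"
  unfolding almost_stable_def
proof (intro allI impI conjI)
  fix i assume i: "i < n"
  then show hi: "h i < K" using st by (simp add: almost_stable_def)
  fix k assume k: "k < K"
  have 1: "gain C \<pi> i k \<le> gain C \<pi> i (h i) + 1" using st i k by (simp add: almost_stable_def)
  have 2: "overfull n m h (h i) \<Longrightarrow> gain C \<pi> i k \<le> gain C \<pi> i (h i)"
    using assms(2) i hi k by (auto simp: settled_def members_def)
  show "gain C (raise_prices n m h \<pi>) i k \<le> gain C (raise_prices n m h \<pi>) i (h i) + 1"
    using 1 2 by (auto simp: gain_def raise_prices_def)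
qed

text \<open>An underfull community has never been overfull, so its price is still zero. Together with the
fact that overfull communities have content nodes before they raise their price, this bounds
all prices.\<close>

definition prices_ok :: "(nat \<Rightarrow> int) \<Rightarrow> (nat \<Rightarrow> nat) \<Rightarrow> bool" where
  "prices_ok \<pi> h \<longleftrightarrow> (\<forall>k<K. 0 \<le> \<pi> k \<and> \<pi> k \<le> M + 1 \<and> (card (members n h k) < m \<longrightarrow> \<pi> k = 0))"

lemma overfull_imp_underfull:
  assumes "\<forall>i<n. h i < K" "a < K" "overfull n m h a"
  shows "\<exists>b<K. card (members n h b) < m"
proof (rule ccontr)
  assume "\<not> ?thesis"
  then have *: "\<forall>b<K. m \<le> card (members n h b)" by auto
  have "(\<Sum>k<K. m) < (\<Sum>k<K. card (members n h k))"
    using * assms by (intro sum_strict_mono_ex1) (auto simp: overfull_def)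
  then show False using sum_card_members[OF assms(1)] n_eq by simp
qed

text \<open>A content node of an overfull community prefers it to an underfull one, which is free. So the
price charged does not exceed the score of the node.\<close>

lemma raise_prices_ok:
  assumes st: "almost_stable n K C \<pi> h" and "\<forall>a<K. settled n m K C \<pi> h a"
    and ok: "prices_ok \<pi> h"
  shows "prices_ok (raise_prices n m h \<pi>) h"
  unfolding prices_ok_def
proof (intro allI impI)
  fix k assume k: "k < K"
  have 1: "0 \<le> \<pi> k \<and> \<pi> k \<le> M + 1 \<and> (card (members n h k) < m \<longrightarrow> \<pi> k = 0)"
    using ok k by (simp add: prices_ok_def)
  have "\<pi> k \<le> M" if ov: "overfull n m h k"
  proof -
    have "\<forall>i<n. h i < K" using st by (simp add: almost_stable_def)
    then obtain b where b: "b < K" "card (members n h b) < m"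
      using overfull_imp_underfull k ov by blast
    have "members n h k \<noteq> {}" using ov by (auto simp: overfull_def)
    then obtain i where i: "i < n" "h i = k" by (auto simp: members_def)
    have "gain C \<pi> i b \<le> gain C \<pi> i k"
      using assms(2) k ov b i by (auto simp: settled_def members_def)
    moreover have "\<pi> b = 0" using ok b by (simp add: prices_ok_def)
    ultimately show ?thesis
      using C_nonneg[OF i(1) b(1)] C_le[OF i(1) k] by (simp add: gain_def)
  qed
  then show "0 \<le> raise_prices n m h \<pi> k \<and> raise_prices n m h \<pi> k \<le> M + 1 \<and>
      (card (members n h k) < m \<longrightarrow> raise_prices n m h \<pi> k = 0)"
    using 1 by (auto simp: raise_prices_def overfull_def)
qed

lemma sweeps_prices_ok:
  assumes "almost_stable n K C \<pi> h" "prices_ok \<pi> h"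
  shows "prices_ok \<pi> ((sweep n m K C \<pi> n ^^ t) h)"
  using assms sweeps_underfull by (auto simp: prices_ok_def)

lemma balanced_if_not_overfull:
  assumes "\<forall>i<n. h i < K" "\<forall>a<K. \<not> overfull n m h a"
  shows "balanced_fun n K h"
proof -
  have "card (members n h k) = m" if k: "k < K" for k
  proof (rule ccontr)
    assume "card (members n h k) \<noteq> m"
    then have "card (members n h k) < m" using assms k by (auto simp: overfull_def not_less)
    then have "(\<Sum>k<K. card (members n h k)) < (\<Sum>k<K. m)"
      using assms k by (intro sum_strict_mono_ex1) (auto simp: overfull_def not_less)
    then show False using sum_card_members[OF assms(1)] n_eq by simp
  qed
  then show ?thesis using assms n_eq K_pos by (simp add: balanced_fun_def)
qed

text \<open>Dividing prices by K + 1 and rounding turns the slack of one unit into exact complementary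
slackness, provided that no price is a multiple of K + 1; a shift by an unused residue class
achieves this. The rounded prices certify optimality by linear programming duality.\<close>

lemma almost_stable_optimal:
  assumes st: "almost_stable n K C \<pi> h" and bal: "balanced_fun n K h"
    and bal': "balanced_fun n K h'"
  shows "(\<Sum>i<n. C i (h' i)) \<le> (\<Sum>i<n. C i (h i))"
proof -
  let ?L = "int (K + 1)"
  obtain e where e: "\<forall>k<K. (\<pi> k - e) mod ?L \<noteq> 0" using unused_residue by blast
  define \<rho> where "\<rho> k = (\<pi> k - e) div ?L" for k
  have low: "?L * \<rho> k + 1 \<le> \<pi> k - e" and up: "\<pi> k - e \<le> ?L * \<rho> k + int K" if "k < K" for k
  proof -
    have eq: "\<pi> k - e = ?L * \<rho> k + (\<pi> k - e) mod ?L"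
      unfolding \<rho>_def by (rule mult_div_mod_eq[symmetric])
    have ran: "0 \<le> (\<pi> k - e) mod ?L" "(\<pi> k - e) mod ?L < ?L" "(\<pi> k - e) mod ?L \<noteq> 0"
      using e that by (simp_all del: of_nat_add of_nat_Suc)
    show "?L * \<rho> k + 1 \<le> \<pi> k - e" "\<pi> k - e \<le> ?L * \<rho> k + int K" using eq ran by linarith+
  qed
  \<comment> \<open>The slack allows the left side to exceed the right one by at most K, but both are multiples of K + 1.\<close>
  have key: "C i (h' i) - ?L * \<rho> (h' i) \<le> C i (h i) - ?L * \<rho> (h i)" if i: "i < n" for i
  proof -
    have K: "h i < K" "h' i < K" using bal bal' i by (auto simp: balanced_fun_def)
    obtain c c' where c: "C i (h i) = ?L * c" "C i (h' i) = ?L * c'"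
      using C_dvd[OF i K(1)] C_dvd[OF i K(2)] by (auto simp only: dvd_def)
    have "gain C \<pi> i (h' i) \<le> gain C \<pi> i (h i) + 1" using st i K by (simp add: almost_stable_def)
    then have "?L * c' - ?L * \<rho> (h' i) - int K \<le> ?L * c - ?L * \<rho> (h i)"
      using low[OF K(1)] up[OF K(2)] by (simp add: gain_def c algebra_simps)
    then have "?L * (c' - \<rho> (h' i) - (c - \<rho> (h i))) < ?L * 1" by (simp add: algebra_simps)
    then have "c' - \<rho> (h' i) - (c - \<rho> (h i)) < 1" by (subst (asm) mult_less_cancel_left_pos) simp_all
    then have "c' - \<rho> (h' i) \<le> c - \<rho> (h i)" by simp
    then have "?L * (c' - \<rho> (h' i)) \<le> ?L * (c - \<rho> (h i))" by (intro mult_left_mono) auto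
    then show ?thesis unfolding c by (simp add: right_diff_distrib)
  qed
  have eq: "(\<Sum>i<n. ?L * \<rho> (h' i)) = (\<Sum>i<n. ?L * \<rho> (h i))"
  proof -
    have 1: "\<forall>i<n. h i < K" "\<forall>i<n. h' i < K" using bal bal' by (auto simp: balanced_fun_def)
    show ?thesis
      unfolding sum_over_members[OF 1(1), where f = "\<lambda>k. ?L * \<rho> k"]
        sum_over_members[OF 1(2), where f = "\<lambda>k. ?L * \<rho> k"]
      using bal bal' by (intro sum.cong) (auto simp: balanced_fun_def)
  qed
  have "(\<Sum>i<n. C i (h' i) - ?L * \<rho> (h' i)) \<le> (\<Sum>i<n. C i (h i) - ?L * \<rho> (h i))"
    using key by (intro sum_mono) auto
  then show ?thesis using eq by (simp only: sum_subtractf)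
qed

end

section \<open>Programs and their running time\<close>

text \<open>Total correctness with a time bound: a Hoare triple with start state s.\<close>

definition runs :: "prog \<Rightarrow> store \<Rightarrow> nat \<Rightarrow> (store \<Rightarrow> bool) \<Rightarrow> bool" where
  "runs P s B Q \<longleftrightarrow> (\<exists>T s'. exec P s T s' \<and> T \<le> B \<and> Q s')"

fun loop_free :: "prog \<Rightarrow> bool" where
  "loop_free (Seq P Q) \<longleftrightarrow> loop_free P \<and> loop_free Q"
| "loop_free (Cond e f P Q) \<longleftrightarrow> loop_free P \<and> loop_free Q"
| "loop_free (Loop e f P) \<longleftrightarrow> False"
| "loop_free P \<longleftrightarrow> True"

fun effect :: "prog \<Rightarrow> store \<Rightarrow> store" where
  "effect (Put a i e) s = s(a := (s a)(val s i := val s e))"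
| "effect (Seq P Q) s = effect Q (effect P s)"
| "effect (Cond e f P Q) s = (if val s e < val s f then effect P s else effect Q s)"
| "effect P s = s"

text \<open>An upper bound for the time, in which a conditional is charged for both branches. A program
without loops can then be verified by evaluating its effect.\<close>

fun cost :: "prog \<Rightarrow> nat" where
  "cost (Put a i e) = ops i + ops e + 1"
| "cost (Seq P Q) = cost P + cost Q"
| "cost (Cond e f P Q) = ops e + ops f + 1 + (cost P + cost Q)"
| "cost P = 1"

lemma exec_loop_free: "loop_free P \<Longrightarrow> \<exists>T\<le>cost P. exec P s T (effect P s)"
proof (induction P arbitrary: s)
  case Skip
  then show ?case using exec_skip[of s] by auto
next
  case (Put a i e)
  show ?case unfolding effect.simps cost.simps using exec_put[of a i e s] by blast
next
  case (Seq P Q)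
  then obtain T1 T2 where "T1 \<le> cost P" "exec P s T1 (effect P s)"
    "T2 \<le> cost Q" "exec Q (effect P s) T2 (effect Q (effect P s))" by auto metis
  then show ?case by (intro exI[of _ "T1 + T2"]) (auto intro: exec_seq)
next
  case (Cond e f P Q)
  show ?case
  proof (cases "val s e < val s f")
    case True
    then obtain T where "T \<le> cost P" "exec P s T (effect P s)" using Cond by auto
    then show ?thesis using True exec_cond_true[of s e f P T "effect P s" Q]
      by (intro exI[of _ "ops e + ops f + 1 + T"]) auto
  next
    case False
    then obtain T where "T \<le> cost Q" "exec Q s T (effect Q s)" using Cond by auto
    then show ?thesis using False exec_cond_false[of s e f Q T "effect Q s" P]
      by (intro exI[of _ "ops e + ops f + 1 + T"]) auto
  qed
qed auto

lemma runs_loop_free: "loop_free P \<Longrightarrow> Q (effect P s) \<Longrightarrow> runs P s (cost P) Q"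
  using exec_loop_free[of P s] by (auto simp: runs_def)

lemma runs_weaken: "runs P s B Q \<Longrightarrow> B \<le> B' \<Longrightarrow> (\<And>s'. Q s' \<Longrightarrow> Q' s') \<Longrightarrow> runs P s B' Q'"
  unfolding runs_def by (meson order_trans)

lemma runs_seq:
  assumes "runs P s B R" "\<And>s'. R s' \<Longrightarrow> runs P' s' B' Q"
  shows "runs (Seq P P') s (B + B') Q"
proof -
  obtain T s' where 1: "exec P s T s'" "T \<le> B" "R s'" using assms(1) by (auto simp: runs_def)
  obtain T' s'' where 2: "exec P' s' T' s''" "T' \<le> B'" "Q s''"
    using assms(2)[OF 1(3)] by (auto simp: runs_def)
  show ?thesis unfolding runs_def using exec_seq[OF 1(1) 2(1)] 1 2
    by (intro exI[of _ "T + T'"] exI[of _ s'']) auto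
qed

text \<open>The number of iterations is bounded by a measure that decreases in each of them.\<close>

lemma runs_while:
  fixes \<mu> :: "store \<Rightarrow> nat"
  assumes "I s"
    and "\<And>s. I s \<Longrightarrow> val s e < val s f \<Longrightarrow> runs P s B (\<lambda>s'. I s' \<and> \<mu> s' < \<mu> s)"
  shows "runs (Loop e f P) s ((\<mu> s + 1) * (ops e + ops f + 1 + B)) (\<lambda>s'. I s' \<and> \<not> val s' e < val s' f)"
  using assms(1)
proof (induction "\<mu> s" arbitrary: s rule: less_induct)
  case less
  show ?case
  proof (cases "val s e < val s f")
    case False
    then show ?thesis using exec_loop_false[of s e f P] less.prems unfolding runs_def
      by (intro exI[of _ "ops e + ops f + 1"] exI[of _ s]) auto
  next
    case True
    obtain T s' where 1: "exec P s T s'" "T \<le> B" "I s'" "\<mu> s' < \<mu> s"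
      using assms(2)[OF less.prems True] by (auto simp: runs_def)
    obtain T' s'' where 2: "exec (Loop e f P) s' T' s''"
      "T' \<le> (\<mu> s' + 1) * (ops e + ops f + 1 + B)" "I s'' \<and> \<not> val s'' e < val s'' f"
      using less.hyps[OF 1(4,3)] by (auto simp: runs_def)
    have "T' \<le> \<mu> s * (ops e + ops f + 1 + B)"
      using 1(4) by (intro order_trans[OF 2(2)] mult_right_mono) auto
    then have "ops e + ops f + 1 + T + T' \<le> (\<mu> s + 1) * (ops e + ops f + 1 + B)"
      using 1(2) by (simp add: algebra_simps)
    then show ?thesis unfolding runs_def using exec_loop_true[OF True 1(1) 2(1)] 2(3) by blast
  qed
qed

abbreviation V :: "nat \<Rightarrow> expr" where "V x \<equiv> Cell x (Const 0)"

abbreviation Assign :: "nat \<Rightarrow> expr \<Rightarrow> prog" where "Assign x e \<equiv> Put x (Const 0) e"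

definition For :: "nat \<Rightarrow> expr \<Rightarrow> prog \<Rightarrow> prog" where
  "For x e P = Seq (Assign x (Const 0))
     (Loop (V x) e (Seq P (Assign x (Add (V x) (Const 1)))))"

lemma runs_For:
  assumes init: "I 0 (s(x := (s x)(0 := 0)))"
    and guard: "\<And>j s. I j s \<Longrightarrow> j \<le> n \<Longrightarrow> s x 0 = int j \<and> val s e = int n"
    and step: "\<And>j s. I j s \<Longrightarrow> j < n \<Longrightarrow>
      runs P s B (\<lambda>s'. s' x 0 = int j \<and> I (Suc j) (s'(x := (s' x)(0 := int (Suc j)))))"
  shows "runs (For x e P) s ((n + 1) * (12 + ops e + B)) (I n)"
proof -
  let ?J = "\<lambda>s. \<exists>j\<le>n. I j s"
  let ?W = "Loop (V x) e (Seq P (Assign x (Add (V x) (Const 1))))"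
  let ?s = "s(x := (s x)(0 := 0))"
  have 1: "runs ?W ?s ((nat (int n - ?s x 0) + 1) * (ops (V x) + ops e + 1 + (B + 6)))
     (\<lambda>s'. ?J s' \<and> \<not> val s' (V x) < val s' e)"
  proof (rule runs_while)
    show "?J ?s" using init by blast
  next
    fix s assume "?J s" "val s (V x) < val s e"
    then obtain j where j: "j < n" "I j s" "s x 0 = int j" using guard by force
    show "runs (Seq P (Assign x (Add (V x) (Const 1)))) s (B + 6)
       (\<lambda>s'. ?J s' \<and> nat (int n - s' x 0) < nat (int n - s x 0))"
    proof (rule runs_seq[OF step[OF j(2,1)]])
      fix s' assume *: "s' x 0 = int j \<and> I (Suc j) (s'(x := (s' x)(0 := int (Suc j))))"
      have "runs (Assign x (Add (V x) (Const 1))) s' (cost (Assign x (Add (V x) (Const 1))))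
         (\<lambda>s'. ?J s' \<and> nat (int n - s' x 0) < nat (int n - s x 0))"
        using * j by (intro runs_loop_free) (auto intro!: exI[of _ "Suc j"] simp: add.commute)
      then show "runs (Assign x (Add (V x) (Const 1))) s' 6
         (\<lambda>s'. ?J s' \<and> nat (int n - s' x 0) < nat (int n - s x 0))" 
        by (simp add: eval_nat_numeral)
    qed
  qed
  have 2: "runs (Assign x (Const 0)) s 3 (\<lambda>s'. s' = ?s)"
    using runs_loop_free[of "Assign x (Const 0)" "\<lambda>s'. s' = ?s" s] by (simp add: eval_nat_numeral)
  have "runs (For x e P) s (3 + (n + 1) * (9 + ops e + B)) (I n)"
    unfolding For_def
  proof (rule runs_seq[OF 2])
    fix s' assume "s' = ?s"
    have "I n s''" if J: "?J s''" "\<not> val s'' (V x) < val s'' e" for s''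
    proof -
      obtain j where j: "j \<le> n" "I j s''" using J by blast
      then have "j = n" using guard[OF j(2,1)] J(2) by simp
      then show ?thesis using j by simp
    qed
    then show "runs ?W s' ((n + 1) * (9 + ops e + B)) (I n)"
      unfolding \<open>s' = ?s\<close> by (intro runs_weaken[OF 1]) auto
  qed
  then show ?thesis
  proof (rule runs_weaken)
    show "3 + (n + 1) * (9 + ops e + B) \<le> (n + 1) * (12 + ops e + B)" by (simp add: algebra_simps)
  qed
qed

text \<open>The number of communities and the order of the tensor are constants of the program, so loops
over them are unrolled and leave loop-free code.\<close>

primrec unroll :: "nat \<Rightarrow> (nat \<Rightarrow> prog) \<Rightarrow> prog" where
  "unroll 0 f = Skip"
| "unroll (Suc k) f = Seq (unroll k f) (f k)"

lemma loop_free_unroll [simp]: "loop_free (unroll k f) \<longleftrightarrow> (\<forall>j<k. loop_free (f j))"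
  by (induction k) (auto simp: less_Suc_eq)

lemma effect_unroll:
  assumes "I 0 s" "\<And>j s. j < k \<Longrightarrow> I j s \<Longrightarrow> I (Suc j) (effect (f j) s)"
  shows "I k (effect (unroll k f) s)"
  using assms by (induction k) auto

lemma runs_unroll:
  assumes "I 0 s" "\<And>j s. j < k \<Longrightarrow> I j s \<Longrightarrow> runs (f j) s B (I (Suc j))"
  shows "runs (unroll k f) s (1 + k * B) (I k)"
  using assms
proof (induction k)
  case 0
  then show ?case using runs_loop_free[of Skip "I 0" s] by simp
next
  case (Suc k)
  have "runs (Seq (unroll k f) (f k)) s ((1 + k * B) + B) (I (Suc k))"
    by (rule runs_seq[of _ _ _ "I k"]) (use Suc in auto)
  then show ?case by (simp add: algebra_simps)
qed

text \<open>Multiplication is no machine operation, but multiples by constants of the program are sums.\<close>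

primrec times_const :: "nat \<Rightarrow> expr \<Rightarrow> expr" where
  "times_const 0 e = Const 0"
| "times_const (Suc k) e = Add e (times_const k e)"

lemma val_times_const [simp]: "val s (times_const k e) = int k * val s e"
  by (induction k) (auto simp: algebra_simps)

lemma index_inj:
  assumes "k < K" "k' < K"
  shows "int K * int i + int k = int K * int i' + int k' \<longleftrightarrow> i = i' \<and> k = k'"
proof
  assume "int K * int i + int k = int K * int i' + int k'"
  then have eq: "K * i + k = K * i' + k'" by (metis of_nat_add of_nat_eq_iff of_nat_mult)
  have "(K * i + k) div K = i" "(K * i' + k') div K = i'" using assms by simp_all
  then show "i = i' \<and> k = k'" using eq by auto
qed auto

section \<open>The projection as a program\<close>

text \<open>The arrays of the projection: 4 the current assignment, 5 the scores (row by row), 6 the prices,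
7 the community sizes, 8 the capacity n div K, 9 the node under inspection, 10 the best
community found for it, 11 a flag that tells whether some community was overfull, 15 the
community of the node under inspection. Scalars live in cell 0 of their array.\<close>

definition row_gain :: "nat \<Rightarrow> expr \<Rightarrow> expr" where
  "row_gain K x = Sub (Cell 5 (Add (times_const K (V 9)) x)) (Cell 6 x)"

definition pick_best :: "nat \<Rightarrow> nat \<Rightarrow> prog" where
  "pick_best K k = unroll k (\<lambda>j. Cond (row_gain K (V 10)) (row_gain K (Const (int j)))
     (Assign 10 (Const (int j))) Skip)"

lemma loop_free_pick_best [simp]: "loop_free (pick_best K k)"
  by (simp add: pick_best_def)

lemma effect_pick_best:
  assumes "s 10 0 = int a"
  shows "effect (pick_best K k) s = s(10 := (s 10)(0 :=
     int (best (\<lambda>j. s 5 (int K * s 9 0 + int j) - s 6 (int j)) a k)))"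
  using assms by (induction k) (auto simp: pick_best_def row_gain_def fun_eq_iff)

lemma best_cong:
  assumes "\<And>j. j < k \<Longrightarrow> g j = g' j" "g a = g' a"
  shows "best g a k = best g' a k"
  using assms(1)
proof (induction k)
  case (Suc k)
  then have eq: "best g a k = best g' a k" by simp
  have "g (best g' a k) = g' (best g' a k)"
    using best_range[of g' a k] Suc.prems assms(2) by auto
  then show ?case using eq Suc.prems by simp
qed simp

definition move_prog :: "nat \<Rightarrow> prog" where
  "move_prog K = Seq (Assign 15 (Cell 4 (V 9)))
     (Cond (V 8) (Cell 7 (V 15))
       (Seq (Assign 10 (V 15))
       (Seq (pick_best K K)
       (Seq (Put 7 (V 15) (Sub (Cell 7 (V 15)) (Const 1)))
       (Seq (Put 4 (V 9) (V 10))
            (Put 7 (V 10) (Add (Cell 7 (V 10)) (Const 1)))))))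
       Skip)"

definition same_off :: "nat set \<Rightarrow> store \<Rightarrow> store \<Rightarrow> bool" where
  "same_off X s s' \<longleftrightarrow> (\<forall>a. a \<notin> X \<longrightarrow> s' a = s a)"

definition holds_costs :: "nat \<Rightarrow> nat \<Rightarrow> (nat \<Rightarrow> nat \<Rightarrow> int) \<Rightarrow> store \<Rightarrow> bool" where
  "holds_costs n K C s \<longleftrightarrow> (\<forall>i<n. \<forall>k<K. s 5 (int K * int i + int k) = C i k)"

definition holds_prices :: "nat \<Rightarrow> (nat \<Rightarrow> int) \<Rightarrow> store \<Rightarrow> bool" where
  "holds_prices K \<pi> s \<longleftrightarrow> (\<forall>k<K. s 6 (int k) = \<pi> k)"

definition holds_assignment :: "nat \<Rightarrow> nat \<Rightarrow> (nat \<Rightarrow> nat) \<Rightarrow> store \<Rightarrow> bool" where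
  "holds_assignment n K h s \<longleftrightarrow> (\<forall>i<n. h i < K \<and> s 4 (int i) = int (h i)) \<and>
     (\<forall>k<K. s 7 (int k) = int (card (members n h k)))"

lemma effect_move_prog:
  assumes as: "holds_assignment n K h s" and co: "holds_costs n K C s" and pr: "holds_prices K \<pi> s"
    and i: "i < n" "s 9 0 = int i" "s 8 0 = int m"
  shows "holds_assignment n K (move_item n m K C \<pi> i h) (effect (move_prog K) s)"
    and "same_off {4, 7, 10, 15} s (effect (move_prog K) s)"
proof -
  define b where "b = best (gain C \<pi> i) (h i) K"
  have h: "h i < K" "s 4 (int i) = int (h i)" and size: "\<And>k. k < K \<Longrightarrow> s 7 (int k) = int (card (members n h k))"
    using as i by (auto simp: holds_assignment_def)
  have b: "b < K" using h best_less by (auto simp: b_def)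
  have pick: "best (\<lambda>j. s 5 (int K * int i + int j) - s 6 (int j)) (h i) K = b"
    unfolding b_def using h co pr i
    by (intro best_cong) (auto simp: gain_def holds_costs_def holds_prices_def)
  have ne: "members n h (h i) \<noteq> {}" using i by (auto simp: members_def)
  then have pos: "1 \<le> card (members n h (h i))" by (simp add: Suc_le_eq card_gt_0_iff)
  show "same_off {4, 7, 10, 15} s (effect (move_prog K) s)"
    using h size i pick by (simp add: move_prog_def effect_pick_best same_off_def)
  show "holds_assignment n K (move_item n m K C \<pi> i h) (effect (move_prog K) s)"
  proof (cases "overfull n m h (h i)")
    case False
    then show ?thesis using as h size i
      by (simp add: move_prog_def move_item_def overfull_def holds_assignment_def)
  next
    case True
    let ?s = "effect (move_prog K) s"
    have mv: "move_item n m K C \<pi> i h = h(i := b)" using True by (simp add: move_item_def b_def)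
    have s4: "?s 4 = (s 4)(int i := int b)"
      and s7: "?s 7 = ((s 7)(int (h i) := s 7 (int (h i)) - 1))
          (int b := ((s 7)(int (h i) := s 7 (int (h i)) - 1)) (int b) + 1)"
      using True h size i pick by (simp_all add: move_prog_def effect_pick_best overfull_def)
    show ?thesis
    proof (cases "b = h i")
      case True
      then show ?thesis using s4 s7 mv as h i by (auto simp: holds_assignment_def)
    next
      case False
      note mem = card_members_upd[where h = h and b = b, OF i(1) False]
      have "?s 7 (int k) = int (card (members n (h(i := b)) k))" if "k < K" for k
        using mem(3)[of k] mem(1,2) that s7 False pos size[OF that] size[OF h(1)] size[OF b]
        by (cases "k = b"; cases "k = h i") (auto simp: of_nat_diff)
      then show ?thesis using s4 mv as b by (auto simp: holds_assignment_def)
    qed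
  qed
qed

definition sweep_prog :: "nat \<Rightarrow> prog" where
  "sweep_prog K = For 9 (Cell 0 (Const 0)) (move_prog K)"

lemma same_off_trans: "same_off X s s' \<Longrightarrow> same_off X s' s'' \<Longrightarrow> same_off X s s''"
  by (simp add: same_off_def)

lemma same_off_mono: "same_off X s s' \<Longrightarrow> X \<subseteq> Y \<Longrightarrow> same_off Y s s'"
  by (auto simp: same_off_def)

lemma same_off_refl [simp]: "same_off X s s"
  by (simp add: same_off_def)

lemma same_off_upd [simp]: "a \<in> X \<Longrightarrow> same_off X s (s'(a := y)) = same_off X s s'"
  by (auto simp: same_off_def)

lemma same_off_costs: "same_off X s s' \<Longrightarrow> 5 \<notin> X \<Longrightarrow> holds_costs n K C s' = holds_costs n K C s"
  by (simp add: same_off_def holds_costs_def)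

lemma same_off_prices: "same_off X s s' \<Longrightarrow> 6 \<notin> X \<Longrightarrow> holds_prices K \<pi> s' = holds_prices K \<pi> s"
  by (simp add: same_off_def holds_prices_def)

lemma same_off_assignment:
  "same_off X s s' \<Longrightarrow> 4 \<notin> X \<Longrightarrow> 7 \<notin> X \<Longrightarrow> holds_assignment n K h s' = holds_assignment n K h s"
  by (simp add: same_off_def holds_assignment_def)

text \<open>The program follows the function sweep step by step, so that all reasoning about the auction
concerns pure functions.\<close>

lemma runs_sweep:
  assumes as: "holds_assignment n K h s" and co: "holds_costs n K C s" and pr: "holds_prices K \<pi> s"
    and s: "s 0 0 = int n" "s 8 0 = int m"
  shows "runs (sweep_prog K) s ((n + 1) * (14 + cost (move_prog K)))
    (\<lambda>s'. holds_assignment n K (sweep n m K C \<pi> n h) s' \<and> same_off {4, 7, 9, 10, 15} s s')"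
proof -
  define I where "I j s' \<longleftrightarrow> s' 9 0 = int j \<and>
    holds_assignment n K (sweep n m K C \<pi> j h) s' \<and> same_off {4, 7, 9, 10, 15} s s'" for j s'
  have "runs (sweep_prog K) s ((n + 1) * (12 + ops (Cell 0 (Const 0)) + cost (move_prog K))) (I n)"
    unfolding sweep_prog_def
  proof (rule runs_For)
    show "I 0 (s(9 := (s 9)(0 := 0)))" using as by (simp add: I_def holds_assignment_def)
  next
    fix j s' assume "I j s'"
    then show "s' 9 0 = int j \<and> val s' (Cell 0 (Const 0)) = int n"
      using s by (simp add: I_def same_off_def)
  next
    fix j s' assume I: "I j s'" and j: "j < n"
    have co': "holds_costs n K C s'" and pr': "holds_prices K \<pi> s'"
      using I co pr same_off_costs same_off_prices by (fastforce simp: I_def)+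
    have s': "s' 9 0 = int j" "s' 8 0 = int m" using I s by (auto simp: I_def same_off_def)
    have as': "holds_assignment n K (sweep n m K C \<pi> j h) s'" using I by (simp add: I_def)
    note mv = effect_move_prog[OF as' co' pr' j s']
    show "runs (move_prog K) s' (cost (move_prog K)) (\<lambda>s''. s'' 9 0 = int j \<and>
        I (Suc j) (s''(9 := (s'' 9)(0 := int (Suc j)))))"
    proof (rule runs_loop_free)
      show "loop_free (move_prog K)" by (simp add: move_prog_def)
      show "effect (move_prog K) s' 9 0 = int j \<and>
        I (Suc j) ((effect (move_prog K) s')(9 := (effect (move_prog K) s' 9)(0 := int (Suc j))))"
        using mv I s' by (auto simp: I_def holds_assignment_def same_off_def)
    qed
  qed
  then show ?thesis by (rule runs_weaken) (auto simp: I_def)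
qed

definition start_item :: "nat \<Rightarrow> prog" where
  "start_item K = Seq (Assign 10 (Const 0)) (Seq (pick_best K K)
     (Seq (Put 4 (V 9) (V 10)) (Put 7 (V 10) (Add (Cell 7 (V 10)) (Const 1)))))"

definition reset_prog :: "nat \<Rightarrow> prog" where
  "reset_prog K = unroll K (\<lambda>k. Seq (Put 6 (Const (int k)) (Const 0)) (Put 7 (Const (int k)) (Const 0)))"

definition start_prog :: "nat \<Rightarrow> prog" where
  "start_prog K = Seq (reset_prog K) (For 9 (Cell 0 (Const 0)) (start_item K))"

definition raise_prog :: "nat \<Rightarrow> prog" where
  "raise_prog K = Seq (Assign 11 (Const 0)) (unroll K (\<lambda>k. Cond (V 8) (Cell 7 (Const (int k)))
     (Seq (Put 6 (Const (int k)) (Add (Cell 6 (Const (int k))) (Const 1))) (Assign 11 (Const 1)))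
     Skip))"

definition round_prog :: "nat \<Rightarrow> prog" where
  "round_prog K = Seq (unroll K (\<lambda>_. sweep_prog K)) (raise_prog K)"

text \<open>The flag is set at the start, so that at least one round is run.\<close>

definition project_prog :: "nat \<Rightarrow> prog" where
  "project_prog K = Seq (start_prog K) (Seq (Assign 11 (Const 1)) (Loop (Const 0) (V 11) (round_prog K)))"

definition optimal :: "nat \<Rightarrow> nat \<Rightarrow> (nat \<Rightarrow> nat \<Rightarrow> int) \<Rightarrow> (nat \<Rightarrow> nat) \<Rightarrow> bool" where
  "optimal n K C h \<longleftrightarrow> balanced_fun n K h \<and>
     (\<forall>h'. balanced_fun n K h' \<longrightarrow> (\<Sum>i<n. C i (h' i)) \<le> (\<Sum>i<n. C i (h i)))"

lemma effect_reset_prog: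
  "(\<forall>k<K. effect (reset_prog K) s 6 (int k) = 0 \<and> effect (reset_prog K) s 7 (int k) = 0) \<and>
   same_off {6, 7} s (effect (reset_prog K) s)"
  unfolding reset_prog_def
  by (rule effect_unroll[where I = "\<lambda>j s'. (\<forall>k<j. s' 6 (int k) = 0 \<and> s' 7 (int k) = 0) \<and> same_off {6, 7} s s'"])
     (auto simp: less_Suc_eq)

lemma runs_start_prog:
  assumes K: "0 < K" and co: "holds_costs n K C s" and n: "s 0 0 = int n"
  defines "h0 \<equiv> \<lambda>i. best (gain C (\<lambda>_. 0) i) 0 K"
  shows "runs (start_prog K) s (cost (reset_prog K) + (n + 1) * (14 + cost (start_item K)))
    (\<lambda>s'. holds_assignment n K h0 s' \<and> holds_prices K (\<lambda>_. 0) s' \<and> same_off {4, 6, 7, 9, 10} s s')"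
proof -
  have h0: "h0 i < K" for i using K best_less by (simp add: h0_def)
  define I where "I j s' \<longleftrightarrow> s' 9 0 = int j \<and> (\<forall>i<j. s' 4 (int i) = int (h0 i)) \<and>
     (\<forall>k<K. s' 7 (int k) = int (card (members j h0 k))) \<and>
     holds_prices K (\<lambda>_. 0) s' \<and> same_off {4, 6, 7, 9, 10} s s'" for j s'
  let ?Q = "\<lambda>s'. (\<forall>k<K. s' 6 (int k) = 0 \<and> s' 7 (int k) = 0) \<and> same_off {6, 7} s s'"
  have 1: "runs (reset_prog K) s (cost (reset_prog K)) ?Q"
    by (intro runs_loop_free effect_reset_prog) (simp add: reset_prog_def)
  have 2: "runs (For 9 (Cell 0 (Const 0)) (start_item K)) s'
     ((n + 1) * (12 + ops (Cell 0 (Const 0)) + cost (start_item K))) (I n)" if Q: "?Q s'" for s'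
  proof (rule runs_For)
    show "I 0 (s'(9 := (s' 9)(0 := 0)))"
      using Q by (auto simp: I_def members_def holds_prices_def same_off_def)
  next
    fix j s' assume "I j s'"
    then show "s' 9 0 = int j \<and> val s' (Cell 0 (Const 0)) = int n"
      using n by (simp add: I_def same_off_def)
  next
    fix j s' assume I: "I j s'" and j: "j < n"
    have gain: "s' 5 (int K * int j + int k) - s' 6 (int k) = gain C (\<lambda>_. 0) j k" if "k < K" for k
      using that j I co by (simp add: I_def gain_def holds_costs_def holds_prices_def same_off_def)
    have pick: "best (\<lambda>i. s' 5 (int K * int j + int i) - s' 6 (int i)) 0 K = h0 j"
      unfolding h0_def by (rule best_cong) (use gain gain[OF K] in simp_all)
    have mem: "members (Suc j) h0 k = (if k = h0 j then insert j (members j h0 k) else members j h0 k)" for k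
      by (auto simp: members_def less_Suc_eq)
    have "j \<notin> members j h0 k" for k by (simp add: members_def)
    then have card: "card (members (Suc j) h0 k) = card (members j h0 k) + (if k = h0 j then 1 else 0)" for k
      by (simp add: mem)
    show "runs (start_item K) s' (cost (start_item K)) (\<lambda>s''. s'' 9 0 = int j \<and>
        I (Suc j) (s''(9 := (s'' 9)(0 := int (Suc j)))))"
    proof (rule runs_loop_free)
      show "loop_free (start_item K)" by (simp add: start_item_def)
      show "effect (start_item K) s' 9 0 = int j \<and>
        I (Suc j) ((effect (start_item K) s')(9 := (effect (start_item K) s' 9)(0 := int (Suc j))))"
        using I h0 pick by (auto simp: start_item_def I_def effect_pick_best[where a = 0] card holds_prices_def less_Suc_eq)
    qed
  qed
  have "runs (start_prog K) s (cost (reset_prog K) +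
     (n + 1) * (12 + ops (Cell 0 (Const 0)) + cost (start_item K))) (I n)"
    unfolding start_prog_def by (rule runs_seq[OF 1 2])
  then show ?thesis by (rule runs_weaken) (auto simp: I_def holds_assignment_def h0)
qed

lemma effect_raise_prog:
  assumes "holds_assignment n K h s" "holds_prices K \<pi> s" "s 8 0 = int m"
  shows "holds_prices K (raise_prices n m h \<pi>) (effect (raise_prog K) s) \<and>
    effect (raise_prog K) s 11 0 = (if \<exists>k<K. overfull n m h k then 1 else 0) \<and>
    same_off {6, 11} s (effect (raise_prog K) s)"
proof -
  let ?I = "\<lambda>j s'. (\<forall>k<K. s' 6 (int k) = (if k < j then raise_prices n m h \<pi> k else \<pi> k)) \<and>
     s' 11 0 = (if \<exists>k<j. overfull n m h k then 1 else 0) \<and> same_off {6, 11} s s'"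
  have "?I K (effect (raise_prog K) s)"
    unfolding raise_prog_def effect.simps(2)
  proof (rule effect_unroll[where I = ?I])
    show "?I 0 (effect (Assign 11 (Const 0)) s)" using assms by (simp add: holds_prices_def)
  next
    fix j s' assume j: "j < K" and I: "?I j s'"
    have "s' 8 0 = int m" "s' 7 (int j) = int (card (members n h j))"
      using I assms j by (auto simp: same_off_def holds_assignment_def)
    then show "?I (Suc j) (effect (Cond (V 8) (Cell 7 (Const (int j)))
      (Seq (Put 6 (Const (int j)) (Add (Cell 6 (Const (int j))) (Const 1))) (Assign 11 (Const 1))) Skip) s')"
      using I j by (auto simp: raise_prices_def overfull_def less_Suc_eq)
  qed
  then show ?thesis by (auto simp: holds_prices_def)
qed

definition project_const :: "nat \<Rightarrow> nat" where
  "project_const K = cost (reset_prog K) + (14 + cost (start_item K)) + 3 +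
     (K + 2) * (5 + K * (14 + cost (move_prog K)) + cost (raise_prog K))"

context auction begin

lemma best_start:
  shows "almost_stable n K C (\<lambda>_. 0) (\<lambda>i. best (gain C (\<lambda>_. 0) i) 0 K)"
    and "0 \<le> M \<Longrightarrow> prices_ok (\<lambda>_. 0) h"
proof -
  show "almost_stable n K C (\<lambda>_. 0) (\<lambda>i. best (gain C (\<lambda>_. 0) i) 0 K)"
    unfolding almost_stable_def
  proof (intro allI impI conjI)
    fix i k assume "k < K"
    then show "gain C (\<lambda>_. 0) i k \<le> gain C (\<lambda>_. 0) i (best (gain C (\<lambda>_. 0) i) 0 K) + 1"
      using best_ge(1)[of k K "gain C (\<lambda>_. 0) i" 0] by linarith
  qed (use K_pos best_less in auto)
qed (simp add: prices_ok_def)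

definition round_inv :: "store \<Rightarrow> store \<Rightarrow> bool" where
  "round_inv s s' \<longleftrightarrow> (\<exists>\<pi> h. holds_prices K \<pi> s' \<and> holds_assignment n K h s' \<and>
     almost_stable n K C \<pi> h \<and> prices_ok \<pi> h \<and> (s' 11 0 = 0 \<or> s' 11 0 = 1) \<and>
     (s' 11 0 = 0 \<longrightarrow> (\<forall>k<K. \<not> overfull n m h k)) \<and>
     same_off {4, 6, 7, 9, 10, 11, 15} s s')"

text \<open>Every round raises a price, and prices are bounded by M + 1, or it finds no overfull community
and clears the flag.\<close>

definition round_measure :: "store \<Rightarrow> nat" where
  "round_measure s = nat ((\<Sum>k<K. M + 1 - s 6 (int k)) + s 11 0)"

text \<open>After K sweeps all communities are settled, so raising the prices of those still overfull keeps
the assignment almost stable.\<close>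

lemma runs_round:
  assumes s: "holds_costs n K C s" "s 0 0 = int n" "s 8 0 = int m"
    and inv: "round_inv s s'" and flag: "0 < s' 11 0"
  shows "runs (round_prog K) s' (1 + K * ((n + 1) * (14 + cost (move_prog K))) + cost (raise_prog K))
    (\<lambda>s''. round_inv s s'' \<and> round_measure s'' < round_measure s')"
proof -
  let ?X = "{4, 6, 7, 9, 10, 11, 15} :: nat set"
  obtain \<pi> h where pr: "holds_prices K \<pi> s'" and as: "holds_assignment n K h s'"
    and st: "almost_stable n K C \<pi> h" and ok: "prices_ok \<pi> h" and one: "s' 11 0 = 1"
    and off: "same_off ?X s s'"
    using inv flag by (auto simp: round_inv_def)
  define I where "I t u \<longleftrightarrow> holds_assignment n K ((sweep n m K C \<pi> n ^^ t) h) u \<and>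
    same_off {4, 7, 9, 10, 15} s' u" for t u
  have 1: "runs (unroll K (\<lambda>_. sweep_prog K)) s' (1 + K * ((n + 1) * (14 + cost (move_prog K)))) (I K)"
  proof (rule runs_unroll)
    show "I 0 s'" using as by (simp add: I_def)
  next
    fix t u assume I: "I t u"
    then have off': "same_off {4, 7, 9, 10, 15} s' u" by (simp add: I_def)
    have "runs (sweep_prog K) u ((n + 1) * (14 + cost (move_prog K)))
      (\<lambda>s''. holds_assignment n K (sweep n m K C \<pi> n ((sweep n m K C \<pi> n ^^ t) h)) s'' \<and>
         same_off {4, 7, 9, 10, 15} u s'')"
    proof (rule runs_sweep)
      show "holds_costs n K C u" using same_off_costs[OF off'] same_off_costs[OF off] s by simp
      show "holds_prices K \<pi> u" using same_off_prices[OF off'] pr by simp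
      show "u 0 0 = int n" "u 8 0 = int m" using off off' s by (auto simp: same_off_def)
    qed (use I in \<open>simp add: I_def\<close>)
    then show "runs (sweep_prog K) u ((n + 1) * (14 + cost (move_prog K))) (I (Suc t))"
      by (rule runs_weaken) (use same_off_trans[OF off'] in \<open>auto simp: I_def\<close>)
  qed
  define h1 where "h1 = (sweep n m K C \<pi> n ^^ K) h"
  have st1: "almost_stable n K C \<pi> h1" unfolding h1_def using sweeps_almost_stable[OF st] .
  have set1: "\<forall>a<K. settled n m K C \<pi> h1 a" unfolding h1_def using sweeps_settle[OF st] by blast
  have ok1: "prices_ok \<pi> h1" unfolding h1_def using sweeps_prices_ok[OF st ok] .
  show ?thesis unfolding round_prog_def
  proof (rule runs_seq[OF 1], rule runs_loop_free)
    fix u assume I: "I K u"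
    then have asu: "holds_assignment n K h1 u" and off': "same_off {4, 7, 9, 10, 15} s' u"
      by (simp_all add: I_def h1_def)
    have pru: "holds_prices K \<pi> u" using same_off_prices[OF off'] pr by simp
    have u8: "u 8 0 = int m" using off off' s by (auto simp: same_off_def)
    let ?u = "effect (raise_prog K) u"
    have r: "holds_prices K (raise_prices n m h1 \<pi>) ?u"
      "?u 11 0 = (if \<exists>k<K. overfull n m h1 k then 1 else 0)" "same_off {6, 11} u ?u"
      using effect_raise_prog[OF asu pru u8] by auto
    have ok2: "prices_ok (raise_prices n m h1 \<pi>) h1" using raise_prices_ok[OF st1 set1 ok1] .
    have asu': "holds_assignment n K h1 ?u" using same_off_assignment[OF r(3)] asu by simp
    have inv': "round_inv s ?u"
      unfolding round_inv_def
      using r ok2 raise_almost_stable[OF st1 set1] off off' asu'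
      by (intro exI[of _ "raise_prices n m h1 \<pi>"] exI[of _ h1])
         (auto simp: same_off_def)
    have sum: "(\<Sum>k<K. M + 1 - s' 6 (int k)) = (\<Sum>k<K. M + 1 - \<pi> k)"
      "(\<Sum>k<K. M + 1 - ?u 6 (int k)) = (\<Sum>k<K. M + 1 - raise_prices n m h1 \<pi> k)"
      using pr r(1) by (auto simp: holds_prices_def)
    have pos': "0 \<le> (\<Sum>k<K. M + 1 - \<pi> k)"
      using ok1 by (intro sum_nonneg) (auto simp: prices_ok_def)
    have pos: "0 \<le> (\<Sum>k<K. M + 1 - raise_prices n m h1 \<pi> k)"
      using ok2 by (intro sum_nonneg) (auto simp: prices_ok_def)
    have "(\<Sum>k<K. M + 1 - raise_prices n m h1 \<pi> k) + ?u 11 0 < (\<Sum>k<K. M + 1 - \<pi> k) + 1"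
    proof (cases "\<exists>k<K. overfull n m h1 k")
      case True
      then have "(\<Sum>k<K. M + 1 - raise_prices n m h1 \<pi> k) < (\<Sum>k<K. M + 1 - \<pi> k)"
        by (intro sum_strict_mono_ex1) (auto simp: raise_prices_def)
      then show ?thesis using r(2) True by simp
    next
      case False
      then have "(\<Sum>k<K. M + 1 - raise_prices n m h1 \<pi> k) = (\<Sum>k<K. M + 1 - \<pi> k)"
        by (intro sum.cong) (auto simp: raise_prices_def)
      then show ?thesis using r(2) False by simp
    qed
    then have "round_measure ?u < round_measure s'"
      unfolding round_measure_def sum one using pos pos' r(2) by (auto split: if_splits)
    then show "round_inv s ?u \<and> round_measure ?u < round_measure s'" using inv' by blast
  qed (simp add: raise_prog_def)
qed

text \<open>There are at most K (M + 1) + 1 rounds, each of K sweeps over n nodes.\<close>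

lemma runs_project:
  assumes s: "holds_costs n K C s" "s 0 0 = int n" "s 8 0 = int m" and M: "0 \<le> M"
  shows "runs (project_prog K) s ((n + 1) * (nat M + 1) * project_const K)
    (\<lambda>s'. \<exists>h. optimal n K C h \<and> (\<forall>i<n. s' 4 (int i) = int (h i)) \<and>
       same_off {4, 6, 7, 9, 10, 11, 15} s s')"
proof -
  let ?R = "1 + K * ((n + 1) * (14 + cost (move_prog K))) + cost (raise_prog K)"
  let ?Q = "\<lambda>s'. holds_assignment n K (\<lambda>i. best (gain C (\<lambda>_. 0) i) 0 K) s' \<and>
    holds_prices K (\<lambda>_. 0) s' \<and> same_off {4, 6, 7, 9, 10} s s'"
  let ?Q1 = "\<lambda>s'. round_inv s s' \<and> round_measure s' = K * (nat M + 1) + 1"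
  have 1: "runs (start_prog K) s (cost (reset_prog K) + (n + 1) * (14 + cost (start_item K))) ?Q"
    using runs_start_prog[OF K_pos s(1,2)] .
  have 2: "runs (Assign 11 (Const 1)) s' 3 ?Q1" if Q: "?Q s'" for s'
  proof -
    have "?Q1 (effect (Assign 11 (Const 1)) s')"
    proof
      show "round_inv s (effect (Assign 11 (Const 1)) s')"
        unfolding round_inv_def using Q best_start M
        by (intro exI[of _ "\<lambda>_. 0"] exI[of _ "\<lambda>i. best (gain C (\<lambda>_. 0) i) 0 K"])
           (auto simp: holds_prices_def holds_assignment_def same_off_def)
      have "(\<Sum>k<K. M + 1 - s' 6 (int k)) = int K * (M + 1)" using Q by (simp add: holds_prices_def)
      then show "round_measure (effect (Assign 11 (Const 1)) s') = K * (nat M + 1) + 1"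
        unfolding round_measure_def using M by (simp add: nat_add_distrib nat_mult_distrib)
    qed
    then show ?thesis using runs_loop_free[of "Assign 11 (Const 1)" ?Q1 s'] by (simp add: eval_nat_numeral)
  qed
  have 3: "runs (Loop (Const 0) (V 11) (round_prog K)) s' ((K * (nat M + 1) + 2) * (4 + ?R))
     (\<lambda>s'. \<exists>h. optimal n K C h \<and> (\<forall>i<n. s' 4 (int i) = int (h i)) \<and>
       same_off {4, 6, 7, 9, 10, 11, 15} s s')" if Q: "?Q1 s'" for s'
  proof -
    have "runs (Loop (Const 0) (V 11) (round_prog K)) s'
       ((round_measure s' + 1) * (ops (Const 0) + ops (V 11) + 1 + ?R))
       (\<lambda>s'. round_inv s s' \<and> \<not> val s' (Const 0) < val s' (V 11))"
      using Q by (intro runs_while runs_round s) auto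
    moreover have "round_measure s' + 1 = K * (nat M + 1) + 2" using Q by simp
    moreover have "ops (Const 0) + ops (V 11) + 1 = 4" by simp
    ultimately have "runs (Loop (Const 0) (V 11) (round_prog K)) s' ((K * (nat M + 1) + 2) * (4 + ?R))
       (\<lambda>s'. round_inv s s' \<and> \<not> val s' (Const 0) < val s' (V 11))"
      by (simp only:)
    then show ?thesis
    proof (rule runs_weaken[OF _ order_refl])
      fix s' assume "round_inv s s' \<and> \<not> val s' (Const 0) < val s' (V 11)"
      then obtain \<pi> h where as: "holds_assignment n K h s'" and st: "almost_stable n K C \<pi> h"
        and ov: "\<forall>k<K. \<not> overfull n m h k" and off: "same_off {4, 6, 7, 9, 10, 11, 15} s s'"
        by (auto simp: round_inv_def)
      have bal: "balanced_fun n K h"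
        using balanced_if_not_overfull ov as by (auto simp: holds_assignment_def)
      have "optimal n K C h" unfolding optimal_def using bal almost_stable_optimal[OF st bal] by blast
      then show "\<exists>h. optimal n K C h \<and> (\<forall>i<n. s' 4 (int i) = int (h i)) \<and>
         same_off {4, 6, 7, 9, 10, 11, 15} s s'"
        using as off by (auto simp: holds_assignment_def)
    qed
  qed
  have "runs (project_prog K) s ((cost (reset_prog K) + (n + 1) * (14 + cost (start_item K))) +
     (3 + (K * (nat M + 1) + 2) * (4 + ?R))) (\<lambda>s'. \<exists>h. optimal n K C h \<and> (\<forall>i<n. s' 4 (int i) = int (h i)) \<and>
       same_off {4, 6, 7, 9, 10, 11, 15} s s')"
    unfolding project_prog_def by (rule runs_seq[OF 1 runs_seq[OF 2 3]])
  moreover have "(cost (reset_prog K) + (n + 1) * (14 + cost (start_item K))) +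
     (3 + (K * (nat M + 1) + 2) * (4 + ?R)) \<le> (n + 1) * (nat M + 1) * project_const K"
  proof -
    let ?x = "(n + 1) * (nat M + 1)"
    have x: "1 \<le> ?x" "n + 1 \<le> ?x" by auto
    have "cost (reset_prog K) \<le> ?x * cost (reset_prog K)" 
      using mult_right_mono[OF x(1), of "cost (reset_prog K)"] by simp
    moreover have "(n + 1) * (14 + cost (start_item K)) \<le> ?x * (14 + cost (start_item K))"
      using x(2) by (rule mult_right_mono) simp
    moreover have "(K * (nat M + 1) + 2) * (4 + ?R) \<le>
       ((nat M + 1) * (K + 2)) * ((n + 1) * (5 + K * (14 + cost (move_prog K)) + cost (raise_prog K)))"
    proof (rule mult_mono)
      show "K * (nat M + 1) + 2 \<le> (nat M + 1) * (K + 2)" by (simp add: algebra_simps)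
      show "4 + ?R \<le> (n + 1) * (5 + K * (14 + cost (move_prog K)) + cost (raise_prog K))"
        by (simp add: algebra_simps)
    qed auto
    moreover have "3 \<le> ?x * 3" using x by auto
    ultimately have "(cost (reset_prog K) + (n + 1) * (14 + cost (start_item K))) +
       (3 + (K * (nat M + 1) + 2) * (4 + ?R)) \<le>
       ?x * cost (reset_prog K) + ?x * (14 + cost (start_item K)) + (?x * 3 +
       ((nat M + 1) * (K + 2)) * ((n + 1) * (5 + K * (14 + cost (move_prog K)) + cost (raise_prog K))))"
      by linarith
    also have "\<dots> = ?x * project_const K"
      unfolding project_const_def by (simp only: distrib_left distrib_right mult.assoc mult.commute mult.left_commute add.assoc)
    finally show ?thesis .
  qed
  ultimately show ?thesis by (rule runs_weaken)
qed

end

section \<open>The power method as a program\<close>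

definition div_prog :: "nat \<Rightarrow> prog" where
  "div_prog K = Seq (Assign 8 (Const 0))
     (Loop (times_const K (V 8)) (Cell 0 (Const 0)) (Assign 8 (Add (V 8) (Const 1))))"

definition fill_prog :: "nat \<Rightarrow> (nat \<Rightarrow> expr) \<Rightarrow> prog" where
  "fill_prog K f = For 9 (Cell 0 (Const 0))
     (unroll K (\<lambda>k. Put 5 (Add (times_const K (V 9)) (Const (int k))) (f k)))"

text \<open>Array 13 holds the number of the tensor entry that is read, 12 the number of the iteration, 14 a
flag; array 2 holds the index tuples.\<close>

definition entry_node :: "nat \<Rightarrow> nat \<Rightarrow> expr" where
  "entry_node d j = Cell 2 (Add (times_const d (V 13)) (Const (int j)))"

text \<open>An entry contributes to the score of its first node only if its other nodes lie in one
community, and then to that community. So one update per entry suffices for all K columns.\<close>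

definition count_prog :: "nat \<Rightarrow> nat \<Rightarrow> prog" where
  "count_prog K d = Seq (Assign 10 (Cell 4 (entry_node d 1)))
     (Seq (Assign 14 (Const 1))
     (Seq (unroll d (\<lambda>j. if j = 0 then Skip
        else Cond (Cell 4 (entry_node d j)) (V 10) (Assign 14 (Const 0))
          (Cond (V 10) (Cell 4 (entry_node d j)) (Assign 14 (Const 0)) Skip)))
     (Cond (Const 0) (V 14)
        (Put 5 (Add (times_const K (entry_node d 0)) (V 10))
           (Add (Cell 5 (Add (times_const K (entry_node d 0)) (V 10))) (Const (int (K + 1)))))
        Skip)))"

definition apply_prog :: "nat \<Rightarrow> nat \<Rightarrow> prog" where
  "apply_prog K d = Seq (fill_prog K (\<lambda>_. Const 0)) (For 13 (Cell 0 (Const 2)) (count_prog K d))"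

text \<open>Array 3 is zero initially, so that only the ones have to be written.\<close>

definition output_prog :: "nat \<Rightarrow> prog" where
  "output_prog K = For 9 (Cell 0 (Const 0)) (Put 3 (Add (times_const K (V 9)) (Cell 4 (V 9))) (Const 1))"

definition ptpm_prog :: "nat \<Rightarrow> nat \<Rightarrow> prog" where
  "ptpm_prog K d = Seq (div_prog K)
     (Seq (fill_prog K (\<lambda>k. times_const (K + 1) (Cell 1 (Add (times_const K (V 9)) (Const (int k))))))
     (Seq (project_prog K)
     (Seq (For 12 (Cell 0 (Const 1)) (Seq (apply_prog K d) (project_prog K)))
     (output_prog K))))"

lemma runs_div_prog:
  assumes K: "0 < K" and s: "s 0 0 = int (K * m)"
  shows "runs (div_prog K) s ((K * m + 1) * (12 + ops (times_const K (V 8))))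
    (\<lambda>s'. s' 8 0 = int m \<and> same_off {8} s s')"
proof -
  let ?J = "\<lambda>s'. 0 \<le> s' 8 0 \<and> s' 8 0 \<le> int m \<and> same_off {8} s s'"
  let ?s = "s(8 := (s 8)(0 := 0))"
  let ?W = "Loop (times_const K (V 8)) (Cell 0 (Const 0)) (Assign 8 (Add (V 8) (Const 1)))"
  have 1: "runs (Assign 8 (Const 0)) s 3 (\<lambda>s'. s' = ?s)"
    using runs_loop_free[of "Assign 8 (Const 0)" "\<lambda>s'. s' = ?s" s] by (simp add: eval_nat_numeral)
  have guard: "val s' (times_const K (V 8)) < val s' (Cell 0 (Const 0)) \<longleftrightarrow> s' 8 0 < int m" if "?J s'" for s'
    using that s K by (simp add: same_off_def)
  have 2: "runs ?W ?s ((nat (int m - ?s 8 0) + 1) * (ops (times_const K (V 8)) + ops (Cell 0 (Const 0)) + 1 + 6))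
     (\<lambda>s'. ?J s' \<and> \<not> val s' (times_const K (V 8)) < val s' (Cell 0 (Const 0)))"
  proof (rule runs_while[where \<mu> = "\<lambda>s. nat (int m - s 8 0)"])
    fix s' assume J: "?J s'" and "val s' (times_const K (V 8)) < val s' (Cell 0 (Const 0))"
    then have less: "s' 8 0 < int m" using guard by blast
    have "runs (Assign 8 (Add (V 8) (Const 1))) s' (cost (Assign 8 (Add (V 8) (Const 1))))
      (\<lambda>s''. ?J s'' \<and> nat (int m - s'' 8 0) < nat (int m - s' 8 0))"
      using J less by (intro runs_loop_free) auto
    then show "runs (Assign 8 (Add (V 8) (Const 1))) s' 6
      (\<lambda>s''. ?J s'' \<and> nat (int m - s'' 8 0) < nat (int m - s' 8 0))"
      by (simp add: eval_nat_numeral)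
  qed (simp add: same_off_def)
  have "runs (div_prog K) s (3 + (m + 1) * (ops (times_const K (V 8)) + 9)) (\<lambda>s'. s' 8 0 = int m \<and> same_off {8} s s')"
    unfolding div_prog_def
  proof (rule runs_seq[OF 1])
    fix s' assume s': "s' = ?s"
    show "runs ?W s' ((m + 1) * (ops (times_const K (V 8)) + 9)) (\<lambda>s'. s' 8 0 = int m \<and> same_off {8} s s')"
      unfolding s' by (rule runs_weaken[OF 2]) (use guard in \<open>force simp: eval_nat_numeral\<close>)+
  qed
  moreover have "3 + (m + 1) * (ops (times_const K (V 8)) + 9) \<le> (K * m + 1) * (12 + ops (times_const K (V 8)))"
  proof -
    have "m + 1 \<le> K * m + 1" using K by simp
    then have "(m + 1) * (ops (times_const K (V 8)) + 9) \<le> (K * m + 1) * (ops (times_const K (V 8)) + 9)"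
      by (rule mult_right_mono) simp
    then show ?thesis by (simp add: algebra_simps)
  qed
  ultimately show ?thesis by (rule runs_weaken)
qed

definition fill_const :: "nat \<Rightarrow> (nat \<Rightarrow> expr) \<Rightarrow> nat" where
  "fill_const K f = 14 + cost (unroll K (\<lambda>k. Put 5 (Add (times_const K (V 9)) (Const (int k))) (f k)))"

lemma runs_fill_prog:
  assumes n: "s 0 0 = int n"
    and f: "\<And>s' i k. same_off {5, 9} s s' \<Longrightarrow> s' 9 0 = int i \<Longrightarrow> i < n \<Longrightarrow> k < K \<Longrightarrow> val s' (f k) = C i k"
  shows "runs (fill_prog K f) s ((n + 1) * fill_const K f)
    (\<lambda>s'. holds_costs n K C s' \<and> same_off {5, 9} s s')"
proof -
  define I where "I j s' \<longleftrightarrow> s' 9 0 = int j \<and> holds_costs j K C s' \<and> same_off {5, 9} s s'" for j s'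
  let ?P = "unroll K (\<lambda>k. Put 5 (Add (times_const K (V 9)) (Const (int k))) (f k))"
  have "runs (fill_prog K f) s ((n + 1) * (12 + ops (Cell 0 (Const 0)) + cost ?P)) (I n)"
    unfolding fill_prog_def
  proof (rule runs_For)
    show "I 0 (s(9 := (s 9)(0 := 0)))" by (simp add: I_def holds_costs_def)
  next
    fix j s' assume "I j s'"
    then show "s' 9 0 = int j \<and> val s' (Cell 0 (Const 0)) = int n"
      using n by (simp add: I_def same_off_def)
  next
    fix j s' assume I: "I j s'" and j: "j < n"
    let ?J = "\<lambda>l u. I j u \<and> (\<forall>k<l. u 5 (int K * int j + int k) = C j k)"
    have J: "?J K (effect ?P s')"
    proof (rule effect_unroll[where I = ?J])
      fix l u assume l: "l < K" and J: "?J l u"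
      then have u: "u 9 0 = int j" "val u (f l) = C j l" using f[of u j l] j by (auto simp: I_def)
      show "?J (Suc l) (effect (Put 5 (Add (times_const K (V 9)) (Const (int l))) (f l)) u)"
        using J u l index_inj[of _ K l _ j]
        by (auto simp: I_def holds_costs_def less_Suc_eq)
    qed (use I in simp)
    show "runs ?P s' (cost ?P) (\<lambda>s''. s'' 9 0 = int j \<and> I (Suc j) (s''(9 := (s'' 9)(0 := int (Suc j)))))"
      by (rule runs_loop_free) (use J in \<open>auto simp: I_def holds_costs_def less_Suc_eq\<close>)
  qed
  then show ?thesis by (rule runs_weaken) (auto simp: I_def fill_const_def)
qed

definition holds_entries :: "nat \<Rightarrow> nat list list \<Rightarrow> store \<Rightarrow> bool" where
  "holds_entries d es s \<longleftrightarrow> (\<forall>x<length es. \<forall>j<d. s 2 (int d * int x + int j) = int (es ! x ! j))"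

definition entry_count :: "nat list list \<Rightarrow> nat \<Rightarrow> (nat \<Rightarrow> nat) \<Rightarrow> nat \<Rightarrow> nat \<Rightarrow> nat" where
  "entry_count es x h i k = card {y. y < x \<and> hd (es ! y) = i \<and> (\<forall>v\<in>set (tl (es ! y)). h v = k)}"

text \<open>The factor K + 1 that the auction needs is built into the scores while they are counted.\<close>

definition power_costs :: "nat \<Rightarrow> nat list list \<Rightarrow> (nat \<Rightarrow> nat) \<Rightarrow> nat \<Rightarrow> nat \<Rightarrow> int" where
  "power_costs K es h i k = int ((K + 1) * entry_count es (length es) h i k)"

lemma entry_count_Suc:
  "entry_count es (Suc x) h i k = entry_count es x h i k +
     (if hd (es ! x) = i \<and> (\<forall>v\<in>set (tl (es ! x)). h v = k) then 1 else 0)"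
proof -
  define P where "P y \<longleftrightarrow> hd (es ! y) = i \<and> (\<forall>v\<in>set (tl (es ! y)). h v = k)" for y
  have "{y. y < Suc x \<and> P y} = (if P x then insert x {y. y < x \<and> P y} else {y. y < x \<and> P y})"
    by (auto elim: less_SucE)
  then have "card {y. y < Suc x \<and> P y} = card {y. y < x \<and> P y} + (if P x then 1 else 0)"
    by (auto simp del: Collect_conj_eq)
  then show ?thesis unfolding entry_count_def P_def .
qed

lemma effect_count_prog:
  assumes d: "2 \<le> d" and len: "length e = d" and e: "set e \<subseteq> {..<n}"
    and ent: "\<And>j. j < d \<Longrightarrow> s 2 (int d * s 13 0 + int j) = int (e ! j)"
    and h: "\<And>i. i < n \<Longrightarrow> s 4 (int i) = int (h i)" and c: "h (e ! 1) = c"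
  shows "effect (count_prog K d) s 5 =
      (if \<forall>v\<in>set (tl e). h v = c
       then (s 5)(int K * int (hd e) + int c :=
               s 5 (int K * int (hd e) + int c) + int (K + 1))
       else s 5)"
    and "same_off {5, 10, 14} s (effect (count_prog K d) s)"
proof -
  let ?P = "unroll d (\<lambda>j. if j = 0 then Skip
        else Cond (Cell 4 (entry_node d j)) (V 10) (Assign 14 (Const 0))
          (Cond (V 10) (Cell 4 (entry_node d j)) (Assign 14 (Const 0)) Skip))"
  let ?s = "effect (Assign 14 (Const 1)) (effect (Assign 10 (Cell 4 (entry_node d 1))) s)"
  let ?I = "\<lambda>l u. same_off {14} ?s u \<and>
     u 14 0 = (if \<forall>j<l. j \<noteq> 0 \<longrightarrow> h (e ! j) = c then 1 else 0)"
  have he: "s 4 (s 2 (int d * s 13 0 + int j)) = int (h (e ! j))" if "j < d" for j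
  proof -
    have "e ! j \<in> set e" using that len by simp
    then have "e ! j < n" using e by blast
    then show ?thesis using ent[OF that] h by simp
  qed
  have s1: "?s 2 = s 2" "?s 4 = s 4" "?s 5 = s 5" "?s 13 = s 13" "?s 10 0 = int c" "?s 14 0 = 1"
    "same_off {10, 14} s ?s"
    using he[of 1] d c by (simp_all add: entry_node_def)
  have after: "u 2 = s 2" "u 4 = s 4" "u 5 = s 5" "u 13 = s 13" "u 10 0 = int c"
    if "same_off {14} ?s u" for u
    using that s1 unfolding same_off_def by simp_all
  have I: "?I d (effect ?P ?s)"
  proof (rule effect_unroll[where I = ?I])
    fix l u assume l: "l < d" and I: "?I l u"
    have u: "u 10 0 = int c" "u 4 (u 2 (int d * u 13 0 + int l)) = int (h (e ! l))"
      using after[of u] I he[OF l] by simp_all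
    have split: "(\<forall>j<Suc l. j \<noteq> 0 \<longrightarrow> h (e ! j) = c) \<longleftrightarrow>
        (\<forall>j<l. j \<noteq> 0 \<longrightarrow> h (e ! j) = c) \<and> (l \<noteq> 0 \<longrightarrow> h (e ! l) = c)"
      by (auto simp: less_Suc_eq)
    show "?I (Suc l) (effect (if l = 0 then Skip
        else Cond (Cell 4 (entry_node d l)) (V 10) (Assign 14 (Const 0))
          (Cond (V 10) (Cell 4 (entry_node d l)) (Assign 14 (Const 0)) Skip)) u)"
      unfolding split using I u by (auto simp: entry_node_def)
  qed (use s1 in simp)
  define u where "u = effect ?P ?s"
  have off: "same_off {14} ?s u" using I unfolding u_def by blast
  note u = after[OF off]
  have e_ne: "e \<noteq> []" using len d by auto
  have tl: "set (tl e) = {e ! j | j. j < d \<and> j \<noteq> 0}"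
  proof (intro equalityI subsetI)
    fix v assume "v \<in> set (tl e)"
    then obtain i where i: "i < length (tl e)" "v = tl e ! i" by (auto simp: in_set_conv_nth)
    then have "v = e ! Suc i" "Suc i < d" using len by (auto simp: nth_tl)
    then show "v \<in> {e ! j | j. j < d \<and> j \<noteq> 0}" by blast
  next
    fix v assume "v \<in> {e ! j | j. j < d \<and> j \<noteq> 0}"
    then obtain j where j: "v = e ! j" "j < d" "j \<noteq> 0" by blast
    then have "v = tl e ! (j - 1)" "j - 1 < length (tl e)" using len by (auto simp: nth_tl)
    then show "v \<in> set (tl e)" by simp
  qed
  have flag: "u 14 0 = (if \<forall>v\<in>set (tl e). h v = c then 1 else 0)"
  proof -
    have "u 14 0 = (if \<forall>j<d. j \<noteq> 0 \<longrightarrow> h (e ! j) = c then 1 else 0)"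
      using I unfolding u_def by blast
    moreover have "(\<forall>v\<in>set (tl e). h v = c) \<longleftrightarrow> (\<forall>j<d. j \<noteq> 0 \<longrightarrow> h (e ! j) = c)"
      unfolding tl by blast
    ultimately show ?thesis by simp
  qed
  have e0: "u 2 (int d * u 13 0) = int (hd e)"
    using ent[of 0] d u e_ne by (simp add: hd_conv_nth)
  have eq: "effect (count_prog K d) s = effect (Cond (Const 0) (V 14)
        (Put 5 (Add (times_const K (entry_node d 0)) (V 10))
           (Add (Cell 5 (Add (times_const K (entry_node d 0)) (V 10))) (Const (int (K + 1)))))
        Skip) u"
    by (simp only: count_prog_def effect.simps(2) u_def)
  show "effect (count_prog K d) s 5 =
      (if \<forall>v\<in>set (tl e). h v = c
       then (s 5)(int K * int (hd e) + int c :=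
               s 5 (int K * int (hd e) + int c) + int (K + 1))
       else s 5)"
    unfolding eq using u flag e0 by (simp add: entry_node_def)
  have "same_off {5, 10, 14} s u"
    using same_off_trans[of "{5, 10, 14}" s ?s u] same_off_mono[OF off] same_off_mono[OF s1(7)] by simp
  then show "same_off {5, 10, 14} s (effect (count_prog K d) s)"
    unfolding eq by simp
qed

definition apply_const :: "nat \<Rightarrow> nat \<Rightarrow> nat" where
  "apply_const K d = fill_const K (\<lambda>_. Const 0) + (14 + cost (count_prog K d))"

lemma runs_apply_prog:
  assumes d: "2 \<le> d" and es: "\<And>e. e \<in> set es \<Longrightarrow> length e = d \<and> set e \<subseteq> {..<n}"
    and s: "s 0 0 = int n" "s 0 2 = int (length es)" "holds_entries d es s"
    and h: "\<And>i. i < n \<Longrightarrow> s 4 (int i) = int (h i) \<and> h i < K"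
  shows "runs (apply_prog K d) s ((n + 1 + length es) * apply_const K d)
    (\<lambda>s'. holds_costs n K (power_costs K es h) s' \<and> same_off {5, 9, 10, 13, 14} s s')"
proof -
  define I where "I x s' \<longleftrightarrow> s' 13 0 = int x \<and>
     holds_costs n K (\<lambda>i k. int ((K + 1) * entry_count es x h i k)) s' \<and> same_off {5, 9, 10, 13, 14} s s'" for x s'
  let ?Q = "\<lambda>s'. holds_costs n K (\<lambda>i k. 0) s' \<and> same_off {5, 9} s s'"
  have 1: "runs (fill_prog K (\<lambda>_. Const 0)) s ((n + 1) * fill_const K (\<lambda>_. Const 0)) ?Q"
    using s by (intro runs_fill_prog) auto
  have 2: "runs (For 13 (Cell 0 (Const 2)) (count_prog K d)) s'
    ((length es + 1) * (12 + ops (Cell 0 (Const 2)) + cost (count_prog K d))) (I (length es))" if Q: "?Q s'" for s'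
  proof (rule runs_For)
    show "I 0 (s'(13 := (s' 13)(0 := 0)))"
      using Q by (auto simp: I_def holds_costs_def entry_count_def same_off_def)
  next
    fix x s' assume "I x s'"
    then show "s' 13 0 = int x \<and> val s' (Cell 0 (Const 2)) = int (length es)"
      using s by (simp add: I_def same_off_def)
  next
    fix x u assume I: "I x u" and x: "x < length es"
    let ?e = "es ! x"
    define k0 where "k0 = h (?e ! 1)"
    have len: "length ?e = d" and sub: "set ?e \<subseteq> {..<n}" using es[of ?e] x by auto
    have off: "same_off {5, 9, 10, 13, 14} s u" and u13: "u 13 0 = int x" using I by (simp_all add: I_def)
    have "u 2 (int d * u 13 0 + int j) = int (?e ! j)" if "j < d" for j
      using s(3) x that off u13 by (simp add: holds_entries_def same_off_def)
    moreover have "u 4 (int i) = int (h i)" if "i < n" for i using h[OF that] off by (simp add: same_off_def)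
    ultimately have c: "effect (count_prog K d) u 5 =
      (if \<forall>v\<in>set (tl ?e). h v = k0
       then (u 5)(int K * int (hd ?e) + int k0 :=
               u 5 (int K * int (hd ?e) + int k0) + int (K + 1))
       else u 5)" "same_off {5, 10, 14} u (effect (count_prog K d) u)"
      using effect_count_prog[where h = h and s = u and c = k0 and K = K, OF d len sub] k0_def by blast+
    have "?e ! 1 = tl ?e ! 0" "0 < length (tl ?e)" using len d by (auto simp: nth_tl)
    then have e1: "?e ! 1 \<in> set (tl ?e)" using nth_mem[of 0 "tl ?e"] by simp
    have "?e ! 1 \<in> set ?e" using len d by simp
    then have "?e ! 1 < n" using sub by blast
    then have hK: "k0 < K" using h unfolding k0_def by blast
    have cost: "effect (count_prog K d) u 5 (int K * int i + int k) =
        int ((K + 1) * entry_count es (Suc x) h i k)" if ik: "i < n" "k < K" for i k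
    proof -
      have old: "u 5 (int K * int i + int k) = int ((K + 1) * entry_count es x h i k)"
        using I ik by (simp add: I_def holds_costs_def)
      have iff: "hd ?e = i \<and> (\<forall>v\<in>set (tl ?e). h v = k) \<longleftrightarrow>
         (\<forall>v\<in>set (tl ?e). h v = k0) \<and> i = hd ?e \<and> k = k0"
        using e1 k0_def by metis
      show ?thesis
        unfolding entry_count_Suc iff
        using c(1) old index_inj[OF ik(2) hK, of i "hd ?e"] by (auto simp: algebra_simps)
    qed
    show "runs (count_prog K d) u (cost (count_prog K d))
       (\<lambda>s''. s'' 13 0 = int x \<and> I (Suc x) (s''(13 := (s'' 13)(0 := int (Suc x)))))"
    proof (rule runs_loop_free)
      show "loop_free (count_prog K d)" by (simp add: count_prog_def)
      show "effect (count_prog K d) u 13 0 = int x \<and>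
        I (Suc x) ((effect (count_prog K d) u)(13 := (effect (count_prog K d) u 13)(0 := int (Suc x))))"
        using cost c(2) off u13 by (auto simp: I_def holds_costs_def same_off_def)
    qed
  qed
  have "runs (apply_prog K d) s ((n + 1) * fill_const K (\<lambda>_. Const 0) +
      (length es + 1) * (12 + ops (Cell 0 (Const 2)) + cost (count_prog K d))) (I (length es))"
    unfolding apply_prog_def by (rule runs_seq[OF 1 2])
  then show ?thesis
  proof (rule runs_weaken)
    have "(n + 1) * fill_const K (\<lambda>_. Const 0) \<le> (n + 1 + length es) * fill_const K (\<lambda>_. Const 0)"
      by (rule mult_right_mono) auto
    moreover have "(length es + 1) * (14 + cost (count_prog K d)) \<le> (n + 1 + length es) * (14 + cost (count_prog K d))"
      by (rule mult_right_mono) auto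
    moreover have "12 + ops (Cell 0 (Const 2)) = 14" by simp
    ultimately show "(n + 1) * fill_const K (\<lambda>_. Const 0) +
      (length es + 1) * (12 + ops (Cell 0 (Const 2)) + cost (count_prog K d)) \<le> (n + 1 + length es) * apply_const K d"
      unfolding apply_const_def by (simp only: distrib_left)
  qed (simp add: I_def power_costs_def[abs_def])
qed

lemma runs_output_prog:
  assumes s: "s 0 0 = int n" and h: "\<And>i. i < n \<Longrightarrow> s 4 (int i) = int (h i) \<and> h i < K"
    and zero: "\<And>x. s 3 x = 0"
  shows "runs (output_prog K) s ((n + 1) * (20 + ops (times_const K (V 9))))
    (\<lambda>s'. \<forall>i<n. \<forall>k<K. s' 3 (int K * int i + int k) = (if h i = k then 1 else 0))"
proof -
  let ?P = "Put 3 (Add (times_const K (V 9)) (Cell 4 (V 9))) (Const 1)"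
  define I where "I j s' \<longleftrightarrow> s' 9 0 = int j \<and> (\<forall>i<n. \<forall>k<K. s' 3 (int K * int i + int k) =
     (if i < j \<and> h i = k then 1 else 0)) \<and> same_off {3, 9} s s'" for j s'
  have "runs (output_prog K) s ((n + 1) * (12 + ops (Cell 0 (Const 0)) + cost ?P)) (I n)"
    unfolding output_prog_def
  proof (rule runs_For)
    show "I 0 (s(9 := (s 9)(0 := 0)))" using zero by (simp add: I_def)
  next
    fix j s' assume "I j s'"
    then show "s' 9 0 = int j \<and> val s' (Cell 0 (Const 0)) = int n"
      using s by (simp add: I_def same_off_def)
  next
    fix j u assume I: "I j u" and j: "j < n"
    have u4: "u 4 (int j) = int (h j)" "h j < K" using I h[OF j] by (auto simp: I_def same_off_def)
    show "runs ?P u (cost ?P) (\<lambda>s''. s'' 9 0 = int j \<and> I (Suc j) (s''(9 := (s'' 9)(0 := int (Suc j)))))"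
      by (rule runs_loop_free)
         (use I u4 index_inj[of _ K "h j" _ j] in \<open>auto simp: I_def less_Suc_eq\<close>)
  qed
  then show ?thesis by (rule runs_weaken) (auto simp: I_def)
qed

definition ptpm_const :: "nat \<Rightarrow> nat \<Rightarrow> nat" where
  "ptpm_const K d = 12 + ops (times_const K (V 8)) +
     fill_const K (\<lambda>k. times_const (K + 1) (Cell 1 (Add (times_const K (V 9)) (Const (int k))))) +
     project_const K + (15 + apply_const K d + project_const K) + (20 + ops (times_const K (V 9)))"

text \<open>With degrees at most M there are at most n M entries, and no score exceeds (K + 1) M. So
counting the scores is cheaper than the projection that follows.\<close>

lemma runs_ptpm_prog:
  fixes H0 :: "nat \<Rightarrow> nat \<Rightarrow> int"
  assumes K: "0 < K" and n: "0 < n" "K dvd n" and d: "2 \<le> d"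
    and es: "\<And>e. e \<in> set es \<Longrightarrow> length e = d \<and> set e \<subseteq> {..<n}"
    and s: "s 0 0 = int n" "s 0 1 = int N" "s 0 2 = int (length es)" "holds_entries d es s" "\<And>x. s 3 x = 0"
    and H0: "\<And>i k. i < n \<Longrightarrow> k < K \<Longrightarrow> s 1 (int K * int i + int k) = H0 i k \<and> 0 \<le> H0 i k \<and> H0 i k \<le> 1"
    and M: "1 \<le> M" "\<And>i k h. i < n \<Longrightarrow> entry_count es (length es) h i k \<le> M" "length es \<le> n * M"
  shows "runs (ptpm_prog K d) s ((N + 1) * (n + 1) * ((K + 1) * M + 1) * ptpm_const K d)
    (\<lambda>s'. \<exists>hs. optimal n K H0 (hs 0) \<and> (\<forall>t<N. optimal n K (power_costs K es (hs t)) (hs (Suc t))) \<and>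
       (\<forall>i<n. \<forall>k<K. s' 3 (int K * int i + int k) = (if hs N i = k then 1 else 0)))"
proof -
  define m where "m = n div K"
  have nm: "n = K * m" using n by (simp add: m_def)
  have m: "0 < m" using n nm by (cases m) auto
  let ?M = "int ((K + 1) * M)"
  let ?D = "(n + 1) * (nat ?M + 1)"
  let ?C0 = "\<lambda>i k. int (K + 1) * H0 i k"
  let ?f = "\<lambda>k. times_const (K + 1) (Cell 1 (Add (times_const K (V 9)) (Const (int k))))"
  let ?X = "{4, 5, 6, 7, 8, 9, 10, 11, 12, 13, 14, 15} :: nat set"
  \<comment> \<open>The first projection is the same auction, with the initial 0/1 matrix as scores.\<close>
  have A0: "auction n m K ?C0 ?M"
  proof
    fix i k assume ik: "i < n" "k < K"
    show "int (K + 1) dvd ?C0 i k" by simp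
    show "0 \<le> ?C0 i k" using H0[OF ik] by simp
    have "?C0 i k \<le> int (K + 1) * 1" using H0[OF ik] by (intro mult_left_mono) auto
    also have "\<dots> \<le> ?M" unfolding of_nat_mult using M(1) by (intro mult_left_mono) auto
    finally show "?C0 i k \<le> ?M" .
  qed (use K m nm in auto)
  have A: "auction n m K (power_costs K es h) ?M" for h
  proof
    fix i k assume ik: "i < n" "k < K"
    show "int (K + 1) dvd power_costs K es h i k" unfolding power_costs_def by (simp only: of_nat_mult dvd_triv_left)
    show "0 \<le> power_costs K es h i k" by (simp add: power_costs_def)
    show "power_costs K es h i k \<le> ?M"
      unfolding power_costs_def of_nat_le_iff using M(2)[OF ik(1)] by (rule mult_left_mono) simp
  qed (use K m nm in auto)
  have opt0: "optimal n K H0 h" if "optimal n K ?C0 h" for h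
    using that unfolding optimal_def sum_distrib_left[symmetric] by (simp del: of_nat_add of_nat_Suc)
  have opt_less: "h i < K" if "optimal n K C h" "i < n" for h C i
    using that by (auto simp: optimal_def balanced_fun_def)
  define I where "I t u \<longleftrightarrow> u 12 0 = int t \<and> u 8 0 = int m \<and> same_off ?X s u \<and>
     (\<exists>hs. optimal n K H0 (hs 0) \<and> (\<forall>t'<t. optimal n K (power_costs K es (hs t')) (hs (Suc t'))) \<and>
       (\<forall>i<n. u 4 (int i) = int (hs t i) \<and> hs t i < K))" for t u
  let ?Q1 = "\<lambda>u. u 8 0 = int m \<and> same_off {8} s u"
  let ?Q2 = "\<lambda>u. u 8 0 = int m \<and> same_off {5, 8, 9} s u \<and> holds_costs n K ?C0 u"
  let ?Q3 = "\<lambda>u. u 8 0 = int m \<and> same_off ?X s u \<and>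
     (\<exists>h. optimal n K H0 h \<and> (\<forall>i<n. u 4 (int i) = int (h i)))"
  let ?Q = "\<lambda>s'. \<exists>hs. optimal n K H0 (hs 0) \<and> (\<forall>t<N. optimal n K (power_costs K es (hs t)) (hs (Suc t))) \<and>
       (\<forall>i<n. \<forall>k<K. s' 3 (int K * int i + int k) = (if hs N i = k then 1 else 0))"
  have 1: "runs (div_prog K) s ((n + 1) * (12 + ops (times_const K (V 8)))) ?Q1"
    using runs_div_prog[OF K, of s m] s nm by simp
  have 2: "runs (fill_prog K ?f) u ((n + 1) * fill_const K ?f) ?Q2" if Q: "?Q1 u" for u
  proof -
    have "runs (fill_prog K ?f) u ((n + 1) * fill_const K ?f) (\<lambda>s'. holds_costs n K ?C0 s' \<and> same_off {5, 9} u s')"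
    proof (rule runs_fill_prog)
      fix s' i k assume "same_off {5, 9} u s'" "s' 9 0 = int i" "i < n" "k < K"
      then show "val s' (?f k) = ?C0 i k" using Q H0[of i k] by (simp add: same_off_def algebra_simps)
    qed (use Q s in \<open>simp add: same_off_def\<close>)
    then show ?thesis by (rule runs_weaken) (use Q in \<open>auto simp: same_off_def\<close>)
  qed
  have 3: "runs (project_prog K) u (?D * project_const K) ?Q3" if Q: "?Q2 u" for u
  proof -
    have "runs (project_prog K) u (?D * project_const K)
      (\<lambda>s'. \<exists>h. optimal n K ?C0 h \<and> (\<forall>i<n. s' 4 (int i) = int (h i)) \<and> same_off {4, 6, 7, 9, 10, 11, 15} u s')"
      by (rule auction.runs_project[OF A0]) (use Q s in \<open>auto simp: same_off_def\<close>)
    then show ?thesis by (rule runs_weaken) (use Q opt0 in \<open>auto simp: same_off_def\<close>)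
  qed
  have iter: "runs (Seq (apply_prog K d) (project_prog K)) u
      ((n + 1 + length es) * apply_const K d + ?D * project_const K)
      (\<lambda>s''. s'' 12 0 = int t \<and> I (Suc t) (s''(12 := (s'' 12)(0 := int (Suc t)))))"
    if I: "I t u" for t u
  proof -
    obtain hs where hs: "optimal n K H0 (hs 0)" "\<forall>t'<t. optimal n K (power_costs K es (hs t')) (hs (Suc t'))"
      "\<And>i. i < n \<Longrightarrow> u 4 (int i) = int (hs t i) \<and> hs t i < K" using I by (auto simp: I_def)
    have off: "same_off ?X s u" "u 8 0 = int m" "u 12 0 = int t" using I by (auto simp: I_def)
    let ?R = "\<lambda>s'. holds_costs n K (power_costs K es (hs t)) s' \<and> same_off {5, 9, 10, 13, 14} u s'"
    have a: "runs (apply_prog K d) u ((n + 1 + length es) * apply_const K d) ?R"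
      by (rule runs_apply_prog[where h = "hs t" and s = u, OF d es])
         (use off s hs(3) in \<open>auto simp: same_off_def holds_entries_def\<close>)
    have b: "runs (project_prog K) u' (?D * project_const K)
      (\<lambda>s''. s'' 12 0 = int t \<and> I (Suc t) (s''(12 := (s'' 12)(0 := int (Suc t)))))" if R: "?R u'" for u'
    proof -
      have "runs (project_prog K) u' (?D * project_const K)
       (\<lambda>s'. \<exists>h. optimal n K (power_costs K es (hs t)) h \<and> (\<forall>i<n. s' 4 (int i) = int (h i)) \<and>
          same_off {4, 6, 7, 9, 10, 11, 15} u' s')"
        by (rule auction.runs_project[OF A]) (use R off s in \<open>auto simp: same_off_def\<close>)
      then show ?thesis
      proof (rule runs_weaken[OF _ order_refl], elim exE conjE)
        fix s' h assume h: "optimal n K (power_costs K es (hs t)) h" "\<forall>i<n. s' 4 (int i) = int (h i)"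
          "same_off {4, 6, 7, 9, 10, 11, 15} u' s'"
        let ?hs = "hs(Suc t := h)"
        have "same_off ?X s s'" "s' 8 0 = int m" "s' 12 0 = int t" using off R h(3) by (auto simp: same_off_def)
        then show "s' 12 0 = int t \<and> I (Suc t) (s'(12 := (s' 12)(0 := int (Suc t))))"
          unfolding I_def using hs h opt_less[OF h(1)]
          by (intro conjI exI[of _ ?hs]) (auto simp: less_Suc_eq)
      qed
    qed
    show ?thesis by (rule runs_seq[OF a b])
  qed
  let ?L = "Seq (apply_prog K d) (project_prog K)"
  let ?B = "(n + 1 + length es) * apply_const K d + ?D * project_const K"
  have 4: "runs (For 12 (Cell 0 (Const 1)) ?L) u ((N + 1) * (12 + ops (Cell 0 (Const 1)) + ?B)) (I N)" if Q: "?Q3 u" for u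
  proof (rule runs_For)
    obtain h where "optimal n K H0 h" "\<forall>i<n. u 4 (int i) = int (h i)" using Q by blast
    then show "I 0 (u(12 := (u 12)(0 := 0)))"
      unfolding I_def using Q opt_less by (intro conjI exI[of _ "\<lambda>_. h"]) auto
  next
    fix t u assume "I t u"
    then show "u 12 0 = int t \<and> val u (Cell 0 (Const 1)) = int N"
      using s by (simp add: I_def same_off_def)
  qed (use iter in blast)
  have 5: "runs (output_prog K) u ((n + 1) * (20 + ops (times_const K (V 9)))) ?Q" if I: "I N u" for u
  proof -
    obtain hs where hs: "optimal n K H0 (hs 0)" "\<forall>t'<N. optimal n K (power_costs K es (hs t')) (hs (Suc t'))"
      "\<And>i. i < n \<Longrightarrow> u 4 (int i) = int (hs N i) \<and> hs N i < K" using I by (auto simp: I_def)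
    have "runs (output_prog K) u ((n + 1) * (20 + ops (times_const K (V 9))))
      (\<lambda>s'. \<forall>i<n. \<forall>k<K. s' 3 (int K * int i + int k) = (if hs N i = k then 1 else 0))"
      by (rule runs_output_prog[where h = "hs N" and s = u]) (use I s hs(3) in \<open>auto simp: I_def same_off_def\<close>)
    then show ?thesis by (rule runs_weaken) (use hs in auto)
  qed
  have "runs (ptpm_prog K d) s ((n + 1) * (12 + ops (times_const K (V 8))) + ((n + 1) * fill_const K ?f +
     (?D * project_const K + ((N + 1) * (12 + ops (Cell 0 (Const 1)) + ?B) + (n + 1) * (20 + ops (times_const K (V 9))))))) ?Q"
    unfolding ptpm_prog_def
    by (rule runs_seq[OF 1 runs_seq[OF 2 runs_seq[OF 3 runs_seq[OF 4 5]]]])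
  then show ?thesis
  proof (rule runs_weaken)
    let ?T = "(N + 1) * (n + 1) * ((K + 1) * M + 1)"
    have D: "?D = (n + 1) * ((K + 1) * M + 1)" by (simp only: nat_int)
    have DT: "?D \<le> ?T" unfolding D mult.assoc[of "N + 1"] by simp
    have nD: "n + 1 \<le> ?D" by simp
    have "n + 1 + length es \<le> (n + 1) + (n + 1) * M" using M(3) by simp
    also have "\<dots> \<le> ?D" unfolding D by (simp add: algebra_simps)
    finally have esD: "n + 1 + length es \<le> ?D" .
    have "?B \<le> ?D * apply_const K d + ?D * project_const K"
      using mult_right_mono[OF esD, of "apply_const K d"] by simp
    moreover have "12 + ops (Cell 0 (Const 1)) \<le> ?D * 15"
      using nD by simp
    ultimately have "12 + ops (Cell 0 (Const 1)) + ?B \<le> ?D * (15 + apply_const K d + project_const K)"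
      unfolding distrib_left[of ?D] by linarith
    then have "(N + 1) * (12 + ops (Cell 0 (Const 1)) + ?B) \<le> (N + 1) * (?D * (15 + apply_const K d + project_const K))"
      by (rule mult_left_mono) simp
    also have "\<dots> = ?T * (15 + apply_const K d + project_const K)" unfolding D by (simp only: mult.assoc)
    finally have 1: "(N + 1) * (12 + ops (Cell 0 (Const 1)) + ?B) \<le> ?T * (15 + apply_const K d + project_const K)" .
    have 2: "(n + 1) * x \<le> ?T * x" "?D * x \<le> ?T * x" for x
      using nD DT by (auto intro!: mult_right_mono)
    show "(n + 1) * (12 + ops (times_const K (V 8))) + ((n + 1) * fill_const K ?f +
     (?D * project_const K + ((N + 1) * (12 + ops (Cell 0 (Const 1)) + ?B) + (n + 1) * (20 + ops (times_const K (V 9))))))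
       \<le> ?T * ptpm_const K d"
      unfolding ptpm_const_def distrib_left[of ?T]
      using 1 2(1)[of "12 + ops (times_const K (V 8))"] 2(1)[of "fill_const K ?f"]
        2(2)[of "project_const K"] 2(1)[of "20 + ops (times_const K (V 9))"]
      unfolding distrib_left[of ?T] by linarith
  qed
qed

section \<open>Assignments as matrices\<close>

definition assign_mat :: "nat \<Rightarrow> nat \<Rightarrow> (nat \<Rightarrow> nat) \<Rightarrow> real mat" where
  "assign_mat n K h = mat n K (\<lambda>(i, k). if h i = k then 1 else 0)"

lemma assign_mat_carrier [simp]: "assign_mat n K h \<in> carrier_mat n K"
  "dim_row (assign_mat n K h) = n" "dim_col (assign_mat n K h) = K"
  by (simp_all add: assign_mat_def)

lemma assign_mat_index [simp]:
  "i < n \<Longrightarrow> k < K \<Longrightarrow> assign_mat n K h $$ (i, k) = (if h i = k then 1 else 0)"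
  by (simp add: assign_mat_def)

lemma assign_mat_cong: "(\<And>i. i < n \<Longrightarrow> h i = h' i) \<Longrightarrow> assign_mat n K h = assign_mat n K h'"
  by (rule eq_matI) auto

lemma assign_mat_eqD:
  assumes "assign_mat n K h = assign_mat n K h'" "i < n" "h i < K"
  shows "h' i = h i"
proof -
  have "assign_mat n K h' $$ (i, h i) = 1" using assms(2,3) unfolding assms(1)[symmetric] by simp
  then show ?thesis by (simp add: assms(2,3) split: if_splits)
qed

lemma row_assign_mat:
  "i < n \<Longrightarrow> row (assign_mat n K h) i = vec K (\<lambda>k. if h i = k then 1 else 0)"
  by (intro eq_vecI) auto

lemma assignments_iff:
  "H \<in> assignments n K \<longleftrightarrow> (\<exists>h. (\<forall>i<n. h i < K) \<and> H = assign_mat n K h)"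
proof
  assume H: "H \<in> assignments n K"
  then have "\<forall>i. \<exists>k. i < n \<longrightarrow> k < K \<and> row H i = unit_vec K k" by (auto simp: assignments_def)
  then obtain h where h: "\<And>i. i < n \<Longrightarrow> h i < K \<and> row H i = unit_vec K (h i)" by metis
  have "H = assign_mat n K h"
  proof (rule eq_matI)
    fix i j assume ij: "i < dim_row (assign_mat n K h)" "j < dim_col (assign_mat n K h)"
    then have "H $$ (i, j) = row H i $ j" using H by (auto simp: assignments_def)
    also have "\<dots> = assign_mat n K h $$ (i, j)" using h[of i] ij by (auto simp: unit_vec_def)
    finally show "H $$ (i, j) = assign_mat n K h $$ (i, j)" .
  qed (use H in \<open>auto simp: assignments_def\<close>)
  then show "\<exists>h. (\<forall>i<n. h i < K) \<and> H = assign_mat n K h" using h by blast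
next
  assume "\<exists>h. (\<forall>i<n. h i < K) \<and> H = assign_mat n K h"
  then obtain h where h: "\<forall>i<n. h i < K" "H = assign_mat n K h" by blast
  have "row H i = unit_vec K (h i)" if "i < n" for i
    using that h by (intro eq_vecI) (auto simp: unit_vec_def)
  then show "H \<in> assignments n K" using h by (auto simp: assignments_def)
qed

lemma balanced_iff:
  "H \<in> balanced n K \<longleftrightarrow> (\<exists>h. balanced_fun n K h \<and> H = assign_mat n K h)"
proof
  assume H: "H \<in> balanced n K"
  then have car: "H \<in> carrier_mat n K" and el: "elements_mat H \<subseteq> {0, 1}"
    and rows: "H *\<^sub>v ones_vec K = ones_vec n"
    and cols: "transpose_mat H *\<^sub>v ones_vec n = real (n div K) \<cdot>\<^sub>v ones_vec K"
    by (auto simp: balanced_def)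
  have val: "H $$ (i, k) = 0 \<or> H $$ (i, k) = 1" if "i < n" "k < K" for i k
    using el elements_matI[OF car that refl] by auto
  have rowsum: "(\<Sum>k<K. H $$ (i, k)) = 1" if i: "i < n" for i
  proof -
    have "(H *\<^sub>v ones_vec K) $ i = 1" using rows i by (simp add: ones_vec_def)
    then show ?thesis using i car by (simp add: ones_vec_def scalar_prod_def lessThan_atLeast0)
  qed
  have colsum: "(\<Sum>i<n. H $$ (i, k)) = real (n div K)" if k: "k < K" for k
  proof -
    have "(transpose_mat H *\<^sub>v ones_vec n) $ k = real (n div K)" using cols k by (simp add: ones_vec_def)
    then show ?thesis using k car by (simp add: ones_vec_def scalar_prod_def lessThan_atLeast0)
  qed
  have "\<exists>k<K. \<forall>l<K. H $$ (i, l) = (if k = l then 1 else 0)" if i: "i < n" for i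
  proof -
    have "\<exists>k<K. H $$ (i, k) = 1"
    proof (rule ccontr)
      assume "\<not> ?thesis"
      then have "(\<Sum>k<K. H $$ (i, k)) = 0" using val[OF i] by (intro sum.neutral) auto
      then show False using rowsum[OF i] by simp
    qed
    then obtain k where k: "k < K" "H $$ (i, k) = 1" by blast
    have "(\<Sum>l\<in>{..<K} - {k}. H $$ (i, l)) = 0"
      using rowsum[OF i] k by (simp add: sum.remove[of "{..<K}" k])
    then have "\<forall>l\<in>{..<K} - {k}. H $$ (i, l) = 0"
      using val[OF i] by (subst (asm) sum_nonneg_eq_0_iff) force+
    then show ?thesis using k by (intro exI[of _ k]) auto
  qed
  then obtain h where h: "\<And>i. i < n \<Longrightarrow> h i < K \<and> (\<forall>l<K. H $$ (i, l) = (if h i = l then 1 else 0))"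
    by metis
  have eq: "H = assign_mat n K h" by (rule eq_matI) (use h car in auto)
  have "card (members n h k) = n div K" if k: "k < K" for k
  proof -
    have "(\<Sum>i<n. H $$ (i, k)) = (\<Sum>i<n. if h i = k then 1 else 0)"
      using h k by (intro sum.cong) auto
    also have "\<dots> = real (card (members n h k))"
      by (simp add: sum.If_cases members_def Int_def)
    finally show ?thesis using colsum[OF k] by simp
  qed
  then show "\<exists>h. balanced_fun n K h \<and> H = assign_mat n K h"
    using h eq by (auto simp: balanced_fun_def)
next
  assume "\<exists>h. balanced_fun n K h \<and> H = assign_mat n K h"
  then obtain h where h: "\<And>i. i < n \<Longrightarrow> h i < K" "\<And>k. k < K \<Longrightarrow> card (members n h k) = n div K"
    and H: "H = assign_mat n K h" by (auto simp: balanced_fun_def)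
  have "(\<Sum>i<n. if h i = k then 1 else 0) = real (card (members n h k))" for k
    by (simp add: sum.If_cases members_def Int_def)
  then have "transpose_mat H *\<^sub>v ones_vec n = real (n div K) \<cdot>\<^sub>v ones_vec K"
    unfolding H using h(2)
    by (intro eq_vecI) (simp_all add: ones_vec_def scalar_prod_def lessThan_atLeast0)
  moreover have "H *\<^sub>v ones_vec K = ones_vec n"
    unfolding H using h(1)
    by (intro eq_vecI) (simp_all add: ones_vec_def scalar_prod_def lessThan_atLeast0)
  moreover have "elements_mat H \<subseteq> {0, 1}" by (auto simp: H elements_mat_def)
  ultimately show "H \<in> balanced n K" by (simp add: balanced_def H)
qed

lemma frob_norm_sq: "C \<in> carrier_mat n K \<Longrightarrow> (frob_norm C)\<^sup>2 = (\<Sum>i<n. \<Sum>k<K. (C $$ (i, k))\<^sup>2)"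
  by (auto simp: frob_norm_def sum_nonneg)

lemma frob_norm_nonneg: "0 \<le> frob_norm C"
  by (simp add: frob_norm_def sum_nonneg)

text \<open>All assignment matrices have the same norm, so minimising the distance to C means maximising
the inner product with C.\<close>

lemma frob_norm_assign_mat_diff:
  assumes C: "C \<in> carrier_mat n K" and h: "\<forall>i<n. h i < K"
  shows "(frob_norm (assign_mat n K h - C))\<^sup>2 =
    (\<Sum>i<n. \<Sum>k<K. (C $$ (i, k))\<^sup>2) + real n - 2 * (\<Sum>i<n. C $$ (i, h i))"
proof -
  have row: "(\<Sum>k<K. ((assign_mat n K h - C) $$ (i, k))\<^sup>2) = (\<Sum>k<K. (C $$ (i, k))\<^sup>2) + (1 - 2 * C $$ (i, h i))"
    if i: "i < n" for i
  proof -
    have "(\<Sum>k<K. ((assign_mat n K h - C) $$ (i, k))\<^sup>2) =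
       (\<Sum>k<K. (C $$ (i, k))\<^sup>2 + (if h i = k then 1 - 2 * C $$ (i, k) else 0))"
      using i C by (intro sum.cong) (auto simp: power2_eq_square algebra_simps)
    also have "\<dots> = (\<Sum>k<K. (C $$ (i, k))\<^sup>2) + (1 - 2 * C $$ (i, h i))"
      using h i by (simp add: sum.distrib)
    finally show ?thesis .
  qed
  have "(frob_norm (assign_mat n K h - C))\<^sup>2 = (\<Sum>i<n. (\<Sum>k<K. (C $$ (i, k))\<^sup>2) + (1 - 2 * C $$ (i, h i)))"
    using C row by (subst frob_norm_sq[of _ n K]) (auto intro!: sum.cong)
  then show ?thesis by (simp add: sum.distrib sum_subtractf sum_distrib_left)
qed

lemma proj_iff:
  assumes C: "C \<in> carrier_mat n K"
  shows "H \<in> proj n K C \<longleftrightarrow> (\<exists>h. balanced_fun n K h \<and> H = assign_mat n K h \<and>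
    (\<forall>h'. balanced_fun n K h' \<longrightarrow> (\<Sum>i<n. C $$ (i, h' i)) \<le> (\<Sum>i<n. C $$ (i, h i))))"
proof -
  have cmp: "frob_norm (assign_mat n K h' - C) < frob_norm (assign_mat n K h - C) \<longleftrightarrow>
     (\<Sum>i<n. C $$ (i, h i)) < (\<Sum>i<n. C $$ (i, h' i))"
    if "balanced_fun n K h" "balanced_fun n K h'" for h h'
  proof -
    have "frob_norm (assign_mat n K h' - C) < frob_norm (assign_mat n K h - C) \<longleftrightarrow>
       (frob_norm (assign_mat n K h' - C))\<^sup>2 < (frob_norm (assign_mat n K h - C))\<^sup>2"
      using frob_norm_nonneg by (smt (verit) power_strict_mono power_mono pos2)
    then show ?thesis
      using that frob_norm_assign_mat_diff[OF C, of h] frob_norm_assign_mat_diff[OF C, of h']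
      by (auto simp: balanced_fun_def)
  qed
  show ?thesis
    unfolding proj_def is_arg_min_def mem_Collect_eq balanced_iff using cmp by (auto simp: not_less) (metis not_less)+
qed

lemma proj_assign_mat:
  assumes C: "C \<in> carrier_mat n K" and h: "balanced_fun n K h"
  shows "assign_mat n K h \<in> proj n K C \<longleftrightarrow>
    (\<forall>h'. balanced_fun n K h' \<longrightarrow> (\<Sum>i<n. C $$ (i, h' i)) \<le> (\<Sum>i<n. C $$ (i, h i)))"
proof
  assume "assign_mat n K h \<in> proj n K C"
  then obtain g where g: "balanced_fun n K g" "assign_mat n K h = assign_mat n K g"
    "\<And>h'. balanced_fun n K h' \<Longrightarrow> (\<Sum>i<n. C $$ (i, h' i)) \<le> (\<Sum>i<n. C $$ (i, g i))"
    unfolding proj_iff[OF C] by blast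
  have "g i = h i" if "i < n" for i using assign_mat_eqD[OF g(2) that] h that by (simp add: balanced_fun_def)
  then show "\<forall>h'. balanced_fun n K h' \<longrightarrow> (\<Sum>i<n. C $$ (i, h' i)) \<le> (\<Sum>i<n. C $$ (i, h i))"
    using g(3) by simp
qed (use h in \<open>auto simp: proj_iff[OF C]\<close>)

text \<open>The entry at (i, k) of the tensor applied to the assignment h.\<close>

definition nbr_count :: "tensor \<Rightarrow> (nat \<Rightarrow> nat) \<Rightarrow> nat \<Rightarrow> nat \<Rightarrow> nat" where
  "nbr_count A h i k = card {js. A (i # js) \<noteq> 0 \<and> (\<forall>j\<in>set js. h j = k)}"

definition ordered_degree :: "tensor \<Rightarrow> nat \<Rightarrow> nat" where
  "ordered_degree A i = card {js. A (i # js) \<noteq> 0}"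

lemma finite_tuples: "finite {js. length js = l \<and> set js \<subseteq> {..<n::nat}}"
  using finite_lists_length_eq[of "{..<n}" l] by (simp add: conj_commute)

lemma adjacency_tensorD:
  assumes "adjacency_tensor n d A"
  shows "A is = 0 \<or> A is = 1" "A is \<noteq> 0 \<Longrightarrow> length is = d" "A is \<noteq> 0 \<Longrightarrow> distinct is"
    "A is \<noteq> 0 \<Longrightarrow> set is \<subseteq> {..<n}"
  using assms unfolding adjacency_tensor_def by (blast | auto)+

lemma finite_nbrs: "adjacency_tensor n d A \<Longrightarrow> finite {js. A (i # js) \<noteq> 0}"
  using adjacency_tensorD[of n d A "i # _"]
  by (intro finite_subset[OF _ finite_tuples[of "d - 1" n]]) fastforce

lemma tensor_apply_assign_mat:
  assumes A: "adjacency_tensor n d A" and ik: "i < n" "k < K"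
  shows "tensor_apply d A (assign_mat n K h) $$ (i, k) = real (nbr_count A h i k)"
proof -
  let ?S = "{js. length js = d - 1 \<and> set js \<subseteq> {..<n}}"
  have pr: "(\<Prod>j\<leftarrow>js. assign_mat n K h $$ (j, k)) = (if \<forall>j\<in>set js. h j = k then 1 else 0)"
    if "set js \<subseteq> {..<n}" for js
    using that by (induction js) (use ik in auto)
  have "tensor_apply d A (assign_mat n K h) $$ (i, k) =
     (\<Sum>js\<in>?S. A (i # js) * (\<Prod>j\<leftarrow>js. assign_mat n K h $$ (j, k)))"
    using ik by (simp add: tensor_apply_def)
  also have "\<dots> = (\<Sum>js\<in>?S. if A (i # js) \<noteq> 0 \<and> (\<forall>j\<in>set js. h j = k) then 1 else 0)"
  proof (intro sum.cong refl)
    fix js assume "js \<in> ?S"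
    then have "set js \<subseteq> {..<n}" by simp
    then show "A (i # js) * (\<Prod>j\<leftarrow>js. assign_mat n K h $$ (j, k)) =
       (if A (i # js) \<noteq> 0 \<and> (\<forall>j\<in>set js. h j = k) then 1 else 0)"
      using pr[of js] adjacency_tensorD(1)[OF A, of "i # js"] by auto
  qed
  also have "\<dots> = real (card {js \<in> ?S. A (i # js) \<noteq> 0 \<and> (\<forall>j\<in>set js. h j = k)})"
    using finite_tuples by (simp add: sum.If_cases Int_def)
  also have "{js \<in> ?S. A (i # js) \<noteq> 0 \<and> (\<forall>j\<in>set js. h j = k)} = {js. A (i # js) \<noteq> 0 \<and> (\<forall>j\<in>set js. h j = k)}"
    using adjacency_tensorD[OF A] by fastforce
  finally show ?thesis by (simp add: nbr_count_def)
qed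

lemma tensor_apply_carrier [simp]: "H \<in> carrier_mat n K \<Longrightarrow> tensor_apply d A H \<in> carrier_mat n K"
  by (simp add: tensor_apply_def)

lemma entry_count_eq_nbr_count:
  assumes A: "adjacency_tensor n d A" and d: "2 \<le> d" and es: "lists_nonzeros A es"
  shows "entry_count es (length es) h i k = nbr_count A h i k"
proof -
  have dist: "distinct es" and set: "set es = {is. A is \<noteq> 0}" using es by (auto simp: lists_nonzeros_def)
  let ?Y = "{y. y < length es \<and> hd (es ! y) = i \<and> (\<forall>v\<in>set (tl (es ! y)). h v = k)}"
  let ?J = "{js. A (i # js) \<noteq> 0 \<and> (\<forall>j\<in>set js. h j = k)}"
  have ne: "e \<noteq> []" if "e \<in> set es" for e using that set adjacency_tensorD(2)[OF A] d by fastforce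
  have "bij_betw (\<lambda>y. tl (es ! y)) ?Y ?J"
  proof (rule bij_betwI')
    fix x y assume xy: "x \<in> ?Y" "y \<in> ?Y"
    show "(tl (es ! x) = tl (es ! y)) = (x = y)"
    proof
      assume "tl (es ! x) = tl (es ! y)"
      then have "es ! x = es ! y"
        using xy ne[of "es ! x"] ne[of "es ! y"] by (metis (mono_tags, lifting) mem_Collect_eq list.collapse nth_mem)
      then show "x = y" using dist xy by (simp add: nth_eq_iff_index_eq)
    qed simp
  next
    fix x assume x: "x \<in> ?Y"
    then have "es ! x \<in> set es" by simp
    moreover from this have "es ! x = i # tl (es ! x)" using x ne by (metis (mono_tags, lifting) mem_Collect_eq list.collapse)
    ultimately show "tl (es ! x) \<in> ?J" using x set by auto
  next
    fix js assume js: "js \<in> ?J"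
    then have "i # js \<in> set es" using set by simp
    then obtain y where "y < length es" "es ! y = i # js" by (auto simp: in_set_conv_nth)
    then show "\<exists>y\<in>?Y. js = tl (es ! y)" using js by (intro bexI[of _ y]) auto
  qed
  then show ?thesis unfolding entry_count_def nbr_count_def by (rule bij_betw_same_card)
qed

lemma nbr_count_le_degree: "adjacency_tensor n d A \<Longrightarrow> nbr_count A h i k \<le> ordered_degree A i"
  unfolding nbr_count_def ordered_degree_def by (intro card_mono finite_nbrs) auto

lemma length_nonzeros_le:
  assumes A: "adjacency_tensor n d A" and d: "2 \<le> d" and es: "lists_nonzeros A es"
    and deg: "\<And>i. i < n \<Longrightarrow> ordered_degree A i \<le> M"
  shows "length es \<le> n * M"
proof -
  have "length es = card {is. A is \<noteq> 0}"
    using es distinct_card[of es] by (auto simp: lists_nonzeros_def)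
  also have "\<dots> \<le> card (\<Union>i<n. (#) i ` {js. A (i # js) \<noteq> 0})"
  proof (rule card_mono)
    show "finite (\<Union>i<n. (#) i ` {js. A (i # js) \<noteq> 0})" using finite_nbrs[OF A] by auto
    show "{is. A is \<noteq> 0} \<subseteq> (\<Union>i<n. (#) i ` {js. A (i # js) \<noteq> 0})"
    proof
      fix e assume "e \<in> {is. A is \<noteq> 0}"
      then have e: "A e \<noteq> 0" "length e = d" "set e \<subseteq> {..<n}" using adjacency_tensorD[OF A] by auto
      then obtain i js where "e = i # js" using d by (cases e) auto
      then show "e \<in> (\<Union>i<n. (#) i ` {js. A (i # js) \<noteq> 0})" using e by auto
    qed
  qed
  also have "\<dots> \<le> (\<Sum>i<n. card ((#) i ` {js. A (i # js) \<noteq> 0}))" by (rule card_UN_le) simp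
  also have "\<dots> \<le> (\<Sum>i<n. M)"
    using deg by (intro sum_mono) (auto simp: ordered_degree_def intro: order_trans[OF card_image_le[OF finite_nbrs[OF A]]])
  finally show ?thesis by simp
qed

definition maximizer :: "nat \<Rightarrow> nat \<Rightarrow> tensor \<Rightarrow> (nat \<Rightarrow> nat) \<Rightarrow> (nat \<Rightarrow> nat) \<Rightarrow> bool" where
  "maximizer n K A h h' \<longleftrightarrow> balanced_fun n K h' \<and>
     (\<forall>g. balanced_fun n K g \<longrightarrow> (\<Sum>i<n. nbr_count A h i (g i)) \<le> (\<Sum>i<n. nbr_count A h i (h' i)))"

lemma proj_tensor_apply:
  assumes A: "adjacency_tensor n d A"
  shows "H \<in> proj n K (tensor_apply d A (assign_mat n K h)) \<longleftrightarrow>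
    (\<exists>h'. maximizer n K A h h' \<and> H = assign_mat n K h')"
proof -
  let ?S = "\<lambda>g. \<Sum>i<n. tensor_apply d A (assign_mat n K h) $$ (i, g i)"
  have eq: "?S g = real (\<Sum>i<n. nbr_count A h i (g i))" if "balanced_fun n K g" for g
    unfolding of_nat_sum using that
    by (intro sum.cong refl tensor_apply_assign_mat[OF A]) (auto simp: balanced_fun_def)
  have "(\<forall>g. balanced_fun n K g \<longrightarrow> ?S g \<le> ?S h') \<longleftrightarrow>
    (\<forall>g. balanced_fun n K g \<longrightarrow> (\<Sum>i<n. nbr_count A h i (g i)) \<le> (\<Sum>i<n. nbr_count A h i (h' i)))"
    if "balanced_fun n K h'" for h'
    using eq that of_nat_le_iff by (metis (no_types, lifting))
  then show ?thesis
    unfolding proj_iff[OF tensor_apply_carrier[OF assign_mat_carrier(1)]] maximizer_def by blast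
qed

text \<open>The bound M for the degrees enters only the time, and every tensor has some such bound.\<close>

lemma exec_ptpm_prog:
  assumes K: "2 \<le> K" and d: "2 \<le> d" and n: "0 < n" "K dvd n"
    and A: "adjacency_tensor n d A" and es: "lists_nonzeros A es" and H0: "H0 \<in> assignments n K"
    and M: "1 \<le> M" "\<And>i. i < n \<Longrightarrow> ordered_degree A i \<le> M"
  shows "\<exists>T s. exec (ptpm_prog K d) (ptpm_input n d K N es H0) T s \<and>
    ptpm_result n K s \<in> ptpm_outputs n d K A N H0 \<and>
    T \<le> (N + 1) * (n + 1) * ((K + 1) * M + 1) * ptpm_const K d"
proof -
  obtain h0 where h0: "\<forall>i<n. h0 i < K" "H0 = assign_mat n K h0" using H0 assignments_iff by blast
  let ?s = "ptpm_input n d K N es H0"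
  let ?H0 = "\<lambda>i k. if h0 i = k then 1 else 0 :: int"
  have idx: "i * K + k < n * K" if "i < n" "k < K" for i k
    using that by (metis add.commute mult_Suc Suc_leI add_strict_mono le_add1 less_le_trans mult_le_mono1 nat_add_left_cancel_less)
  have es_ok: "length e = d \<and> set e \<subseteq> {..<n}" if "e \<in> set es" for e
    using that es adjacency_tensorD[OF A] by (auto simp: lists_nonzeros_def)
  have "runs (ptpm_prog K d) ?s ((N + 1) * (n + 1) * ((K + 1) * M + 1) * ptpm_const K d)
    (\<lambda>s'. \<exists>hs. optimal n K ?H0 (hs 0) \<and> (\<forall>t<N. optimal n K (power_costs K es (hs t)) (hs (Suc t))) \<and>
       (\<forall>i<n. \<forall>k<K. s' 3 (int K * int i + int k) = (if hs N i = k then 1 else 0)))"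
  proof (rule runs_ptpm_prog[OF _ n d es_ok])
    show "?s 0 0 = int n" "?s 0 1 = int N" "?s 0 2 = int (length es)" "\<And>x. ?s 3 x = 0"
      by (simp_all add: ptpm_input_def nth_Cons' eval_nat_numeral)
    show "holds_entries d es ?s"
      unfolding holds_entries_def
    proof (intro allI impI)
      fix x j assume xj: "x < length es" "j < d"
      have eq: "int d * int x + int j = int (x * d + j)" by (simp add: algebra_simps)
      have "x * d + j < length es * d"
        using xj by (metis add.commute mult_Suc Suc_leI add_strict_mono le_add1 less_le_trans mult_le_mono1 nat_add_left_cancel_less)
      moreover have "(x * d + j) div d = x" "(x * d + j) mod d = j" using xj by simp_all
      ultimately show "?s 2 (int d * int x + int j) = int (es ! x ! j)"
        unfolding eq ptpm_input_def by (simp del: of_nat_add of_nat_mult)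
    qed
  next
    fix i k assume ik: "i < n" "k < K"
    have eq: "int K * int i + int k = int (i * K + k)" by (simp add: algebra_simps)
    have "(i * K + k) div K = i" "(i * K + k) mod K = k" using ik by simp_all
    then show "?s 1 (int K * int i + int k) = ?H0 i k \<and> 0 \<le> ?H0 i k \<and> ?H0 i k \<le> 1"
      unfolding eq ptpm_input_def using idx[OF ik] ik h0 by (simp del: of_nat_add of_nat_mult)
  next
    fix i k and h :: "nat \<Rightarrow> nat" assume "i < n"
    then show "entry_count es (length es) h i k \<le> M"
      unfolding entry_count_eq_nbr_count[OF A d es]
      using nbr_count_le_degree[OF A] M(2) order_trans by blast
  qed (use K M length_nonzeros_le[OF A d es] in auto)
  then obtain T s hs where T: "exec (ptpm_prog K d) ?s T s"
      "T \<le> (N + 1) * (n + 1) * ((K + 1) * M + 1) * ptpm_const K d"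
    and hs: "optimal n K ?H0 (hs 0)" "\<And>t. t < N \<Longrightarrow> optimal n K (power_costs K es (hs t)) (hs (Suc t))"
    and out: "\<And>i k. i < n \<Longrightarrow> k < K \<Longrightarrow> s 3 (int K * int i + int k) = (if hs N i = k then 1 else 0)"
    unfolding runs_def by blast
  have res: "ptpm_result n K s = assign_mat n K (hs N)"
  proof (rule eq_matI)
    fix i k assume "i < dim_row (assign_mat n K (hs N))" "k < dim_col (assign_mat n K (hs N))"
    then have ik: "i < n" "k < K" by auto
    have eq: "int (i * K + k) = int K * int i + int k" by (simp add: algebra_simps)
    show "ptpm_result n K s $$ (i, k) = assign_mat n K (hs N) $$ (i, k)"
      using ik out[OF ik] by (simp add: ptpm_result_def eq del: of_nat_add of_nat_mult)
  qed (auto simp: ptpm_result_def)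
  define H where "H t = assign_mat n K (hs (t - 1))" for t
  have "H 1 \<in> proj n K H0"
  proof -
    have "(\<Sum>i<n. H0 $$ (i, g i)) = real_of_int (\<Sum>i<n. ?H0 i (g i))" if "balanced_fun n K g" for g
      unfolding of_int_sum using that h0 by (intro sum.cong) (auto simp: balanced_fun_def)
    then show ?thesis
      using hs(1) h0(2) unfolding H_def optimal_def
      by (subst proj_assign_mat) (auto simp del: of_int_sum)
  qed
  moreover have "H (t + 1) \<in> proj n K (tensor_apply d A (H t))" if t: "t \<in> {1..N}" for t
  proof -
    obtain t' where t': "t = Suc t'" "t' < N" using t by (cases t) auto
    have opt: "optimal n K (power_costs K es (hs t')) (hs (Suc t'))" using hs(2) t' by blast
    have "maximizer n K A (hs t') (hs (Suc t'))"
      unfolding maximizer_def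
    proof (intro conjI allI impI)
      show "balanced_fun n K (hs (Suc t'))" using opt by (simp add: optimal_def)
      fix g assume "balanced_fun n K g"
      then have "(\<Sum>i<n. power_costs K es (hs t') i (g i)) \<le> (\<Sum>i<n. power_costs K es (hs t') i (hs (Suc t') i))"
        using opt by (simp add: optimal_def)
      then have "int ((K + 1) * (\<Sum>i<n. nbr_count A (hs t') i (g i))) \<le>
          int ((K + 1) * (\<Sum>i<n. nbr_count A (hs t') i (hs (Suc t') i)))"
        unfolding power_costs_def entry_count_eq_nbr_count[OF A d es] sum_distrib_left of_nat_sum .
      then have "(K + 1) * (\<Sum>i<n. nbr_count A (hs t') i (g i)) \<le> (K + 1) * (\<Sum>i<n. nbr_count A (hs t') i (hs (Suc t') i))"
        unfolding of_nat_le_iff .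
      then show "(\<Sum>i<n. nbr_count A (hs t') i (g i)) \<le> (\<Sum>i<n. nbr_count A (hs t') i (hs (Suc t') i))"
        by (subst (asm) mult_le_cancel1) simp
    qed
    then show ?thesis using proj_tensor_apply[OF A] t' by (auto simp: H_def)
  qed
  ultimately have "H (N + 1) \<in> ptpm_outputs n d K A N H0" unfolding ptpm_outputs_def by blast
  then have "ptpm_result n K s \<in> ptpm_outputs n d K A N H0" by (simp add: H_def res)
  then show ?thesis using T by blast
qed

lemma ptpm_prog_implements_ptpm:
  assumes "2 \<le> K" "2 \<le> d"
  shows "implements_ptpm d K (ptpm_prog K d)"
  unfolding implements_ptpm_def
proof (intro allI impI)
  fix n N :: nat and A :: tensor and es H0
  assume *: "0 < n" "K dvd n" "0 < N" "adjacency_tensor n d A" "lists_nonzeros A es" "H0 \<in> assignments n K"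
  define M where "M = 1 + (\<Sum>i<n. ordered_degree A i)"
  have "ordered_degree A i \<le> M" if "i < n" for i
    using that member_le_sum[of i "{..<n}" "ordered_degree A"] by (simp add: M_def)
  then show "\<exists>T s. exec (ptpm_prog K d) (ptpm_input n d K N es H0) T s \<and>
      ptpm_result n K s \<in> ptpm_outputs n d K A N H0"
    using exec_ptpm_prog[OF assms *(1,2,4,5,6), of M N] by (auto simp: M_def)
qed

section \<open>Contraction towards the planted partition\<close>

definition errors :: "nat \<Rightarrow> (nat \<Rightarrow> nat) \<Rightarrow> (nat \<Rightarrow> nat) \<Rightarrow> nat set" where
  "errors n h g = {i. i < n \<and> h i \<noteq> g i}"

text \<open>The tuples through i whose contribution can change when only the nodes of S are reassigned.\<close>

definition touch_count :: "tensor \<Rightarrow> nat set \<Rightarrow> nat \<Rightarrow> nat" where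
  "touch_count A S i = card {js. A (i # js) \<noteq> 0 \<and> set js \<inter> S \<noteq> {}}"

lemma finite_errors [simp]: "finite (errors n h g)"
  by (simp add: errors_def)

lemma errors_subset: "errors n h g \<subseteq> {..<n}"
  by (auto simp: errors_def)

lemma nbr_count_le_touch:
  assumes A: "adjacency_tensor n d A" and S: "errors n h g \<subseteq> S"
  shows "nbr_count A h i k \<le> nbr_count A g i k + touch_count A S i"
proof -
  have fin: "finite {js. A (i # js) \<noteq> 0 \<and> P js}" for P
    by (rule finite_subset[OF _ finite_nbrs[OF A]]) auto
  have "{js. A (i # js) \<noteq> 0 \<and> (\<forall>j\<in>set js. h j = k)} \<subseteq>
     {js. A (i # js) \<noteq> 0 \<and> (\<forall>j\<in>set js. g j = k)} \<union> {js. A (i # js) \<noteq> 0 \<and> set js \<inter> S \<noteq> {}}"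
  proof
    fix js assume js: "js \<in> {js. A (i # js) \<noteq> 0 \<and> (\<forall>j\<in>set js. h j = k)}"
    have "set js \<subseteq> {..<n}" using adjacency_tensorD(4)[OF A, of "i # js"] js by auto
    then have "g j = k" if "set js \<inter> S = {}" "j \<in> set js" for j
      using S js that by (fastforce simp: errors_def)
    then show "js \<in> {js. A (i # js) \<noteq> 0 \<and> (\<forall>j\<in>set js. g j = k)} \<union> {js. A (i # js) \<noteq> 0 \<and> set js \<inter> S \<noteq> {}}"
      using js by blast
  qed
  then have "card {js. A (i # js) \<noteq> 0 \<and> (\<forall>j\<in>set js. h j = k)} \<le>
     card ({js. A (i # js) \<noteq> 0 \<and> (\<forall>j\<in>set js. g j = k)} \<union> {js. A (i # js) \<noteq> 0 \<and> set js \<inter> S \<noteq> {}})"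
    by (intro card_mono finite_UnI fin)
  also have "\<dots> \<le> nbr_count A g i k + touch_count A S i"
    unfolding nbr_count_def touch_count_def by (rule card_Un_le)
  finally show ?thesis unfolding nbr_count_def[of A h] .
qed

definition has_gap :: "nat \<Rightarrow> nat \<Rightarrow> tensor \<Rightarrow> (nat \<Rightarrow> nat) \<Rightarrow> real \<Rightarrow> bool" where
  "has_gap n K A g \<Delta> \<longleftrightarrow>
     (\<forall>i<n. \<forall>k<K. k \<noteq> g i \<longrightarrow> real (nbr_count A g i k) + \<Delta> \<le> real (nbr_count A g i (g i)))"

text \<open>The new iterate beats g with respect to the perturbed scores. On each wrong node the true
scores lose the gap, and the two scores involved are each perturbed by at most the tuples that
meet the old errors.\<close>

lemma maximizer_errors:
  assumes A: "adjacency_tensor n d A" and g: "balanced_fun n K g" and gap: "has_gap n K A g \<Delta>"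
    and h': "maximizer n K A h h'"
  shows "\<Delta> * card (errors n h' g) \<le> 2 * (\<Sum>i\<in>errors n h' g. real (touch_count A (errors n h g) i))"
proof -
  let ?S = "errors n h g" and ?S' = "errors n h' g"
  let ?c = "\<lambda>i k. real (nbr_count A h i k)" and ?d = "\<lambda>i k. real (nbr_count A g i k)"
  let ?t = "\<lambda>i. real (touch_count A ?S i)"
  have "(\<Sum>i<n. nbr_count A h i (g i)) \<le> (\<Sum>i<n. nbr_count A h i (h' i))"
    using h' g by (simp add: maximizer_def)
  then have "(\<Sum>i<n. ?c i (g i)) \<le> (\<Sum>i<n. ?c i (h' i))" by (metis of_nat_le_iff of_nat_sum)
  moreover have "(\<Sum>i<n. f i) = (\<Sum>i\<in>?S'. f i) + (\<Sum>i\<in>{..<n} - ?S'. f i)" for f :: "nat \<Rightarrow> real"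
    using errors_subset[of n h' g] by (simp add: sum.subset_diff[of ?S' "{..<n}"])
  moreover have "(\<Sum>i\<in>{..<n} - ?S'. ?c i (g i)) = (\<Sum>i\<in>{..<n} - ?S'. ?c i (h' i))"
    by (intro sum.cong) (auto simp: errors_def)
  ultimately have le: "(\<Sum>i\<in>?S'. ?c i (g i)) \<le> (\<Sum>i\<in>?S'. ?c i (h' i))" by (metis add_le_cancel_right)
  have "(\<Sum>i\<in>?S'. \<Delta> - 2 * ?t i) \<le> (\<Sum>i\<in>?S'. ?c i (g i) - ?c i (h' i))"
  proof (rule sum_mono)
    fix i assume i: "i \<in> ?S'"
    have "h' i < K" "h' i \<noteq> g i" "i < n" using i h' by (auto simp: errors_def maximizer_def balanced_fun_def)
    then have "?d i (h' i) + \<Delta> \<le> ?d i (g i)" using gap by (simp add: has_gap_def)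
    moreover have "?d i (g i) \<le> ?c i (g i) + ?t i"
      using nbr_count_le_touch[OF A, of g h ?S i "g i"] by (simp add: errors_def eq_commute)
    moreover have "?c i (h' i) \<le> ?d i (h' i) + ?t i"
      using nbr_count_le_touch[OF A, of h g ?S i "h' i"] by simp
    ultimately show "\<Delta> - 2 * ?t i \<le> ?c i (g i) - ?c i (h' i)" by linarith
  qed
  then have "(\<Sum>i\<in>?S'. \<Delta> - 2 * ?t i) \<le> 0" using le by (simp add: sum_subtractf)
  then show ?thesis by (simp add: sum_subtractf sum_distrib_left mult.commute)
qed

text \<open>Sets S of at most s nodes do not meet enough tuples through any set S' with at least |S| / L
nodes to make up for the gap.\<close>

definition expands :: "nat \<Rightarrow> tensor \<Rightarrow> real \<Rightarrow> real \<Rightarrow> real \<Rightarrow> bool" where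
  "expands n A \<Delta> s L \<longleftrightarrow> (\<forall>S S'. S \<subseteq> {..<n} \<longrightarrow> S' \<subseteq> {..<n} \<longrightarrow> S \<noteq> {} \<longrightarrow> S' \<noteq> {} \<longrightarrow>
     real (card S) \<le> s \<longrightarrow> real (card S) \<le> L * card S' \<longrightarrow>
     2 * (\<Sum>i\<in>S'. real (touch_count A S i)) < \<Delta> * card S')"

text \<open>Otherwise the old and new errors would be a pair of sets excluded by the expansion property,
unless there are no old errors; then no score is perturbed and the gap alone excludes new
errors.\<close>

lemma maximizer_contracts:
  assumes A: "adjacency_tensor n d A" and g: "balanced_fun n K g" and gap: "has_gap n K A g \<Delta>"
    and ex: "expands n A \<Delta> s L" and pos: "0 < \<Delta>"
    and h: "real (card (errors n h g)) \<le> s" and h': "maximizer n K A h h'"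
  shows "L * card (errors n h' g) \<le> card (errors n h g)"
proof (rule ccontr)
  assume neg: "\<not> ?thesis"
  let ?S = "errors n h g" and ?S' = "errors n h' g"
  note err = maximizer_errors[OF A g gap h']
  have S': "?S' \<noteq> {}" using neg by auto
  show False
  proof (cases "?S = {}")
    case True
    then have "touch_count A ?S i = 0" for i by (simp add: touch_count_def)
    then have "\<Delta> * card ?S' \<le> 0" using err by simp
    then show False using pos S' by (simp add: mult_le_0_iff card_eq_0_iff)
  next
    case False
    then have "2 * (\<Sum>i\<in>?S'. real (touch_count A ?S i)) < \<Delta> * card ?S'"
      using ex S' h neg errors_subset unfolding expands_def by auto
    then show False using err by linarith
  qed
qed

lemma nbr_count_permute:
  "inj \<pi> \<Longrightarrow> nbr_count A (\<pi> \<circ> g) i (\<pi> k) = nbr_count A g i k"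
  by (simp add: nbr_count_def inj_eq)

text \<open>The iterates may approach any relabelling of the planted partition, so the gap is needed for
all of them; the expansion property does not mention the partition.\<close>

lemma has_gap_permute:
  assumes "has_gap n K A g \<Delta>" "\<pi> permutes {..<K}"
  shows "has_gap n K A (\<pi> \<circ> g) \<Delta>"
  unfolding has_gap_def
proof (intro allI impI)
  fix i k assume i: "i < n" and k: "k < K" "k \<noteq> (\<pi> \<circ> g) i"
  obtain l where l: "k = \<pi> l" "l < K"
    using permutes_image[OF assms(2)] k(1) by (metis imageE lessThan_iff)
  have inj: "inj \<pi>" using assms(2) by (rule permutes_inj)
  have "l \<noteq> g i" using k l by auto
  then show "real (nbr_count A (\<pi> \<circ> g) i k) + \<Delta> \<le> real (nbr_count A (\<pi> \<circ> g) i ((\<pi> \<circ> g) i))"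
    using assms(1) i l nbr_count_permute[OF inj, of A g i] by (simp add: has_gap_def)
qed

lemma balanced_fun_permute:
  assumes g: "balanced_fun n K g" and \<pi>: "\<pi> permutes {..<K}"
  shows "balanced_fun n K (\<pi> \<circ> g)"
proof -
  have inj: "inj \<pi>" using \<pi> by (rule permutes_inj)
  have "card (members n (\<pi> \<circ> g) k) = n div K" if k: "k < K" for k
  proof -
    obtain l where l: "k = \<pi> l" "l < K"
      using permutes_image[OF \<pi>] k(1) by (metis imageE lessThan_iff)
    have "members n (\<pi> \<circ> g) k = members n g l" using inj by (auto simp: members_def l inj_eq)
    then show ?thesis using g l by (simp add: balanced_fun_def)
  qed
  moreover have "(\<pi> \<circ> g) i < K" if "i < n" for i
    using permutes_in_image[OF \<pi>, of "g i"] g that by (simp add: balanced_fun_def)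
  ultimately show ?thesis by (simp add: balanced_fun_def)
qed

lemma assign_mat_times_perm:
  assumes g: "\<forall>i<n. g i < K" and \<pi>: "\<pi> permutes {..<K}"
  shows "assign_mat n K g * mat K K (\<lambda>(i, j). if j = \<pi> i then 1 else 0) = assign_mat n K (\<pi> \<circ> g)"
proof (rule eq_matI)
  fix i k assume "i < dim_row (assign_mat n K (\<pi> \<circ> g))" "k < dim_col (assign_mat n K (\<pi> \<circ> g))"
  then have ik: "i < n" "k < K" by auto
  have "(assign_mat n K g * mat K K (\<lambda>(i, j). if j = \<pi> i then 1 else 0)) $$ (i, k) =
     (\<Sum>l = 0..<K. (if g i = l then 1 else 0) * (if k = \<pi> l then 1 else 0))"
    using ik by (simp add: scalar_prod_def)
  also have "\<dots> = (\<Sum>l = 0..<K. if g i = l then (if k = \<pi> l then 1 else 0) else 0)"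
    by (intro sum.cong) auto
  also have "\<dots> = (if k = \<pi> (g i) then 1 else 0)" using g ik by simp
  finally show "(assign_mat n K g * mat K K (\<lambda>(i, j). if j = \<pi> i then 1 else 0)) $$ (i, k) =
     assign_mat n K (\<pi> \<circ> g) $$ (i, k)" using ik by auto
qed auto

lemma true_partitions_assign_mat:
  assumes "\<forall>i<n. g i < K"
  shows "true_partitions K (assign_mat n K g) = {assign_mat n K (\<pi> \<circ> g) | \<pi>. \<pi> permutes {..<K}}"
  unfolding true_partitions_def perm_mats_def image_image
  using assign_mat_times_perm[OF assms] by (auto simp: image_iff)

lemma sum_agree:
  "(\<Sum>i<n. if h i = g i then 1 else 0 :: real) = real n - real (card (errors n h g))"
proof -
  have "(\<Sum>i<n. if h i = g i then 1 else 0 :: real) = (\<Sum>i<n. 1 - (if h i \<noteq> g i then 1 else 0))"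
    by (intro sum.cong) auto
  also have "\<dots> = real n - real (card (errors n h g))"
    by (simp add: sum_subtractf sum.If_cases errors_def Int_def)
  finally show ?thesis .
qed

lemma frob_norm_assign_mats:
  assumes "\<forall>i<n. h i < K" "\<forall>i<n. g i < K"
  shows "(frob_norm (assign_mat n K h - assign_mat n K g))\<^sup>2 = 2 * real (card (errors n h g))"
proof -
  have "(\<Sum>i<n. \<Sum>k<K. (assign_mat n K g $$ (i, k))\<^sup>2) = (\<Sum>i<n. \<Sum>k<K. if g i = k then 1 else 0)"
    by (intro sum.cong) auto
  also have "\<dots> = real n" using assms by simp
  finally have 1: "(\<Sum>i<n. \<Sum>k<K. (assign_mat n K g $$ (i, k))\<^sup>2) = real n" .
  have "(\<Sum>i<n. assign_mat n K g $$ (i, h i)) = (\<Sum>i<n. if h i = g i then 1 else 0)"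
    using assms by (intro sum.cong) auto
  then show ?thesis
    using frob_norm_assign_mat_diff[OF assign_mat_carrier(1) assms(1), of g] 1 sum_agree[of h g n] by simp
qed

text \<open>The first projection is at least as close to the initial point as g is, so the triangle
inequality costs a factor of two.\<close>

lemma proj_assign_mat_errors:
  assumes h0: "\<forall>i<n. h0 i < K" and g: "balanced_fun n K g"
    and H: "H \<in> proj n K (assign_mat n K h0)"
  shows "\<exists>h. balanced_fun n K h \<and> H = assign_mat n K h \<and> card (errors n h g) \<le> 2 * card (errors n h0 g)"
proof -
  obtain h where h: "balanced_fun n K h" "H = assign_mat n K h"
    "(\<Sum>i<n. assign_mat n K h0 $$ (i, g i)) \<le> (\<Sum>i<n. assign_mat n K h0 $$ (i, h i))"
    using H g unfolding proj_iff[OF assign_mat_carrier(1)] by blast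
  \<comment> \<open>The score of an assignment with respect to the initial matrix counts the nodes on which they agree.\<close>
  have agree: "(\<Sum>i<n. assign_mat n K h0 $$ (i, f i)) = real n - real (card (errors n h0 f))" if "balanced_fun n K f" for f
    unfolding sum_agree[symmetric] using that by (intro sum.cong) (auto simp: balanced_fun_def)
  have "card (errors n h0 h) \<le> card (errors n h0 g)" using h(3) agree h(1) g by simp
  moreover have "card (errors n h g) \<le> card (errors n h0 h \<union> errors n h0 g)"
    by (intro card_mono) (auto simp: errors_def)
  moreover have "card (errors n h0 h \<union> errors n h0 g) \<le> card (errors n h0 h) + card (errors n h0 g)"
    by (rule card_Un_le)
  ultimately show ?thesis using h(1,2) by (intro exI[of _ h]) auto
qed

text \<open>An error count below s / L^N < 1 is zero.\<close>

lemma ptpm_outputs_subset: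
  assumes A: "adjacency_tensor n d A" and g: "balanced_fun n K g" and gap: "has_gap n K A g \<Delta>"
    and ex: "expands n A \<Delta> s L" and pos: "0 < \<Delta>" "1 \<le> L"
    and H0: "H0 \<in> assignments n K"
    and near: "(MIN Q\<in>perm_mats K. frob_norm (H0 - assign_mat n K g * Q)) \<le> r"
    and r: "r\<^sup>2 \<le> s" and N: "s < L ^ N"
  shows "ptpm_outputs n d K A N H0 \<subseteq> true_partitions K (assign_mat n K g)"
proof
  fix Hout assume "Hout \<in> ptpm_outputs n d K A N H0"
  then obtain H where Hout: "Hout = H (N + 1)" and H1: "H 1 \<in> proj n K H0"
    and Ht: "\<And>t. t \<in> {1..N} \<Longrightarrow> H (t + 1) \<in> proj n K (tensor_apply d A (H t))"
    by (auto simp: ptpm_outputs_def)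
  have gK: "\<forall>i<n. g i < K" using g by (simp add: balanced_fun_def)
  obtain h0 where h0: "\<forall>i<n. h0 i < K" "H0 = assign_mat n K h0" using H0 assignments_iff by blast
  have "(MIN Q\<in>perm_mats K. frob_norm (H0 - assign_mat n K g * Q)) \<in>
      (\<lambda>Q. frob_norm (H0 - assign_mat n K g * Q)) ` perm_mats K"
    using finite_perm_mats perm_mats_nonempty by (intro Min_in) auto
  then obtain Q where Q: "Q \<in> perm_mats K" "frob_norm (H0 - assign_mat n K g * Q) \<le> r"
    using near by auto
  then obtain \<pi> where \<pi>: "\<pi> permutes {..<K}" "Q = mat K K (\<lambda>(i, j). if j = \<pi> i then 1 else 0)"
    by (auto simp: perm_mats_def)
  define g' where "g' = \<pi> \<circ> g"
  have g': "balanced_fun n K g'" unfolding g'_def using balanced_fun_permute[OF g \<pi>(1)] .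
  have gap': "has_gap n K A g' \<Delta>" unfolding g'_def using has_gap_permute[OF gap \<pi>(1)] .
  have "frob_norm (assign_mat n K h0 - assign_mat n K g') \<le> r"
    using Q(2) assign_mat_times_perm[OF gK \<pi>(1)] \<pi>(2) h0(2) by (simp add: g'_def)
  then have "(frob_norm (assign_mat n K h0 - assign_mat n K g'))\<^sup>2 \<le> r\<^sup>2"
    by (rule power_mono) (rule frob_norm_nonneg)
  then have err0: "2 * real (card (errors n h0 g')) \<le> s"
    using frob_norm_assign_mats[OF h0(1), of g'] g' r by (simp add: balanced_fun_def)
  have "\<exists>h. balanced_fun n K h \<and> H (t + 1) = assign_mat n K h \<and> real (card (errors n h g')) * L ^ t \<le> s"
    if "t \<le> N" for t
    using that
  proof (induction t)
    case 0
    obtain h where h: "balanced_fun n K h" "H 1 = assign_mat n K h"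
      "card (errors n h g') \<le> 2 * card (errors n h0 g')"
      using proj_assign_mat_errors[OF h0(1) g', of "H 1"] H1 h0(2) by auto
    then have "real (card (errors n h g')) \<le> s" using err0 by linarith
    then show ?case using h by auto
  next
    case (Suc t)
    then obtain h where h: "balanced_fun n K h" "H (t + 1) = assign_mat n K h"
      "real (card (errors n h g')) * L ^ t \<le> s" by auto
    have "H (t + 1 + 1) \<in> proj n K (tensor_apply d A (assign_mat n K h))"
      using Ht[of "t + 1"] Suc.prems h(2) by simp
    then obtain h' where h': "maximizer n K A h h'" "H (t + 1 + 1) = assign_mat n K h'"
      using proj_tensor_apply[OF A] by blast
    have "real (card (errors n h g')) * 1 \<le> real (card (errors n h g')) * L ^ t"
      using pos by (intro mult_left_mono) auto
    then have "real (card (errors n h g')) \<le> s" using h(3) by linarith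
    then have "L * card (errors n h' g') \<le> card (errors n h g')"
      by (rule maximizer_contracts[OF A g' gap' ex pos(1) _ h'(1)])
    then have "L * card (errors n h' g') * L ^ t \<le> card (errors n h g') * L ^ t"
      using pos by (intro mult_right_mono) auto
    then have "real (card (errors n h' g')) * L ^ Suc t \<le> s" using h(3) by (simp add: mult_ac)
    then show ?case using h' by (auto simp: maximizer_def)
  qed
  then obtain h where h: "balanced_fun n K h" "Hout = assign_mat n K h" "real (card (errors n h g')) * L ^ N \<le> s"
    using Hout by blast
  have "card (errors n h g') = 0"
  proof (rule ccontr)
    assume "card (errors n h g') \<noteq> 0"
    then have "1 \<le> real (card (errors n h g'))" by linarith
    then have "1 * L ^ N \<le> real (card (errors n h g')) * L ^ N"
      using pos by (intro mult_right_mono) auto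
    then show False using h(3) N by linarith
  qed
  then have "Hout = assign_mat n K g'"
    unfolding h(2) by (intro assign_mat_cong) (auto simp: errors_def)
  then show "Hout \<in> true_partitions K (assign_mat n K g)"
    unfolding true_partitions_assign_mat[OF gK] g'_def using \<pi>(1) by blast
qed

section \<open>Counting and concentration of hyperedges\<close>

definition tensor_of :: "nat \<Rightarrow> nat \<Rightarrow> (nat list \<Rightarrow> bool) \<Rightarrow> tensor" where
  "tensor_of n d X is = (if length is = d \<and> distinct is \<and> set is \<subseteq> {..<n} then of_bool (X (sort is)) else 0)"

lemma hsbm_eq: "hsbm n d p q Hs = map_pmf (tensor_of n d) (Pi_pmf (increasing_tuples n d) False
    (\<lambda>is. bernoulli_pmf (if same_community Hs is then p else q)))"
  unfolding hsbm_def tensor_of_def[abs_def] ..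

lemma adjacency_tensor_of: "adjacency_tensor n d (tensor_of n d X)"
  unfolding adjacency_tensor_def
proof (intro conjI allI impI)
  fix "is" js :: "nat list" assume m: "mset is = mset js"
  have "sort is = sort js" using m by (metis sorted_list_of_multiset_mset)
  moreover have "length is = length js" "distinct is = distinct js" "set is = set js"
    using m by (auto dest: mset_eq_length mset_eq_setD mset_eq_imp_distinct_iff)
  ultimately show "tensor_of n d X is = tensor_of n d X js" by (simp add: tensor_of_def)
qed (auto simp: tensor_of_def split: if_splits)

lemma increasing_tuplesD:
  assumes "e \<in> increasing_tuples n d"
  shows "length e = d" "sorted e" "distinct e" "set e \<subseteq> {..<n}" "card (set e) = d"
  using assms by (auto simp: increasing_tuples_def strict_sorted_iff distinct_card)

lemma finite_increasing_tuples [simp]: "finite (increasing_tuples n d)"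
  by (rule finite_subset[OF _ finite_tuples[of d n]]) (auto simp: increasing_tuples_def)

lemma increasing_tuples_eqI:
  "e \<in> increasing_tuples n d \<Longrightarrow> e' \<in> increasing_tuples n d \<Longrightarrow> set e = set e' \<Longrightarrow> e = e'"
  by (meson increasing_tuplesD sorted_distinct_set_unique)

lemma sort_increasing_tuple:
  assumes "distinct js" "length js = d" "set js \<subseteq> {..<n}"
  shows "sort js \<in> increasing_tuples n d"
  using assms by (auto simp: increasing_tuples_def strict_sorted_iff)

text \<open>The tensor lists each hyperedge through i with all orders of its other d - 1 nodes.\<close>

lemma card_nonzero_tuples:
  assumes i: "i < n" and d: "1 \<le> d"
  shows "card {js. tensor_of n d X (i # js) \<noteq> 0 \<and> P (set js)} =
    fact (d - 1) * card {e \<in> increasing_tuples n d. X e \<and> i \<in> set e \<and> P (set e - {i})}"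
proof -
  let ?F = "{e \<in> increasing_tuples n d. X e \<and> i \<in> set e \<and> P (set e - {i})}"
  have "{js. tensor_of n d X (i # js) \<noteq> 0 \<and> P (set js)} = (\<Union>e\<in>?F. permutations_of_set (set e - {i}))"
  proof (intro equalityI subsetI)
    fix js assume "js \<in> {js. tensor_of n d X (i # js) \<noteq> 0 \<and> P (set js)}"
    then have js: "length (i # js) = d" "distinct (i # js)" "set (i # js) \<subseteq> {..<n}" "X (sort (i # js))" "P (set js)"
      by (auto simp: tensor_of_def split: if_splits)
    let ?e = "sort (i # js)"
    have "?e \<in> increasing_tuples n d" using sort_increasing_tuple[OF js(2,1,3)] .
    moreover have "set ?e - {i} = set js" using js(2) by (simp only: set_sort) auto
    ultimately have "?e \<in> ?F" using js by (simp only: mem_Collect_eq set_sort) auto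
    moreover have "js \<in> permutations_of_set (set ?e - {i})"
      using js(2) \<open>set ?e - {i} = set js\<close> by (intro permutations_of_setI) auto
    ultimately show "js \<in> (\<Union>e\<in>?F. permutations_of_set (set e - {i}))" by blast
  next
    fix js assume "js \<in> (\<Union>e\<in>?F. permutations_of_set (set e - {i}))"
    then obtain e where e: "e \<in> increasing_tuples n d" "X e" "i \<in> set e" "P (set e - {i})"
      and js: "set js = set e - {i}" "distinct js" by (auto simp: permutations_of_set_def)
    have dist: "distinct (i # js)" using js by auto
    have set: "set (i # js) = set e" using js e by auto
    have len: "length (i # js) = d"
      using distinct_card[OF dist] set increasing_tuplesD(5)[OF e(1)] by simp
    have sub: "set (i # js) \<subseteq> {..<n}" using set increasing_tuplesD(4)[OF e(1)] by simp
    have "sort (i # js) = e"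
    proof (rule increasing_tuples_eqI[OF sort_increasing_tuple[OF dist len sub] e(1)])
      show "set (sort (i # js)) = set e" using set by (simp only: set_sort)
    qed
    then have "tensor_of n d X (i # js) = 1"
      unfolding tensor_of_def using dist len sub e(2) by (simp only: if_True simp_thms of_bool_eq)
    then show "js \<in> {js. tensor_of n d X (i # js) \<noteq> 0 \<and> P (set js)}" using e(4) js by simp
  qed
  also have "card \<dots> = (\<Sum>e\<in>?F. card (permutations_of_set (set e - {i})))"
  proof (rule card_UN_disjoint)
    show "\<forall>e\<in>?F. \<forall>e'\<in>?F. e \<noteq> e' \<longrightarrow>
      permutations_of_set (set e - {i}) \<inter> permutations_of_set (set e' - {i}) = {}"
    proof (intro ballI impI)
      fix e e' assume e: "e \<in> ?F" "e' \<in> ?F" "e \<noteq> e'"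
      then have "set e \<noteq> set e'" using increasing_tuples_eqI by blast
      then have "set e - {i} \<noteq> set e' - {i}" using e by blast
      then show "permutations_of_set (set e - {i}) \<inter> permutations_of_set (set e' - {i}) = {}"
        by (auto simp: permutations_of_set_def)
    qed
  qed auto
  also have "\<dots> = (\<Sum>e\<in>?F. fact (d - 1))"
    by (intro sum.cong) (auto simp: increasing_tuplesD card_Diff_singleton)
  finally show ?thesis by simp
qed

text \<open>An edge is determined by the list of its nodes outside U.\<close>

lemma card_edges_containing:
  assumes U: "finite U" "card U \<le> d"
  shows "card {e \<in> increasing_tuples n d. U \<subseteq> set e} \<le> n ^ (d - card U)"
proof -
  let ?F = "{e \<in> increasing_tuples n d. U \<subseteq> set e}"
  let ?f = "filter (\<lambda>x. x \<notin> U)"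
  let ?L = "{xs. set xs \<subseteq> {..<n} \<and> length xs = d - card U}"
  have "inj_on ?f ?F"
  proof (rule inj_onI)
    fix e e' assume e: "e \<in> ?F" "e' \<in> ?F" "?f e = ?f e'"
    have "set e = set (?f e) \<union> U" using e(1) by auto
    also have "\<dots> = set (?f e') \<union> U" by (simp only: e(3))
    also have "\<dots> = set e'" using e(2) by auto
    finally have "set e = set e'" .
    then show "e = e'" using e increasing_tuples_eqI by blast
  qed
  moreover have "?f ` ?F \<subseteq> ?L"
  proof
    fix xs assume "xs \<in> ?f ` ?F"
    then obtain e where e: "e \<in> increasing_tuples n d" "U \<subseteq> set e" "xs = ?f e" by blast
    have "distinct xs" using e(3) increasing_tuplesD(3)[OF e(1)] by simp
    then have "length xs = card (set xs)" by (rule distinct_card[symmetric])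
    also have "set xs = set e - U" using e by auto
    also have "card \<dots> = d - card U" using e U increasing_tuplesD(5)[OF e(1)] by (simp add: card_Diff_subset)
    finally show "xs \<in> ?L" using e increasing_tuplesD(4)[OF e(1)] by auto
  qed
  ultimately have "card ?F \<le> card ?L"
    by (rule card_inj_on_le) (simp add: finite_lists_length_eq)
  then show ?thesis using card_lists_length_eq[of "{..<n}" "d - card U"] by simp
qed

lemma card_edges_through:
  assumes i: "i < n" and B: "B \<subseteq> {..<n}" "i \<notin> B" and d: "1 \<le> d"
  shows "card {e \<in> increasing_tuples n d. i \<in> set e \<and> set e - {i} \<subseteq> B} = card B choose (d - 1)"
proof -
  let ?F = "{e \<in> increasing_tuples n d. i \<in> set e \<and> set e - {i} \<subseteq> B}"
  let ?T = "{T. T \<subseteq> B \<and> card T = d - 1}"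
  have fin: "finite B" using B finite_subset by blast
  have "bij_betw (\<lambda>e. set e - {i}) ?F ?T"
  proof (rule bij_betwI')
    fix e e' assume e: "e \<in> ?F" "e' \<in> ?F"
    show "(set e - {i} = set e' - {i}) = (e = e')"
    proof
      assume "set e - {i} = set e' - {i}"
      moreover have "set e = insert i (set e - {i})" "set e' = insert i (set e' - {i})" using e by auto
      ultimately have "set e = set e'" by metis
      then show "e = e'" using e increasing_tuples_eqI by blast
    qed simp
  next
    fix e assume "e \<in> ?F"
    then show "set e - {i} \<in> ?T" by (auto simp: increasing_tuplesD card_Diff_singleton)
  next
    fix T assume T: "T \<in> ?T"
    then have finT: "finite T" "i \<notin> T" using fin B finite_subset by auto
    let ?e = "sorted_list_of_set (insert i T)"
    have set: "set ?e = insert i T" using finT by (metis finite_insert set_sorted_list_of_set)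
    have "length ?e = card (insert i T)" by simp
    also have "\<dots> = d" using finT T d by simp
    finally have "length ?e = d" .
    then have "?e \<in> increasing_tuples n d"
      using set T B i by (auto simp: increasing_tuples_def simp del: sorted_list_of_set_insert_remove)
    then have "?e \<in> ?F" using set T by auto
    moreover have "T = set ?e - {i}" using set finT by auto
    ultimately show "\<exists>e\<in>?F. T = set e - {i}" by blast
  qed
  then have "card ?F = card ?T" by (rule bij_betw_same_card)
  then show ?thesis using n_subsets[OF fin] by simp
qed

text \<open>Markov's inequality for the exponential of the weighted sum. Positive and negative weights are
both needed: the gap compares two counts.\<close>

lemma bernoulli_chernoff:
  fixes r w :: "'a \<Rightarrow> real"
  assumes I: "finite I" and r: "\<And>x. x \<in> I \<Longrightarrow> 0 \<le> r x \<and> r x \<le> 1"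
  shows "measure_pmf.prob (Pi_pmf I False (\<lambda>x. bernoulli_pmf (r x)))
      {X. t \<le> (\<Sum>x\<in>I. w x * of_bool (X x))} \<le> exp (- t + (\<Sum>x\<in>I. r x * (exp (w x) - 1)))"
proof -
  let ?P = "Pi_pmf I False (\<lambda>x. bernoulli_pmf (r x))"
  let ?S = "\<lambda>X. \<Sum>x\<in>I. w x * of_bool (X x)"
  have "set_pmf ?P \<subseteq> PiE_dflt I False (\<lambda>_. UNIV)"
    by (rule order_trans[OF set_Pi_pmf_subset'[OF I]]) (auto simp: PiE_dflt_def)
  then have fin: "finite (set_pmf ?P)"
    by (rule finite_subset) (intro finite_PiE_dflt I, simp)
  have le: "(\<Prod>x\<in>I. 1 + r x * (exp (w x) - 1)) \<le> (\<Prod>x\<in>I. exp (r x * (exp (w x) - 1)))"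
  proof (rule prod_mono)
    fix x assume x: "x \<in> I"
    have "r x * (1 - exp (w x)) \<le> 1 * 1"
    proof (cases "exp (w x) \<le> 1")
      case True
      then show ?thesis using r[OF x] by (intro mult_mono) auto
    next
      case False
      then have "r x * (1 - exp (w x)) \<le> 0" using r[OF x] by (intro mult_nonneg_nonpos) auto
      then show ?thesis by simp
    qed
    then have "0 \<le> 1 + r x * (exp (w x) - 1)" by (simp add: algebra_simps)
    then show "0 \<le> 1 + r x * (exp (w x) - 1) \<and> 1 + r x * (exp (w x) - 1) \<le> exp (r x * (exp (w x) - 1))"
      using exp_ge_add_one_self by blast
  qed
  have "measure_pmf.prob ?P {X. t \<le> ?S X} = measure_pmf.expectation ?P (indicator {X. t \<le> ?S X})"
    by simp
  also have "\<dots> \<le> measure_pmf.expectation ?P (\<lambda>X. exp (- t) * exp (?S X))"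
  proof (rule integral_mono)
    fix X show "indicator {X. t \<le> ?S X} X \<le> exp (- t) * exp (?S X)"
      by (auto simp: indicator_def mult_exp_exp)
  qed (use fin in \<open>auto intro: integrable_measure_pmf_finite\<close>)
  also have "\<dots> = exp (- t) * measure_pmf.expectation ?P (\<lambda>X. \<Prod>x\<in>I. exp (w x * of_bool (X x)))"
    by (subst exp_sum[OF I]) simp
  also have "measure_pmf.expectation ?P (\<lambda>X. \<Prod>x\<in>I. exp (w x * of_bool (X x))) =
     (\<Prod>x\<in>I. measure_pmf.expectation (bernoulli_pmf (r x)) (\<lambda>b. exp (w x * of_bool b)))"
    by (rule expectation_prod_Pi_pmf[where f = "\<lambda>x b. exp (w x * of_bool b)", OF I])
       (auto intro: integrable_measure_pmf_finite)
  also have "\<dots> = (\<Prod>x\<in>I. 1 + r x * (exp (w x) - 1))"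
    using r by (intro prod.cong) (auto simp: algebra_simps)
  also have "exp (- t) * \<dots> \<le> exp (- t) * (\<Prod>x\<in>I. exp (r x * (exp (w x) - 1)))"
    using le by (rule mult_left_mono) simp
  also have "(\<Prod>x\<in>I. exp (r x * (exp (w x) - 1))) = exp (\<Sum>x\<in>I. r x * (exp (w x) - 1))"
    by (rule exp_sum[OF I, symmetric])
  finally show ?thesis by (simp only: mult_exp_exp)
qed

lemma prob_many_present:
  fixes r :: "'a \<Rightarrow> real" and l t c p :: real
  assumes I: "finite I" and r: "\<And>x. x \<in> I \<Longrightarrow> 0 \<le> r x \<and> r x \<le> p" and p: "0 \<le> p" "p \<le> 1" and F: "F \<subseteq> I"
    and c: "real (card F) \<le> c" and lam: "0 \<le> l"
  shows "measure_pmf.prob (Pi_pmf I False (\<lambda>x. bernoulli_pmf (r x)))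
      {X. t \<le> real (card {x \<in> F. X x})} \<le> exp (- l * t + c * p * exp l)"
proof -
  let ?P = "Pi_pmf I False (\<lambda>x. bernoulli_pmf (r x))"
  let ?w = "\<lambda>x. if x \<in> F then l else 0"
  have fin: "finite F" using I F finite_subset by blast
  have sum: "(\<Sum>x\<in>I. (if x \<in> F then f x else 0)) = (\<Sum>x\<in>F. f x)" for f :: "'a \<Rightarrow> real"
    using F I by (simp add: sum.If_cases Int_absorb1)
  have "(\<Sum>x\<in>I. ?w x * of_bool (X x)) = l * real (card {x \<in> F. X x})" for X
  proof -
    have "(\<Sum>x\<in>I. ?w x * of_bool (X x)) = (\<Sum>x\<in>I. if x \<in> F then l * of_bool (X x) else 0)"
      by (intro sum.cong) auto
    also have "\<dots> = (\<Sum>x\<in>F. l * of_bool (X x))" by (rule sum)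
    also have "\<dots> = l * (\<Sum>x\<in>F. of_bool (X x))" by (rule sum_distrib_left[symmetric])
    also have "(\<Sum>x\<in>F. of_bool (X x)) = real (card {x \<in> F. X x})"
      using fin by (simp add: sum.If_cases of_bool_def Int_def)
    finally show ?thesis .
  qed
  then have "measure_pmf.prob ?P {X. t \<le> real (card {x \<in> F. X x})} \<le>
     measure_pmf.prob ?P {X. l * t \<le> (\<Sum>x\<in>I. ?w x * of_bool (X x))}"
    using lam by (intro measure_pmf.finite_measure_mono) (auto intro: mult_left_mono)
  also have "\<dots> \<le> exp (- (l * t) + (\<Sum>x\<in>I. r x * (exp (?w x) - 1)))"
    using r p by (intro bernoulli_chernoff I) force
  also have "\<dots> \<le> exp (- l * t + c * p * exp l)"
  proof -
    have "(\<Sum>x\<in>I. r x * (exp (?w x) - 1)) = (\<Sum>x\<in>F. r x * (exp l - 1))"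
      unfolding sum[symmetric] by (intro sum.cong) auto
    also have "\<dots> \<le> (\<Sum>x\<in>F. p * exp l)"
      using r F lam p by (intro sum_mono mult_mono) auto
    also have "\<dots> \<le> c * p * exp l"
      using c p by (simp add: mult_right_mono mult.assoc)
    finally show ?thesis by simp
  qed
  finally show ?thesis .
qed

text \<open>The number of sets of size s in the form exp (s (1 + log (n / s))), which is what the
union bound over small sets can afford.\<close>

lemma binomial_le_exp:
  assumes "1 \<le> s" "s \<le> n"
  shows "real (n choose s) \<le> exp (real s * (1 + ln (real n / real s)))"
proof -
  have sums: "(\<lambda>k. real s ^ k /\<^sub>R fact k) sums exp (real s)" by (rule exp_converges)
  have "sum (\<lambda>k. real s ^ k /\<^sub>R fact k) {s} \<le> (\<Sum>k. real s ^ k /\<^sub>R fact k)"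
    by (intro sum_le_suminf sums_summable[OF sums]) auto
  then have "real s ^ s /\<^sub>R fact s \<le> exp (real s)" using sums_unique[OF sums] by simp
  then have fact: "real s ^ s \<le> exp (real s) * fact s" by (simp add: divide_simps)
  have "real (n choose s) * fact s = real ((n choose s) * fact s)" by simp
  also have "\<dots> \<le> real (n ^ s)" using binomial_fact_pow[of n s] by (simp only: of_nat_le_iff)
  finally have 1: "real (n choose s) * fact s \<le> real n ^ s" by simp
  have "real (n choose s) * real s ^ s \<le> real (n choose s) * (exp (real s) * fact s)"
    using fact by (rule mult_left_mono) simp
  also have "\<dots> \<le> exp (real s) * real n ^ s" using 1 by (simp add: mult_ac)
  finally have "real (n choose s) \<le> exp (real s) * (real n / real s) ^ s"
    using assms by (simp add: power_divide divide_simps)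
  also have "(real n / real s) ^ s = exp (real s * ln (real n / real s))"
    using assms by (simp add: exp_of_nat_mult)
  finally show ?thesis by (simp add: exp_add distrib_left)
qed

lemma binomial_ge_power: "real (n - k) ^ k \<le> fact k * real (n choose k)"
proof (cases "k \<le> n")
  case True
  have "real (n - k) ^ k = (\<Prod>i = 0..<k. real (n - k))" by simp
  also have "\<dots> \<le> (\<Prod>i = 0..<k. real (n - i))" by (intro prod_mono) auto
  also have "\<dots> = (\<Prod>i = 0..<k. real n - real i)" using True by (intro prod.cong) auto
  also have "\<dots> = fact k * real (n choose k)"
    by (simp add: binomial_gbinomial gbinomial_prod_rev)
  finally show ?thesis .
qed (cases k; simp)

section \<open>Exceptional events of the block model\<close>

lemma row_assign_mat_eq_iff:
  assumes "i < n" "j < n" "g i < K" "g j < K"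
  shows "row (assign_mat n K g) i = row (assign_mat n K g) j \<longleftrightarrow> g i = g j"
proof
  assume "row (assign_mat n K g) i = row (assign_mat n K g) j"
  then have "assign_mat n K g $$ (i, g i) = assign_mat n K g $$ (j, g i)"
    using assms by (metis index_row(1) assign_mat_carrier(2,3))
  then show "g i = g j" using assms by (simp split: if_splits)
next
  assume eq: "g i = g j"
  show "row (assign_mat n K g) i = row (assign_mat n K g) j"
    unfolding row_assign_mat[OF assms(1)] row_assign_mat[OF assms(2)] eq ..
qed

locale block_model =
  fixes n d K :: nat and g :: "nat \<Rightarrow> nat" and p q :: real
  assumes bal: "balanced_fun n K g" and d: "2 \<le> d" and q: "0 \<le> q" "q \<le> p" and p: "p \<le> 1"
begin

definition edge_prob :: "nat list \<Rightarrow> real" where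
  "edge_prob e = (if same_community (assign_mat n K g) e then p else q)"

definition edges_pmf :: "(nat list \<Rightarrow> bool) pmf" where
  "edges_pmf = Pi_pmf (increasing_tuples n d) False (\<lambda>e. bernoulli_pmf (edge_prob e))"

abbreviation Pr :: "(nat list \<Rightarrow> bool) set \<Rightarrow> real" where
  "Pr \<equiv> measure_pmf.prob edges_pmf"

lemma hsbm_edges: "hsbm n d p q (assign_mat n K g) = map_pmf (tensor_of n d) edges_pmf"
  unfolding hsbm_eq edges_pmf_def edge_prob_def ..

lemma edge_prob_bounds: "0 \<le> edge_prob e" "edge_prob e \<le> p" "edge_prob e \<le> 1"
  using q p by (auto simp: edge_prob_def)

lemma prob_edges_many:
  assumes "F \<subseteq> increasing_tuples n d" "real (card F) \<le> c" "0 \<le> l"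
  shows "Pr {X. t \<le> real (card {e \<in> F. X e})} \<le> exp (- l * t + c * p * exp l)"
  unfolding edges_pmf_def using assms edge_prob_bounds q p
  by (intro prob_many_present) auto

lemma prob_large_degree:
  assumes i: "i < n"
  shows "Pr {X. fact (d - 1) * t \<le> real (ordered_degree (tensor_of n d X) i)}
    \<le> exp (- t + real n ^ (d - 1) * p * exp 1)"
proof -
  let ?F = "{e \<in> increasing_tuples n d. i \<in> set e}"
  have "ordered_degree (tensor_of n d X) i = fact (d - 1) * card {e \<in> ?F. X e}" for X
  proof -
    have eq: "{e \<in> increasing_tuples n d. X e \<and> i \<in> set e \<and> True} = {e \<in> ?F. X e}" by blast
    have "1 \<le> d" using d by simp
    from card_nonzero_tuples[OF i this, of X "\<lambda>_. True"]
    show ?thesis unfolding ordered_degree_def eq by (simp only: simp_thms)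
  qed
  then have "{X. fact (d - 1) * t \<le> real (ordered_degree (tensor_of n d X) i)} =
     {X. t \<le> real (card {e \<in> ?F. X e})}" by simp
  moreover have "card ?F \<le> n ^ (d - 1)" using card_edges_containing[of "{i}" d n] d by simp
  then have "real (card ?F) \<le> real n ^ (d - 1)" by (metis of_nat_le_iff of_nat_power)
  ultimately show ?thesis using prob_edges_many[of ?F "real n ^ (d - 1)" 1 t] by simp
qed

text \<open>Each hyperedge is counted for at most d first nodes, and at most |S| |S'| n^(d - 2) hyperedges
contain a node of S' and another node of S.\<close>

lemma prob_bad_expansion:
  assumes S: "S \<subseteq> {..<n}" "S' \<subseteq> {..<n}" and l: "0 \<le> l"
  shows "Pr {X. fact d * t \<le> (\<Sum>i\<in>S'. real (touch_count (tensor_of n d X) S i))}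
    \<le> exp (- l * t + real (card S) * real (card S') * real n ^ (d - 2) * p * exp l)"
proof -
  let ?E = "increasing_tuples n d"
  let ?F = "{e \<in> ?E. \<exists>i\<in>S' \<inter> set e. (set e - {i}) \<inter> S \<noteq> {}}"
  have fin: "finite S" "finite S'" using S finite_subset by blast+
  have touch: "(\<Sum>i\<in>S'. touch_count (tensor_of n d X) S i) \<le> fact d * card {e \<in> ?F. X e}" for X
  proof -
    let ?G = "{e \<in> ?F. X e}"
    have "touch_count (tensor_of n d X) S i \<le> fact (d - 1) * card {e \<in> ?G. i \<in> set e}" if i: "i \<in> S'" for i
    proof -
      have "touch_count (tensor_of n d X) S i =
         fact (d - 1) * card {e \<in> ?E. X e \<and> i \<in> set e \<and> (set e - {i}) \<inter> S \<noteq> {}}"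
        unfolding touch_count_def
        by (rule card_nonzero_tuples[where P = "\<lambda>T. T \<inter> S \<noteq> {}"]) (use i S d in auto)
      also have "\<dots> \<le> fact (d - 1) * card {e \<in> ?G. i \<in> set e}"
      proof (intro mult_left_mono card_mono)
        show "{e \<in> ?E. X e \<and> i \<in> set e \<and> (set e - {i}) \<inter> S \<noteq> {}} \<subseteq> {e \<in> ?G. i \<in> set e}"
          using i by blast
      qed simp_all
      finally show ?thesis .
    qed
    then have "(\<Sum>i\<in>S'. touch_count (tensor_of n d X) S i) \<le> (\<Sum>i\<in>S'. fact (d - 1) * card {e \<in> ?G. i \<in> set e})"
      by (rule sum_mono)
    also have "\<dots> = fact (d - 1) * (\<Sum>i\<in>S'. \<Sum>e\<in>?G. if i \<in> set e then 1 else 0)"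
      by (simp add: sum_distrib_left sum.If_cases Int_def)
    also have "(\<Sum>i\<in>S'. \<Sum>e\<in>?G. if i \<in> set e then 1 else 0) = (\<Sum>e\<in>?G. \<Sum>i\<in>S'. if i \<in> set e then 1 else 0)"
      by (rule sum.swap)
    also have "\<dots> \<le> (\<Sum>e\<in>?G. d)"
    proof (rule sum_mono)
      fix e assume "e \<in> ?G"
      then have "card (set e) = d" using increasing_tuplesD(5)[of e n d] by simp
      moreover have "card (S' \<inter> set e) \<le> card (set e)" by (intro card_mono) auto
      ultimately show "(\<Sum>i\<in>S'. if i \<in> set e then 1 else 0) \<le> d"
        using fin by (simp add: sum.If_cases)
    qed
    finally have "(\<Sum>i\<in>S'. touch_count (tensor_of n d X) S i) \<le> fact (d - 1) * (card ?G * d)" by simp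
    also have "\<dots> = fact d * card ?G" using d by (simp add: fact_reduce[of d])
    finally show ?thesis .
  qed
  have cF: "real (card ?F) \<le> real (card S) * real (card S') * real n ^ (d - 2)"
  proof -
    let ?I = "{(i, j). i \<in> S' \<and> j \<in> S \<and> i \<noteq> j}"
    have finI: "finite ?I" by (rule finite_subset[of _ "S' \<times> S"]) (use fin in auto)
    have "?F \<subseteq> (\<Union>(i, j)\<in>?I. {e \<in> ?E. {i, j} \<subseteq> set e})" by blast
    moreover have "finite (\<Union>(i, j)\<in>?I. {e \<in> ?E. {i, j} \<subseteq> set e})"
      using finI by (intro finite_UN_I) (auto simp: case_prod_unfold)
    ultimately have "card ?F \<le> card (\<Union>(i, j)\<in>?I. {e \<in> ?E. {i, j} \<subseteq> set e})"
      by (intro card_mono)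
    also have "\<dots> \<le> (\<Sum>(i, j)\<in>?I. card {e \<in> ?E. {i, j} \<subseteq> set e})"
      using card_UN_le[OF finI, of "\<lambda>(i, j). {e \<in> ?E. {i, j} \<subseteq> set e}"] by (simp add: case_prod_unfold)
    also have "\<dots> \<le> (\<Sum>(i, j)\<in>?I. n ^ (d - 2))"
    proof (rule sum_mono, clarify)
      fix i j :: nat assume "i \<noteq> j"
      then show "card {e \<in> ?E. {i, j} \<subseteq> set e} \<le> n ^ (d - 2)"
        using card_edges_containing[of "{i, j}" d n] d by (simp add: numeral_2_eq_2)
    qed
    also have "\<dots> = card ?I * n ^ (d - 2)" by (simp add: case_prod_unfold)
    also have "\<dots> \<le> (card S' * card S) * n ^ (d - 2)"
    proof (rule mult_right_mono)
      have "card ?I \<le> card (S' \<times> S)" using fin by (intro card_mono) auto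
      then show "card ?I \<le> card S' * card S" by (simp add: card_cartesian_product)
    qed simp
    finally have "real (card ?F) \<le> real ((card S' * card S) * n ^ (d - 2))" by (simp only: of_nat_le_iff)
    then show ?thesis by (simp add: mult_ac)
  qed
  have "{X. fact d * t \<le> (\<Sum>i\<in>S'. real (touch_count (tensor_of n d X) S i))} \<subseteq>
     {X. t \<le> real (card {e \<in> ?F. X e})}"
  proof
    fix X assume "X \<in> {X. fact d * t \<le> (\<Sum>i\<in>S'. real (touch_count (tensor_of n d X) S i))}"
    then have "fact d * t \<le> real (\<Sum>i\<in>S'. touch_count (tensor_of n d X) S i)" by simp
    also have "\<dots> \<le> real (fact d * card {e \<in> ?F. X e})" using touch[of X] by (simp only: of_nat_le_iff)
    finally have "fact d * t \<le> fact d * real (card {e \<in> ?F. X e})" by simp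
    then show "X \<in> {X. t \<le> real (card {e \<in> ?F. X e})}"
      by (simp only: mult_le_cancel_left_pos[OF fact_gt_zero] mem_Collect_eq)
  qed
  then have "Pr {X. fact d * t \<le> (\<Sum>i\<in>S'. real (touch_count (tensor_of n d X) S i))}
     \<le> Pr {X. t \<le> real (card {e \<in> ?F. X e})}"
    by (intro measure_pmf.finite_measure_mono) auto
  also have "\<dots> \<le> exp (- l * t + real (card S) * real (card S') * real n ^ (d - 2) * p * exp l)"
    using prob_edges_many[OF _ cF l] by blast
  finally show ?thesis .
qed

text \<open>The two counts involve disjoint sets of hyperedges, one with probability p and one with
probability q. The weights -l and l turn the comparison into one exponential moment.\<close>

lemma prob_small_gap:
  fixes l :: real
  assumes i: "i < n" and k: "k < K" "k \<noteq> g i" and m: "m = n div K" and l: "0 \<le> l"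
  shows "Pr {X. real (nbr_count (tensor_of n d X) g i (g i)) <
        real (nbr_count (tensor_of n d X) g i k) + fact (d - 1) * t}
    \<le> exp (l * t + real (m - 1 choose (d - 1)) * p * (exp (- l) - 1) + real (m choose (d - 1)) * q * (exp l - 1))"
proof -
  let ?E = "increasing_tuples n d"
  define F where "F a = {e \<in> ?E. i \<in> set e \<and> (\<forall>j\<in>set e - {i}. g j = a)}" for a
  have FE: "F a \<subseteq> ?E" and finF: "finite (F a)" for a by (auto simp: F_def)
  have Fi: "i \<in> set e" and Fn: "set e \<subseteq> {..<n}" if "e \<in> F a" for e a
    using that increasing_tuplesD(4) by (auto simp: F_def)
  have Fg: "g j = a" if "e \<in> F a" "j \<in> set e" "j \<noteq> i" for e a j using that by (auto simp: F_def)
  let ?w = "\<lambda>e. if e \<in> F (g i) then - l else if e \<in> F k then l else 0"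
  have gK: "g j < K" if "j < n" for j using bal that by (simp add: balanced_fun_def)
  have nbr: "nbr_count (tensor_of n d X) g i a = fact (d - 1) * card {e \<in> F a. X e}" for X a
  proof -
    have eq: "{e \<in> ?E. X e \<and> i \<in> set e \<and> (\<forall>j\<in>set e - {i}. g j = a)} = {e \<in> F a. X e}"
      unfolding F_def by blast
    have "1 \<le> d" using d by simp
    from card_nonzero_tuples[OF i this, of X "\<lambda>T. \<forall>j\<in>T. g j = a"]
    show ?thesis unfolding nbr_count_def eq .
  qed
  have cardF: "card (F a) = card (members n g a - {i}) choose (d - 1)" for a
  proof -
    have "F a = {e \<in> ?E. i \<in> set e \<and> set e - {i} \<subseteq> members n g a - {i}}"
      unfolding F_def
    proof (intro Collect_cong conj_cong refl)
      fix e assume "e \<in> ?E" "i \<in> set e"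
      then have "set e \<subseteq> {..<n}" using increasing_tuplesD(4) by blast
      then show "(\<forall>j\<in>set e - {i}. g j = a) \<longleftrightarrow> set e - {i} \<subseteq> members n g a - {i}"
        by (auto simp: members_def)
    qed
    then have "card (F a) = card {e \<in> ?E. i \<in> set e \<and> set e - {i} \<subseteq> members n g a - {i}}"
      by (rule arg_cong)
    also have "\<dots> = card (members n g a - {i}) choose (d - 1)"
      by (rule card_edges_through[OF i]) (use d in \<open>auto simp: members_def\<close>)
    finally show ?thesis .
  qed
  have "i \<in> members n g (g i)" "i \<notin> members n g k" using i k by (auto simp: members_def)
  then have N: "card (F (g i)) = m - 1 choose (d - 1)" "card (F k) = m choose (d - 1)"
    unfolding cardF using bal gK[OF i] k(1) m by (simp_all add: balanced_fun_def)
  have other: "\<exists>j\<in>set e. j \<noteq> i" if "e \<in> F a" for e a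
  proof (rule ccontr)
    assume "\<not> ?thesis"
    then have "set e \<subseteq> {i}" by blast
    then have "card (set e) \<le> 1" using card_mono[of "{i}" "set e"] by simp
    moreover have "card (set e) = d" using that FE increasing_tuplesD(5) by blast
    ultimately show False using d by simp
  qed
  \<comment> \<open>Both kinds of hyperedges contain a node other than i, whose community tells them apart.\<close>
  have disj: "e \<notin> F (g i)" if "e \<in> F k" for e
    using other[OF that] Fg[OF that] Fg[of e "g i"] k(2) by blast
  have pF: "edge_prob e = p" if e: "e \<in> F (g i)" for e
  proof -
    have gj: "g j = g i" if "j \<in> set e" for j using Fg[OF e that] by blast
    have "same_community (assign_mat n K g) e"
      unfolding same_community_def
    proof (intro ballI)
      fix x y assume xy: "x \<in> set e" "y \<in> set e"
      then have "x < n" "y < n" using Fn[OF e] by auto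
      then show "row (assign_mat n K g) x = row (assign_mat n K g) y"
        using row_assign_mat_eq_iff[of x n y g K] gK[of x] gK[of y] gj[OF xy(1)] gj[OF xy(2)] by simp
    qed
    then show ?thesis by (simp add: edge_prob_def)
  qed
  have qF: "edge_prob e = q" if e: "e \<in> F k" for e
  proof -
    obtain j where j: "j \<in> set e" "j \<noteq> i" using other e by blast
    have "g j = k" using Fg[OF e j] .
    moreover have "j < n" using Fn[OF e] j by blast
    ultimately have "row (assign_mat n K g) i \<noteq> row (assign_mat n K g) j"
      using row_assign_mat_eq_iff[of i n j g K] i gK[of i] gK[of j] k by auto
    then have "\<not> same_community (assign_mat n K g) e"
      unfolding same_community_def using j(1) Fi[OF e] by blast
    then show ?thesis by (simp add: edge_prob_def)
  qed
  have split: "(\<Sum>e\<in>?E. if e \<in> F (g i) then a e else if e \<in> F k then b e else 0) =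
      (\<Sum>e\<in>F (g i). a e) + (\<Sum>e\<in>F k. b e)" for a b :: "nat list \<Rightarrow> real"
  proof -
    have one: "(\<Sum>e\<in>?E. if e \<in> F x then f e else 0) = (\<Sum>e\<in>F x. f e)" for x and f :: "nat list \<Rightarrow> real"
      using FE by (simp add: sum.If_cases Int_absorb1)
    have "(\<Sum>e\<in>?E. if e \<in> F (g i) then a e else if e \<in> F k then b e else 0) =
       (\<Sum>e\<in>?E. (if e \<in> F (g i) then a e else 0) + (if e \<in> F k then b e else 0))"
      using disj by (intro sum.cong) auto
    then show ?thesis unfolding sum.distrib one .
  qed
  have sum_w: "(\<Sum>e\<in>?E. ?w e * of_bool (X e)) =
     l * (real (card {e \<in> F k. X e}) - real (card {e \<in> F (g i). X e}))" for X
  proof -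
    have c: "(\<Sum>e\<in>F a. c * of_bool (X e)) = c * real (card {e \<in> F a. X e})" for a and c :: real
    proof -
      have "(\<Sum>e\<in>F a. of_bool (X e)) = real (card {e \<in> F a. X e})"
        using finF by (simp add: sum.If_cases of_bool_def Int_def)
      then show ?thesis by (simp only: sum_distrib_left[symmetric])
    qed
    have "(\<Sum>e\<in>?E. ?w e * of_bool (X e)) =
       (\<Sum>e\<in>?E. if e \<in> F (g i) then - l * of_bool (X e) else if e \<in> F k then l * of_bool (X e) else 0)"
      by (intro sum.cong) simp_all
    then show ?thesis unfolding split c by (simp only: right_diff_distrib mult_minus_left)
  qed
  have "{X. real (nbr_count (tensor_of n d X) g i (g i)) < real (nbr_count (tensor_of n d X) g i k) + fact (d - 1) * t}
     \<subseteq> {X. - (l * t) \<le> (\<Sum>e\<in>?E. ?w e * of_bool (X e))}"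
  proof
    fix X assume "X \<in> {X. real (nbr_count (tensor_of n d X) g i (g i)) < real (nbr_count (tensor_of n d X) g i k) + fact (d - 1) * t}"
    then have "fact (d - 1) * real (card {e \<in> F (g i). X e}) < fact (d - 1) * (real (card {e \<in> F k. X e}) + t)"
      unfolding nbr mem_Collect_eq of_nat_mult of_nat_fact distrib_left .
    then have "real (card {e \<in> F (g i). X e}) < real (card {e \<in> F k. X e}) + t"
      by (simp only: mult_less_cancel_left_pos[OF fact_gt_zero])
    then have "l * (- t) \<le> l * (real (card {e \<in> F k. X e}) - real (card {e \<in> F (g i). X e}))"
      using l by (intro mult_left_mono) auto
    then show "X \<in> {X. - (l * t) \<le> (\<Sum>e\<in>?E. ?w e * of_bool (X e))}" unfolding mem_Collect_eq sum_w by simp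
  qed
  then have "Pr {X. real (nbr_count (tensor_of n d X) g i (g i)) <
        real (nbr_count (tensor_of n d X) g i k) + fact (d - 1) * t} \<le>
     Pr {X. - (l * t) \<le> (\<Sum>e\<in>?E. ?w e * of_bool (X e))}"
    by (intro measure_pmf.finite_measure_mono) simp_all
  also have "\<dots> \<le> exp (- (- (l * t)) + (\<Sum>e\<in>?E. edge_prob e * (exp (?w e) - 1)))"
    unfolding edges_pmf_def by (rule bernoulli_chernoff) (simp_all add: edge_prob_bounds)
  also have "(\<Sum>e\<in>?E. edge_prob e * (exp (?w e) - 1)) =
     (\<Sum>e\<in>?E. if e \<in> F (g i) then p * (exp (- l) - 1) else if e \<in> F k then q * (exp l - 1) else 0)"
    using pF qF by (intro sum.cong) auto
  also have "\<dots> = real (m - 1 choose (d - 1)) * p * (exp (- l) - 1) + real (m choose (d - 1)) * q * (exp l - 1)"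
    unfolding split using N by simp
  finally show ?thesis by (simp add: add.assoc)
qed
end

lemma prob_UN_le:
  assumes "finite I" "\<And>i. i \<in> I \<Longrightarrow> measure_pmf.prob P (F i) \<le> b i"
  shows "measure_pmf.prob P (\<Union>i\<in>I. F i) \<le> (\<Sum>i\<in>I. b i)"
proof -
  have "measure_pmf.prob P (\<Union>i\<in>I. F i) \<le> (\<Sum>i\<in>I. measure_pmf.prob P (F i))"
    using assms(1) by (rule measure_UNION_le) simp
  also have "\<dots> \<le> (\<Sum>i\<in>I. b i)" using assms(2) by (rule sum_mono)
  finally show ?thesis .
qed

context block_model
begin

lemma prob_some_large_degree:
  assumes n: "0 < n" and p: "real n ^ (d - 1) * p = \<alpha> * ln n"
  shows "Pr {X. \<exists>i<n. fact (d - 1) * ((\<alpha> * exp 1 + 2) * ln n) \<le>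
      real (ordered_degree (tensor_of n d X) i)} \<le> 1 / n"
proof -
  let ?t = "(\<alpha> * exp 1 + 2) * ln n"
  let ?B = "\<lambda>i. {X. fact (d - 1) * ?t \<le> real (ordered_degree (tensor_of n d X) i)}"
  have "Pr (\<Union>i\<in>{..<n}. ?B i) \<le> (\<Sum>i<n. exp (- ?t + real n ^ (d - 1) * p * exp 1))"
  proof (rule prob_UN_le)
    fix i assume "i \<in> {..<n}"
    then show "Pr (?B i) \<le> exp (- ?t + real n ^ (d - 1) * p * exp 1)"
      by (intro prob_large_degree) simp
  qed simp
  also have "\<dots> = real n * exp (- 2 * ln n)" using p by (simp add: algebra_simps)
  also have "exp (- 2 * ln n) = 1 / (real n * real n)"
    using n by (simp add: exp_minus exp_double power2_eq_square divide_simps)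
  also have "real n * (1 / (real n * real n)) = 1 / n" using n by simp
  finally have "Pr (\<Union>i\<in>{..<n}. ?B i) \<le> 1 / n" .
  moreover have "(\<Union>i\<in>{..<n}. ?B i) = {X. \<exists>i<n. fact (d - 1) * ?t \<le> real (ordered_degree (tensor_of n d X) i)}" by blast
  ultimately show ?thesis by simp
qed

lemma prob_no_gap:
  assumes b: "\<And>m. m = n div K \<Longrightarrow> l * t + real (m - 1 choose (d - 1)) * p * (exp (- l) - 1) +
      real (m choose (d - 1)) * q * (exp l - 1) \<le> b" and l: "0 \<le> l"
  shows "Pr {X. \<not> has_gap n K (tensor_of n d X) g (fact (d - 1) * t)} \<le> real n * (real K * exp b)"
proof -
  let ?B = "\<lambda>i k. {X. real (nbr_count (tensor_of n d X) g i (g i)) < real (nbr_count (tensor_of n d X) g i k) + fact (d - 1) * t}"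
  have 1: "Pr (?B i k) \<le> exp b" if "i < n" "k < K" "k \<noteq> g i" for i k
    by (rule order_trans[OF prob_small_gap[OF that refl l]]) (use b in simp)
  have "{X. \<not> has_gap n K (tensor_of n d X) g (fact (d - 1) * t)} = (\<Union>i\<in>{..<n}. \<Union>k\<in>{..<K} - {g i}. ?B i k)"
    by (auto simp: has_gap_def not_le)
  also have "Pr \<dots> \<le> (\<Sum>i<n. real K * exp b)"
  proof (rule prob_UN_le)
    fix i assume i: "i \<in> {..<n}"
    have "Pr (\<Union>k\<in>{..<K} - {g i}. ?B i k) \<le> (\<Sum>k\<in>{..<K} - {g i}. exp b)"
      by (rule prob_UN_le) (use 1 i in auto)
    also have "\<dots> \<le> (\<Sum>k<K. exp b)" by (rule sum_mono2) auto
    finally show "Pr (\<Union>k\<in>{..<K} - {g i}. ?B i k) \<le> real K * exp b" by simp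
  qed simp
  finally show ?thesis by simp
qed

text \<open>For sets of sizes s and s' the threshold for the number of hyperedges is \<kappa> s' log n, and with y = log (n / s) the bound for
one pair is exp (s' log n (\<alpha> - \<kappa> y)). The number of pairs is at most
exp (s (1 + y) + s' log n), where s (1 + y) \<le> \<kappa> y s' log n / 2 by the choice of the ratio
\<kappa> log n / 4 between s and s'. So half of the exponent \<kappa> y survives, and y \<ge> Y makes it beat
\<alpha> + 1 by a margin of 3, which pays for the sum over s and s'.\<close>

lemma prob_not_expands:
  assumes n: "1 < n" and p: "real n ^ (d - 1) * p = \<alpha> * ln n" and \<alpha>: "0 < \<alpha>"
    and \<delta>: "0 < \<delta>" and \<kappa>: "\<kappa> = \<delta> / (2 * d)" and Y: "1 \<le> Y" "2 * (\<alpha> + 4) / \<kappa> \<le> Y"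
  shows "Pr
    {X. \<not> expands n (tensor_of n d X) (fact (d - 1) * (\<delta> * ln n)) (exp (- Y) * n) (\<kappa> / 4 * ln n)} \<le> 1 / n"
proof -
  let ?L = "\<kappa> / 4 * ln n"
  let ?sub = "\<lambda>s. {S. S \<subseteq> {..<n} \<and> card S = s}"
  let ?bad = "\<lambda>S S'. {X. fact d * (\<kappa> * ln n * card S') \<le> (\<Sum>i\<in>S'. real (touch_count (tensor_of n d X) S i))}"
  define I where "I = {(s, s'). s \<in> {1..n} \<and> s' \<in> {1..n} \<and> real s \<le> exp (- Y) * n \<and> real s \<le> ?L * s'}"
  have \<kappa>0: "0 < \<kappa>" using \<delta> d \<kappa> by simp
  have ln: "0 < ln (real n)" using n by simp
  have finI: "finite I" by (rule finite_subset[of _ "{1..n} \<times> {1..n}"]) (auto simp: I_def)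
  have cardI: "card I \<le> n * n"
  proof -
    have "card I \<le> card ({1..n} \<times> {1..n})" by (rule card_mono) (auto simp: I_def)
    then show ?thesis by (simp add: card_cartesian_product)
  qed
  have fin_sub: "finite (?sub s)" for s by (rule finite_subset[of _ "Pow {..<n}"]) auto
  have card_sub: "card (?sub s) = n choose s" for s using n_subsets[of "{..<n}" s] by simp
  have fact_d: "fact d = fact (d - 1) * real d" using d by (simp add: fact_reduce[of d])
  have "{X. \<not> expands n (tensor_of n d X) (fact (d - 1) * (\<delta> * ln n)) (exp (- Y) * n) ?L} \<subseteq>
     (\<Union>x\<in>I. \<Union>S\<in>?sub (fst x). \<Union>S'\<in>?sub (snd x). ?bad S S')"
  proof
    fix X assume "X \<in> {X. \<not> expands n (tensor_of n d X) (fact (d - 1) * (\<delta> * ln n)) (exp (- Y) * n) ?L}"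
    then obtain S S' where S: "S \<subseteq> {..<n}" "S' \<subseteq> {..<n}" "S \<noteq> {}" "S' \<noteq> {}"
      "real (card S) \<le> exp (- Y) * n" "real (card S) \<le> ?L * card S'"
      and big: "fact (d - 1) * (\<delta> * ln n) * card S' \<le> 2 * (\<Sum>i\<in>S'. real (touch_count (tensor_of n d X) S i))"
      unfolding expands_def by (auto simp: not_less)
    have c: "1 \<le> card S" "card S \<le> n" "1 \<le> card S'" "card S' \<le> n"
      using S card_mono[of "{..<n}" S] card_mono[of "{..<n}" S'] finite_subset[of S "{..<n}"] finite_subset[of S' "{..<n}"]
      by (auto simp: Suc_le_eq card_gt_0_iff)
    have "(card S, card S') \<in> I" using c S by (auto simp: I_def)
    moreover have "X \<in> ?bad S S'"
    proof -
      have "fact d * (\<kappa> * ln n * card S') = fact (d - 1) * (\<delta> * ln n) * card S' / 2"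
        unfolding fact_d \<kappa> using d by simp
      then show ?thesis unfolding mem_Collect_eq using big by linarith
    qed
    ultimately show "X \<in> (\<Union>x\<in>I. \<Union>S\<in>?sub (fst x). \<Union>S'\<in>?sub (snd x). ?bad S S')"
      using S(1,2) by (intro UN_I[of "(card S, card S')"] UN_I[of S] UN_I[of S']) auto
  qed
  then have "Pr {X. \<not> expands n (tensor_of n d X) (fact (d - 1) * (\<delta> * ln n)) (exp (- Y) * n) ?L} \<le>
     Pr (\<Union>x\<in>I. \<Union>S\<in>?sub (fst x). \<Union>S'\<in>?sub (snd x). ?bad S S')"
    by (intro measure_pmf.finite_measure_mono) simp_all
  also have "\<dots> \<le> (\<Sum>x\<in>I. exp (- 3 * ln n))"
  proof (rule prob_UN_le[OF finI])
    fix x assume x: "x \<in> I"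
    define s s' where "s = fst x" and "s' = snd x"
    have s: "1 \<le> s" "s \<le> n" "1 \<le> s'" "s' \<le> n" "real s \<le> exp (- Y) * n" "real s \<le> ?L * s'"
      using x by (auto simp: I_def s_def s'_def)
    define y where "y = ln (real n / real s)"
    have ey: "exp y = real n / real s" using n s by (simp add: y_def)
    have yY: "Y \<le> y"
    proof -
      have "exp Y \<le> real n / real s"
        using s by (simp add: exp_minus divide_simps mult.commute)
      then show ?thesis using ey exp_le_cancel_iff by metis
    qed
    let ?b = "exp (s' * ln n * (\<alpha> - \<kappa> * y))"
    \<comment> \<open>The weight y is chosen such that exp y compensates the factor s / n in the expected count.\<close>
    have one: "Pr (?bad S S') \<le> ?b" if S: "S \<in> ?sub s" "S' \<in> ?sub s'" for S S'
    proof -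
      have "Pr (?bad S S') \<le>
         exp (- y * (\<kappa> * ln n * card S') + real (card S) * real (card S') * real n ^ (d - 2) * p * exp y)"
        using S yY Y by (intro prob_bad_expansion) auto
      also have "real (card S) * real (card S') * real n ^ (d - 2) * p * exp y = s' * (real n ^ (d - 1) * p)"
      proof -
        have "d - 1 = Suc (d - 2)" using d by simp
        then have "real n ^ (d - 1) = real n * real n ^ (d - 2)" by simp
        then show ?thesis using S s ey by simp
      qed
      also have "exp (- y * (\<kappa> * ln n * card S') + s' * (real n ^ (d - 1) * p)) = ?b"
        unfolding p using S by (simp add: algebra_simps)
      finally show ?thesis using S by simp
    qed
    have "Pr (\<Union>S\<in>?sub s. \<Union>S'\<in>?sub s'. ?bad S S') \<le> (\<Sum>S\<in>?sub s. \<Sum>S'\<in>?sub s'. ?b)"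
      by (intro prob_UN_le fin_sub one) auto
    also have "\<dots> = real (n choose s) * (real (n choose s') * ?b)"
      unfolding sum_constant card_sub ..
    also have "\<dots> \<le> exp (s * (1 + y)) * (exp (s' * ln n) * ?b)"
    proof (intro mult_mono)
      show "real (n choose s) \<le> exp (s * (1 + y))" unfolding y_def using s by (intro binomial_le_exp) auto
      have "n choose s' \<le> n ^ s'" using s by (intro binomial_le_pow)
      then have "real (n choose s') \<le> real n ^ s'" by (metis of_nat_le_iff of_nat_power)
      also have "\<dots> = exp (s' * ln n)" using n by (simp add: exp_of_nat_mult)
      finally show "real (n choose s') \<le> exp (s' * ln n)" .
    qed auto
    also have "\<dots> = exp (s * (1 + y) + s' * ln n + s' * ln n * (\<alpha> - \<kappa> * y))"
      by (simp add: exp_add mult.assoc)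
    also have "\<dots> \<le> exp (- 3 * ln n)"
    proof -
      have "s * (1 + y) \<le> (?L * s') * (2 * y)"
        using s yY Y by (intro mult_mono) auto
      moreover have "\<alpha> + 4 \<le> \<kappa> / 2 * y"
      proof -
        have "\<kappa> / 2 * (2 * (\<alpha> + 4) / \<kappa>) \<le> \<kappa> / 2 * y"
          using Y yY \<kappa>0 by (intro mult_left_mono) auto
        then show ?thesis using \<kappa>0 by simp
      qed
      then have "s' * ln n * (\<alpha> + 4) \<le> s' * ln n * (\<kappa> / 2 * y)"
        using ln by (intro mult_left_mono) auto
      moreover have "1 * ln n \<le> s' * ln n" using s ln by (intro mult_right_mono) auto
      ultimately have "s * (1 + y) + s' * ln n + s' * ln n * (\<alpha> - \<kappa> * y) \<le> - 3 * ln n"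
        by (simp add: algebra_simps)
      then show ?thesis by simp
    qed
    finally show "Pr (\<Union>S\<in>?sub (fst x). \<Union>S'\<in>?sub (snd x). ?bad S S') \<le> exp (- 3 * ln n)"
      unfolding s_def s'_def .
  qed
  also have "\<dots> = card I * exp (- 3 * ln n)" by simp
  also have "\<dots> \<le> (n * n) * exp (- 3 * ln n)"
    using cardI by (intro mult_right_mono) (simp_all only: of_nat_le_iff of_nat_mult[symmetric] exp_ge_zero)
  also have "exp (- 3 * ln n) = 1 / (real n * real n * real n)"
  proof -
    have "exp (3 * ln (real n)) = real n ^ 3" using n exp_of_nat_mult[of 3 "ln (real n)"] by simp
    then show ?thesis by (simp add: exp_minus power3_eq_cube inverse_eq_divide)
  qed
  also have "(n * n) * (1 / (real n * real n * real n)) = 1 / n" using n by simp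
  finally show ?thesis .
qed

end

section \<open>Asymptotics and the theorem\<close>

text \<open>With exp l = a / b the two expected counts contribute a (a - b) and b (a - b) up to the common
factor log n / c with c = K^(d - 1) (d - 1)!, and their difference is (a - b)^2 = D c. The term with \<delta> takes away (D - 1) / 2 and
the deviation of the binomial coefficient from a power at most (D - 1) / 4, which leaves more than
one.\<close>

lemma gap_exponent_le:
  fixes a b \<delta> l D :: real and d K :: nat
  assumes d: "2 \<le> d" and K: "2 \<le> K" and ab: "0 < b" "b < a"
    and D: "D = (a - b)\<^sup>2 / (real K ^ (d - 1) * fact (d - 1))" and D1: "1 < D"
    and l: "l = ln (a / b)" and \<delta>: "l * \<delta> = (D - 1) / 2"
  shows "\<forall>\<^sub>F n in sequentially. K dvd n \<longrightarrow>
    l * (\<delta> * ln n) + real (n div K - 1 choose (d - 1)) * (a\<^sup>2 * ln n / real n ^ (d - 1)) * (exp (- l) - 1) +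
      real (n div K choose (d - 1)) * (b\<^sup>2 * ln n / real n ^ (d - 1)) * (exp l - 1) \<le> - (1 + (D - 1) / 4) * ln n"
proof -
  define c where "c = real K ^ (d - 1) * fact (d - 1)"
  define \<rho> where "\<rho> n = (1 - real d * real K / real n) ^ (d - 1)" for n :: nat
  have c: "0 < c" using K by (simp add: c_def)
  have el: "exp l = a / b" "exp (- l) = b / a" using ab by (simp_all add: l exp_minus)
  have "(\<lambda>n. 1 - real d * real K / real n) \<longlonglongrightarrow> 1 - 0"
    by (intro tendsto_intros lim_const_over_n)
  then have "\<rho> \<longlonglongrightarrow> 1 ^ (d - 1)" unfolding \<rho>_def[abs_def] by (intro tendsto_power) simp
  then have "(\<lambda>n. a * (a - b) / c * \<rho> n) \<longlonglongrightarrow> a * (a - b) / c * 1" by (intro tendsto_intros) simp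
  moreover have "a * (a - b) / c * 1 - (D - 1) / 4 < a * (a - b) / c * 1" using D1 by simp
  ultimately have ev: "\<forall>\<^sub>F n in sequentially. a * (a - b) / c * 1 - (D - 1) / 4 < a * (a - b) / c * \<rho> n"
    by (rule order_tendstoD(1))
  show ?thesis
    using ev eventually_ge_at_top[of "d * K"]
  proof eventually_elim
    case (elim n)
    show ?case
    proof
      assume dvd: "K dvd n"
      define m where "m = n div K"
      have nm: "n = K * m" using dvd by (simp add: m_def)
      have n0: "0 < n" using elim(2) d K by (auto intro: Nat.gr0I)
      have dm: "d \<le> m" using elim(2) K by (simp add: nm mult.commute)
      have ln0: "0 \<le> ln (real n)" using n0 by simp
      have N2: "\<rho> n * real m ^ (d - 1) \<le> fact (d - 1) * real (m - 1 choose (d - 1))"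
      proof -
        have "(1 - real d * real K / real n) * real m = real m - real d"
          using K n0 by (simp add: nm field_simps)
        also have "\<dots> = real (m - 1 - (d - 1))" using dm d by (simp add: of_nat_diff)
        finally have "\<rho> n * real m ^ (d - 1) = real (m - 1 - (d - 1)) ^ (d - 1)"
          by (simp only: \<rho>_def power_mult_distrib[symmetric])
        also have "\<dots> \<le> fact (d - 1) * real (m - 1 choose (d - 1))" by (rule binomial_ge_power)
        finally show ?thesis .
      qed
      have N1: "fact (d - 1) * real (m choose (d - 1)) \<le> real m ^ (d - 1)"
      proof -
        have "real ((m choose (d - 1)) * fact (d - 1)) \<le> real (m ^ (d - 1))"
          using binomial_fact_pow[of m "d - 1"] by (simp only: of_nat_le_iff)
        then show ?thesis by (simp add: mult.commute)
      qed
      have npow: "real n ^ (d - 1) = real K ^ (d - 1) * real m ^ (d - 1)" by (simp add: nm power_mult_distrib)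
      have m0: "0 < real m ^ (d - 1)" using dm d by simp
      have cancel: "x / (k * f) * r = (r * z) * (x / (f * (k * z)))" if "0 < z" for x k f r z :: real
        using that by (simp add: mult.commute)
      have P2: "ln n / c * \<rho> n \<le> real (m - 1 choose (d - 1)) * (ln n / real n ^ (d - 1))"
      proof -
        have "ln n / c * \<rho> n = (\<rho> n * real m ^ (d - 1)) * (ln n / (fact (d - 1) * real n ^ (d - 1)))"
          unfolding c_def npow by (rule cancel[OF m0])
        also have "\<dots> \<le> (fact (d - 1) * real (m - 1 choose (d - 1))) * (ln n / (fact (d - 1) * real n ^ (d - 1)))"
          using N2 ln0 by (intro mult_right_mono) auto
        finally show ?thesis by simp
      qed
      have P1: "real (m choose (d - 1)) * (ln n / real n ^ (d - 1)) \<le> ln n / c"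
      proof -
        have "real (m choose (d - 1)) * (ln n / real n ^ (d - 1)) =
           (fact (d - 1) * real (m choose (d - 1))) * (ln n / (fact (d - 1) * real n ^ (d - 1)))" by simp
        also have "\<dots> \<le> real m ^ (d - 1) * (ln n / (fact (d - 1) * real n ^ (d - 1)))"
          using N1 ln0 by (intro mult_right_mono) auto
        also have "\<dots> = ln n / c"
          unfolding c_def npow by (rule cancel[OF m0, of "ln n" _ _ 1, unfolded mult_1 mult_1_right, symmetric])
        finally show ?thesis .
      qed
      define U where "U = real (m - 1 choose (d - 1)) * (ln n / real n ^ (d - 1))"
      define W where "W = real (m choose (d - 1)) * (ln n / real n ^ (d - 1))"
      define u where "u = a * (a - b)"
      define w where "w = b * (a - b)"
      have "D = (a - b)\<^sup>2 / c" unfolding D c_def ..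
      then have "D * c = (a - b)\<^sup>2" using c by simp
      then have uw: "0 \<le> u" "0 \<le> w" "u - w = D * c"
        using ab by (simp_all add: u_def w_def power2_eq_square algebra_simps)
      have e2: "real (m - 1 choose (d - 1)) * (a\<^sup>2 * ln n / real n ^ (d - 1)) * (exp (- l) - 1) = - (u * U)"
      proof -
        have "a\<^sup>2 * (exp (- l) - 1) = - u" unfolding el u_def using ab by (simp add: field_simps power2_eq_square)
        moreover have "real (m - 1 choose (d - 1)) * (a\<^sup>2 * ln n / real n ^ (d - 1)) * (exp (- l) - 1) =
           (a\<^sup>2 * (exp (- l) - 1)) * U" unfolding U_def by simp
        ultimately show ?thesis by simp
      qed
      have e1: "real (m choose (d - 1)) * (b\<^sup>2 * ln n / real n ^ (d - 1)) * (exp l - 1) = w * W"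
      proof -
        have "b\<^sup>2 * (exp l - 1) = w" unfolding el w_def using ab by (simp add: field_simps power2_eq_square)
        moreover have "real (m choose (d - 1)) * (b\<^sup>2 * ln n / real n ^ (d - 1)) * (exp l - 1) =
           (b\<^sup>2 * (exp l - 1)) * W" unfolding W_def by simp
        ultimately show ?thesis by simp
      qed
      let ?x = "ln n / c"
      have 1: "u * (?x * \<rho> n) \<le> u * U" using P2 uw unfolding U_def by (intro mult_left_mono) auto
      have 2: "w * W \<le> w * ?x" using P1 uw unfolding W_def by (intro mult_left_mono) auto
      have 3: "u * ?x - (D * ln n / 4 - ln n / 4) \<le> u * (?x * \<rho> n)"
      proof -
        have "(u / c * 1 - (D - 1) / 4) * ln n \<le> (u / c * \<rho> n) * ln n"
          using elim(1) ln0 unfolding u_def by (intro mult_right_mono) auto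
        moreover have "(u / c * 1 - (D - 1) / 4) * ln n = u * ?x - (D * ln n / 4 - ln n / 4)"
          by (simp add: left_diff_distrib diff_divide_distrib)
        moreover have "(u / c * \<rho> n) * ln n = u * (?x * \<rho> n)" by simp
        ultimately show ?thesis by (simp only:)
      qed
      have 4: "u * ?x - w * ?x = D * ln n"
        using c unfolding left_diff_distrib[symmetric] uw(3) by simp
      have "l * (\<delta> * ln n) = (D - 1) / 2 * ln n" using \<delta> by (simp add: mult.assoc[symmetric])
      also have "\<dots> = D * ln n / 2 - ln n / 2" by (simp add: left_diff_distrib diff_divide_distrib)
      finally have 5: "l * (\<delta> * ln n) = D * ln n / 2 - ln n / 2" .
      have 6: "- (1 + (D - 1) / 4) * ln n = - (ln n + (D * ln n / 4 - ln n / 4))"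
        by (simp add: left_diff_distrib diff_divide_distrib distrib_right)
      have "A + - UU + WW \<le> - (x + (y / 4 - x / 4))"
        if "X \<le> UU" "WW \<le> Y" "Z - (y / 4 - x / 4) \<le> X" "Z - Y = y" "A = y / 2 - x / 2"
        for A UU WW X Y Z x y :: real using that by linarith
      from this[OF 1 2 3 4 5]
      show "l * (\<delta> * ln n) + real (n div K - 1 choose (d - 1)) * (a\<^sup>2 * ln n / real n ^ (d - 1)) * (exp (- l) - 1) +
        real (n div K choose (d - 1)) * (b\<^sup>2 * ln n / real n ^ (d - 1)) * (exp l - 1) \<le> - (1 + (D - 1) / 4) * ln n"
        unfolding m_def[symmetric] e1 e2 6 .
    qed
  qed
qed

definition iterations :: "nat \<Rightarrow> nat" where
  "iterations n = nat \<lceil>2 * ln (ln (real n))\<rceil> + nat \<lceil>2 * ln (real n) / ln (ln (real n))\<rceil> + 2"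

lemma iterations_ge: "2 * ln (real n) / ln (ln (real n)) \<le> real (iterations n)"
  unfolding iterations_def by linarith

lemma eventually_iterations_le:
  "\<forall>\<^sub>F n in sequentially. real (iterations n + 1) \<le> 9 * (ln (real n) / ln (ln (real n)))"
proof -
  have "\<forall>\<^sub>F n in sequentially. 0 \<le> ln (ln (real n))" by real_asymp
  moreover have "\<forall>\<^sub>F n in sequentially. ln (ln (real n)) \<le> ln (real n) / ln (ln (real n))" by real_asymp
  moreover have "\<forall>\<^sub>F n in sequentially. 1 \<le> ln (real n) / ln (ln (real n))" by real_asymp
  ultimately show ?thesis
  proof eventually_elim
    case (elim n)
    then have "0 \<le> 2 * ln (ln (real n))" "0 \<le> 2 * ln (real n) / ln (ln (real n))" by linarith+
    then have "real (iterations n + 1) \<le> (2 * ln (ln (real n)) + 1) + (2 * ln (real n) / ln (ln (real n)) + 1) + 3"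
      unfolding iterations_def by linarith
    then show ?case using elim by simp
  qed
qed

text \<open>Since \<eta> log n exceeds the root of log n, its power with exponent 2 log n / log log n is at
least n.\<close>

lemma eventually_contraction_power:
  fixes \<eta> :: real
  assumes "0 < \<eta>"
  shows "\<forall>\<^sub>F n in sequentially. 1 \<le> \<eta> * ln (real n) \<and> real n \<le> (\<eta> * ln (real n)) ^ iterations n"
proof -
  have "\<forall>\<^sub>F n in sequentially. sqrt (ln (real n)) \<le> \<eta> * ln (real n)" using assms by real_asymp
  moreover have "\<forall>\<^sub>F n in sequentially. 0 < ln (ln (real n))" by real_asymp
  moreover have "\<forall>\<^sub>F n in sequentially. 1 < ln (real n)" by real_asymp
  moreover have "\<forall>\<^sub>F n in sequentially. 1 < real n" by real_asymp
  ultimately show ?thesis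
  proof eventually_elim
    case (elim n)
    have "ln (real n) \<le> real (iterations n) * (ln (ln (real n)) / 2)"
      using iterations_ge[of n] elim by (simp add: field_simps)
    moreover have "real n = exp (ln (real n))" using elim by simp
    ultimately have "real n \<le> exp (real (iterations n) * (ln (ln (real n)) / 2))"
      by (metis exp_le_cancel_iff)
    also have "\<dots> = exp (ln (ln (real n)) / 2) ^ iterations n" by (rule exp_of_nat_mult)
    also have "exp (ln (ln (real n)) / 2) = sqrt (ln (real n))"
      using elim by (simp add: ln_sqrt[symmetric])
    also have "sqrt (ln (real n)) ^ iterations n \<le> (\<eta> * ln (real n)) ^ iterations n"
      using elim by (intro power_mono) auto
    finally show ?case using elim by (smt (verit) real_sqrt_ge_1_iff)
  qed
qed

lemma eventually_failure_le:
  fixes \<tau> c :: real and K :: nat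
  assumes "0 < c" "c < \<tau>" "c < 1"
  shows "\<forall>\<^sub>F n in sequentially. 1 / real n + real n * (real K * exp (- (1 + \<tau>) * ln (real n))) + 1 / real n \<le> real n powr (- c)"
proof -
  have "\<forall>\<^sub>F n in sequentially. real K * real n powr (- \<tau>) \<le> 1 / 2 * real n powr (- c)"
    using assms by real_asymp
  moreover have "\<forall>\<^sub>F n in sequentially. 2 / real n \<le> 1 / 2 * real n powr (- c)"
    using assms by real_asymp
  moreover have "\<forall>\<^sub>F n in sequentially. 1 < real n" by real_asymp
  ultimately show ?thesis
  proof eventually_elim
    case (elim n)
    have "real n * exp (- (1 + \<tau>) * ln (real n)) = real n powr 1 * real n powr (- (1 + \<tau>))"
      using elim by (simp add: powr_def)
    also have "\<dots> = real n powr (- \<tau>)" unfolding powr_add[symmetric] by simp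
    finally have "real n * (real K * exp (- (1 + \<tau>) * ln (real n))) = real K * real n powr (- \<tau>)"
      by (simp add: mult.left_commute)
    moreover have "1 / real n + 1 / real n = 2 / real n" by simp
    ultimately show ?case using elim(1,2) by linarith
  qed
qed

definition good_tensor ::
    "nat \<Rightarrow> nat \<Rightarrow> nat \<Rightarrow> (nat \<Rightarrow> nat) \<Rightarrow> real \<Rightarrow> real \<Rightarrow> real \<Rightarrow> tensor \<Rightarrow> bool" where
  "good_tensor n d K g \<alpha> \<delta> Y A \<longleftrightarrow> adjacency_tensor n d A \<and>
     (\<forall>i<n. real (ordered_degree A i) \<le> fact (d - 1) * ((\<alpha> * exp 1 + 2) * ln n)) \<and>
     has_gap n K A g (fact (d - 1) * (\<delta> * ln n)) \<and>
     expands n A (fact (d - 1) * (\<delta> * ln n)) (exp (- Y) * n) (\<delta> / (2 * d) / 4 * ln n)"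

text \<open>The margin by which the separation exceeds one is shared: half of it pays for the gap \<delta>, and
part of the rest is left as the exponent c of the failure probability. The parameter Y, which sets the radius of contraction, can then be chosen as large as the
expansion requires.\<close>

lemma eventually_good:
  fixes \<alpha> \<beta> :: real and d K :: nat
  assumes d: "2 \<le> d" and K: "2 \<le> K" and ab: "0 < \<beta>" "\<beta> < \<alpha>"
    and sep: "(sqrt \<alpha> - sqrt \<beta>)\<^sup>2 / (real K ^ (d - 1) * fact (d - 1)) > 1"
  shows "\<exists>\<delta>>0. \<exists>c>0. \<forall>Y\<ge>1. 2 * (\<alpha> + 4) / (\<delta> / (2 * d)) \<le> Y \<longrightarrow>
    (\<forall>\<^sub>F n in sequentially. K dvd n \<longrightarrow> (\<forall>g. balanced_fun n K g \<longrightarrow>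
      1 - real n powr (- c) \<le> measure_pmf.prob
        (hsbm n d (\<alpha> * ln n / real n ^ (d - 1)) (\<beta> * ln n / real n ^ (d - 1)) (assign_mat n K g))
        {A. good_tensor n d K g \<alpha> \<delta> Y A}))"
proof -
  define a b where "a = sqrt \<alpha>" and "b = sqrt \<beta>"
  have ab': "0 < b" "b < a" and sq: "a\<^sup>2 = \<alpha>" "b\<^sup>2 = \<beta>" using ab by (auto simp: a_def b_def)
  define D where "D = (a - b)\<^sup>2 / (real K ^ (d - 1) * fact (d - 1))"
  have D1: "1 < D" using sep by (simp add: D_def a_def b_def)
  define l where "l = ln (a / b)"
  have l: "0 < l" using ab' by (simp add: l_def)
  define \<delta> where "\<delta> = (D - 1) / (2 * l)"
  have \<delta>: "0 < \<delta>" "l * \<delta> = (D - 1) / 2" using D1 l by (simp_all add: \<delta>_def)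
  define \<tau> where "\<tau> = (D - 1) / 4"
  define c where "c = min (\<tau> / 2) (1 / 2)"
  have \<tau>: "0 < \<tau>" using D1 by (simp add: \<tau>_def)
  then have "0 < c" "c \<le> \<tau> / 2" "c \<le> 1 / 2" by (simp_all add: c_def)
  then have c: "0 < c" "c < \<tau>" "c < 1" using \<tau> by linarith+
  have main: "\<forall>\<^sub>F n in sequentially. K dvd n \<longrightarrow> (\<forall>g. balanced_fun n K g \<longrightarrow>
      1 - real n powr (- c) \<le> measure_pmf.prob
        (hsbm n d (\<alpha> * ln n / real n ^ (d - 1)) (\<beta> * ln n / real n ^ (d - 1)) (assign_mat n K g))
        {A. good_tensor n d K g \<alpha> \<delta> Y A})"
    if Y: "1 \<le> Y" "2 * (\<alpha> + 4) / (\<delta> / (2 * d)) \<le> Y" for Y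
  proof -
    have "\<forall>\<^sub>F n in sequentially. \<alpha> * ln (real n) / real n \<le> 1" by real_asymp
    moreover have "\<forall>\<^sub>F n in sequentially. 1 < (n :: nat)" by (rule eventually_gt_at_top)
    moreover note gap_exponent_le[OF d K ab' D_def D1 l_def \<delta>(2)]
    moreover note eventually_failure_le[OF c, of K]
    ultimately show ?thesis
    proof eventually_elim
      case (elim n)
      show ?case
      proof (intro impI allI)
        fix g assume dvd: "K dvd n" and g: "balanced_fun n K g"
        let ?p = "\<alpha> * ln n / real n ^ (d - 1)" and ?q = "\<beta> * ln n / real n ^ (d - 1)"
        have n: "1 < n" "0 < n" using elim(2) by auto
        have ln: "0 < ln (real n)" using n by simp
        have "real n ^ 1 \<le> real n ^ (d - 1)" using n d by (intro power_increasing) auto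
        then have "?p \<le> \<alpha> * ln n / real n"
          using ab ln n by (intro divide_left_mono mult_pos_pos) auto
        then have p1: "?p \<le> 1" using elim(1) by simp
        interpret block_model n d K g ?p ?q
        proof
          show "0 \<le> ?q" using ab ln by simp
          show "?q \<le> ?p" using ab ln by (intro divide_right_mono mult_right_mono) auto
        qed (use g d p1 in auto)
        have np: "real n ^ (d - 1) * ?p = \<alpha> * ln n" using n by simp
        let ?B1 = "{X. \<exists>i<n. fact (d - 1) * ((\<alpha> * exp 1 + 2) * ln n) \<le> real (ordered_degree (tensor_of n d X) i)}"
        let ?B2 = "{X. \<not> has_gap n K (tensor_of n d X) g (fact (d - 1) * (\<delta> * ln n))}"
        let ?B3 = "{X. \<not> expands n (tensor_of n d X) (fact (d - 1) * (\<delta> * ln n)) (exp (- Y) * n) (\<delta> / (2 * d) / 4 * ln n)}"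
        let ?G = "{A. good_tensor n d K g \<alpha> \<delta> Y A}"
        have B1: "Pr ?B1 \<le> 1 / n"
          using prob_some_large_degree[OF n(2) np] .
        have B2: "Pr ?B2 \<le> real n * (real K * exp (- (1 + \<tau>) * ln n))"
        proof (rule prob_no_gap[where l = l])
          fix m assume m: "m = n div K"
          show "l * (\<delta> * ln n) + real (m - 1 choose (d - 1)) * ?p * (exp (- l) - 1) +
              real (m choose (d - 1)) * ?q * (exp l - 1) \<le> - (1 + \<tau>) * ln n"
            using elim(3) dvd unfolding sq \<tau>_def m by blast
        qed (use l in simp)
        have B3: "Pr ?B3 \<le> 1 / n"
          using prob_not_expands[OF n(1) np _ \<delta>(1) refl Y] ab by simp
        have "- (tensor_of n d -` ?G) \<subseteq> (?B1 \<union> ?B2) \<union> ?B3"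
          using adjacency_tensor_of by (auto simp: good_tensor_def not_le intro: less_imp_le)
        then have "Pr (- (tensor_of n d -` ?G)) \<le> Pr ((?B1 \<union> ?B2) \<union> ?B3)"
          by (intro measure_pmf.finite_measure_mono) simp_all
        also have "\<dots> \<le> (Pr ?B1 + Pr ?B2) + Pr ?B3"
          by (intro order_trans[OF measure_Un_le] add_right_mono measure_Un_le) simp_all
        also have "\<dots> \<le> real n powr (- c)" using B1 B2 B3 elim(4) by linarith
        finally have "Pr (- (tensor_of n d -` ?G)) \<le> real n powr (- c)" .
        moreover have "Pr (- (tensor_of n d -` ?G)) = 1 - Pr (tensor_of n d -` ?G)"
          using measure_pmf.prob_compl[of "tensor_of n d -` ?G" edges_pmf] by (simp add: Compl_eq_Diff_UNIV)
        ultimately show "1 - real n powr (- c) \<le> measure_pmf.prob (hsbm n d ?p ?q (assign_mat n K g)) ?G"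
          unfolding hsbm_edges measure_map_pmf by linarith
      qed
    qed
  qed
  show ?thesis using \<delta>(1) c(1) main by blast
qed

lemma recovery_from_good_tensor:
  fixes \<Delta> Y L r :: real
  assumes K: "2 \<le> K" and d: "2 \<le> d" and n: "0 < n" "K dvd n" and A: "adjacency_tensor n d A"
    and g: "balanced_fun n K g" and gap: "has_gap n K A g \<Delta>" and \<Delta>: "0 < \<Delta>"
    and ex: "expands n A \<Delta> (exp (- Y) * n) L" and L: "1 \<le> L" "real n \<le> L ^ N" and Y: "0 < Y"
    and deg: "\<And>i. i < n \<Longrightarrow> ordered_degree A i \<le> M" "1 \<le> M"
    and H0: "H0 \<in> assignments n K"
    and near: "(MIN Q\<in>perm_mats K. frob_norm (H0 - assign_mat n K g * Q)) \<le> r" and r: "r\<^sup>2 \<le> exp (- Y) * n"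
  shows "ptpm_outputs n d K A N H0 \<subseteq> true_partitions K (assign_mat n K g) \<and>
    (\<forall>es. lists_nonzeros A es \<longrightarrow> (\<exists>T s. exec (ptpm_prog K d) (ptpm_input n d K N es H0) T s \<and>
       ptpm_result n K s \<in> true_partitions K (assign_mat n K g) \<and>
       T \<le> (N + 1) * (n + 1) * ((K + 1) * M + 1) * ptpm_const K d))"
proof -
  have "exp (- Y) * n < 1 * real n" using Y n by (intro mult_strict_right_mono) auto
  then have "exp (- Y) * n < L ^ N" using L by simp
  then have sub: "ptpm_outputs n d K A N H0 \<subseteq> true_partitions K (assign_mat n K g)"
    using ptpm_outputs_subset[OF A g gap ex \<Delta> L(1) H0 near r] by blast
  then show ?thesis using exec_ptpm_prog[OF K d n A _ H0 deg(2,1), of _ N] by blast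
qed

lemma eventually_running_time:
  fixes c1 :: real and K :: nat
  assumes "0 < c1"
  shows "\<exists>C>0. \<forall>\<^sub>F n in sequentially.
    real ((iterations n + 1) * (n + 1) * ((K + 1) * nat \<lceil>c1 * ln n\<rceil> + 1) * b) \<le>
      C * (real n * (ln n)\<^sup>2 / ln (ln n)) \<and> 1 \<le> nat \<lceil>c1 * ln n\<rceil>"
proof -
  define C where "C = 9 * 2 * (real (K + 1) * (c1 + 1) + 1) * (real b + 1)"
  have C: "0 < C" using assms unfolding C_def by (intro mult_pos_pos add_nonneg_pos) auto
  have "\<forall>\<^sub>F n in sequentially. real ((iterations n + 1) * (n + 1) * ((K + 1) * nat \<lceil>c1 * ln n\<rceil> + 1) * b) \<le>
      C * (real n * (ln n)\<^sup>2 / ln (ln n)) \<and> 1 \<le> nat \<lceil>c1 * ln n\<rceil>"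
  proof -
    have "\<forall>\<^sub>F n in sequentially. 1 \<le> ln (real n)" by real_asymp
    moreover have "\<forall>\<^sub>F n in sequentially. 0 < ln (ln (real n))" by real_asymp
    moreover have "\<forall>\<^sub>F n in sequentially. 1 \<le> real n" by real_asymp
    moreover note eventually_iterations_le
    ultimately show ?thesis
    proof eventually_elim
      case (elim n)
      have "0 < ln (real n)" using elim(1) by linarith
      then have pos: "0 < c1 * ln n" by (rule mult_pos_pos[OF assms])
      have m1: "real (nat \<lceil>c1 * ln n\<rceil>) \<le> c1 * ln n + 1" using pos by linarith
      have "real ((K + 1) * nat \<lceil>c1 * ln n\<rceil> + 1) \<le> real (K + 1) * (c1 * ln n + 1) + 1"
        unfolding of_nat_add of_nat_mult of_nat_1 using m1 by (intro add_right_mono mult_left_mono) auto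
      also have "\<dots> \<le> real (K + 1) * (c1 * ln n + ln n) + ln n"
        using elim by (intro add_mono mult_left_mono order_refl) auto
      also have "\<dots> = (real (K + 1) * (c1 + 1) + 1) * ln n" by (simp add: algebra_simps)
      finally have 1: "real ((K + 1) * nat \<lceil>c1 * ln n\<rceil> + 1) \<le> (real (K + 1) * (c1 + 1) + 1) * ln n" .
      have 2: "real (n + 1) \<le> 2 * real n" using elim by simp
      have "real ((iterations n + 1) * (n + 1) * ((K + 1) * nat \<lceil>c1 * ln n\<rceil> + 1) * b) =
         real (iterations n + 1) * real (n + 1) * real ((K + 1) * nat \<lceil>c1 * ln n\<rceil> + 1) * real b"
        by (simp only: of_nat_mult)
      also have "\<dots> \<le> (9 * (ln n / ln (ln n))) * (2 * real n) * ((real (K + 1) * (c1 + 1) + 1) * ln n) * (real b + 1)"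
        using 1 2 elim assms by (intro mult_mono mult_nonneg_nonneg of_nat_0_le_iff) auto
      also have "\<dots> = C * (real n * (ln n)\<^sup>2 / ln (ln n))"
        unfolding C_def by (simp add: power2_eq_square)
      finally show ?case using pos by linarith
    qed
  qed
  then show ?thesis using C by blast
qed

theorem theorem4p1:
  fixes d K :: nat and \<alpha> \<beta> :: real
  assumes "d \<ge> 2" and "K \<ge> 2" and "\<alpha> > \<beta>" and "\<beta> > 0"
    and "(sqrt \<alpha> - sqrt \<beta>)\<^sup>2 / (real K ^ (d - 1) * fact (d - 1)) > 1"
  shows "\<exists>P. implements_ptpm d K P \<and>
    (\<exists>\<gamma>>0. \<exists>c>0. \<exists>C>0. \<forall>\<^sub>F n in sequentially. K dvd n \<longrightarrow> (\<forall>Hs\<in>balanced n K.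
       let p = \<alpha> * ln (real n) / real n ^ (d - 1);
           q = \<beta> * ln (real n) / real n ^ (d - 1);
           \<theta> = 1 / 4 * min (1 / sqrt (real K * (real d - 1)))
                 (\<gamma> * real K powr (real d - 3 / 2) / (16 * (real d - 1) * (\<alpha> - \<beta>)));
           N = nat \<lceil>2 * ln (ln (real n))\<rceil> + nat \<lceil>2 * ln (real n) / ln (ln (real n))\<rceil> + 2
       in measure_pmf.prob (hsbm n d p q Hs)
            {A. \<forall>H0\<in>assignments n K.
               (MIN Q\<in>perm_mats K. frob_norm (H0 - Hs * Q)) \<le> \<theta> * sqrt (real n) \<longrightarrow>
               ptpm_outputs n d K A N H0 \<subseteq> true_partitions K Hs \<and>
               (\<forall>es. lists_nonzeros A es \<longrightarrow>
                  (\<exists>T s. exec P (ptpm_input n d K N es H0) T s \<and>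
                     ptpm_result n K s \<in> true_partitions K Hs \<and>
                     real T \<le> C * (real n * (ln (real n))\<^sup>2 / ln (ln (real n)))))}
          \<ge> 1 - real n powr (- c)))"
proof -
  obtain \<delta> c where \<delta>: "0 < \<delta>" and c: "0 < c"
    and good: "\<And>Y. 1 \<le> Y \<Longrightarrow> 2 * (\<alpha> + 4) / (\<delta> / (2 * d)) \<le> Y \<Longrightarrow>
    (\<forall>\<^sub>F n in sequentially. K dvd n \<longrightarrow> (\<forall>g. balanced_fun n K g \<longrightarrow>
      1 - real n powr (- c) \<le> measure_pmf.prob
        (hsbm n d (\<alpha> * ln n / real n ^ (d - 1)) (\<beta> * ln n / real n ^ (d - 1)) (assign_mat n K g))
        {A. good_tensor n d K g \<alpha> \<delta> Y A}))"
    using eventually_good[OF assms(1,2,4,3,5)] by blast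
  \<comment> \<open>The radius of contraction, as a fraction exp (- Y) of n.\<close>
  define Y where "Y = max 1 (2 * (\<alpha> + 4) / (\<delta> / (2 * d)))"
  have Y: "1 \<le> Y" "2 * (\<alpha> + 4) / (\<delta> / (2 * d)) \<le> Y" by (simp_all add: Y_def)
  define \<eta> where "\<eta> = \<delta> / (2 * d) / 4"
  have \<eta>: "0 < \<eta>" using \<delta> assms(1) by (simp add: \<eta>_def)
  define c1 where "c1 = fact (d - 1) * (\<alpha> * exp 1 + 2)"
  have c1: "0 < c1" using assms(3,4) by (simp add: c1_def add_pos_pos)
  \<comment> \<open>This choice makes the second term of the minimum equal to 4 sqrt (exp (- Y)), so that the square of \<theta> is at most exp (- Y).\<close>
  define \<gamma> where "\<gamma> = 4 * sqrt (exp (- Y)) * (16 * (real d - 1) * (\<alpha> - \<beta>)) / real K powr (real d - 3 / 2)"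
  have \<gamma>: "0 < \<gamma>" using assms(1,2,3) by (simp add: \<gamma>_def)
  define \<theta> where "\<theta> = 1 / 4 * min (1 / sqrt (real K * (real d - 1)))
                 (\<gamma> * real K powr (real d - 3 / 2) / (16 * (real d - 1) * (\<alpha> - \<beta>)))"
  have "\<gamma> * real K powr (real d - 3 / 2) / (16 * (real d - 1) * (\<alpha> - \<beta>)) = 4 * sqrt (exp (- Y))"
    using assms(1,2,3) by (simp add: \<gamma>_def)
  then have "0 \<le> \<theta>" "\<theta> \<le> sqrt (exp (- Y))" using assms(1) by (simp_all add: \<theta>_def)
  then have "\<theta>\<^sup>2 \<le> (sqrt (exp (- Y)))\<^sup>2" by (intro power_mono)
  then have \<theta>: "\<theta>\<^sup>2 \<le> exp (- Y)" by simp
  \<comment> \<open>The degree bound c1 log n, the number of iterations and the size n multiply to the bound claimed.\<close>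
  obtain C where C: "0 < C" and time: "\<forall>\<^sub>F n in sequentially.
    real ((iterations n + 1) * (n + 1) * ((K + 1) * nat \<lceil>c1 * ln n\<rceil> + 1) * ptpm_const K d) \<le>
      C * (real n * (ln n)\<^sup>2 / ln (ln n)) \<and> 1 \<le> nat \<lceil>c1 * ln n\<rceil>"
    using eventually_running_time[OF c1] by blast
  let ?good = "\<lambda>n Hs. {A. \<forall>H0\<in>assignments n K.
               (MIN Q\<in>perm_mats K. frob_norm (H0 - Hs * Q)) \<le> \<theta> * sqrt (real n) \<longrightarrow>
               ptpm_outputs n d K A (iterations n) H0 \<subseteq> true_partitions K Hs \<and>
               (\<forall>es. lists_nonzeros A es \<longrightarrow>
                  (\<exists>T s. exec (ptpm_prog K d) (ptpm_input n d K (iterations n) es H0) T s \<and>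
                     ptpm_result n K s \<in> true_partitions K Hs \<and>
                     real T \<le> C * (real n * (ln (real n))\<^sup>2 / ln (ln (real n)))))}"
  have "\<forall>\<^sub>F n in sequentially. K dvd n \<longrightarrow> (\<forall>Hs\<in>balanced n K.
    1 - real n powr (- c) \<le> measure_pmf.prob
      (hsbm n d (\<alpha> * ln (real n) / real n ^ (d - 1)) (\<beta> * ln (real n) / real n ^ (d - 1)) Hs) (?good n Hs))"
    using good[OF Y] time eventually_contraction_power[OF \<eta>] eventually_gt_at_top[of 1]
  proof eventually_elim
    case (elim n)
    show ?case
    proof (intro impI ballI)
      fix Hs assume dvd: "K dvd n" and Hs: "Hs \<in> balanced n K"
      then obtain g where g: "balanced_fun n K g" "Hs = assign_mat n K g" using balanced_iff by blast
      let ?P = "hsbm n d (\<alpha> * ln (real n) / real n ^ (d - 1)) (\<beta> * ln (real n) / real n ^ (d - 1)) Hs"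
      let ?\<Delta> = "fact (d - 1) * (\<delta> * ln n)"
      let ?G = "{A. good_tensor n d K g \<alpha> \<delta> Y A}"
      have "?G \<subseteq> ?good n Hs"
      proof
        fix A assume "A \<in> ?G"
        then have A: "adjacency_tensor n d A" "has_gap n K A g ?\<Delta>"
          "\<And>i. i < n \<Longrightarrow> real (ordered_degree A i) \<le> c1 * ln n"
          "expands n A ?\<Delta> (exp (- Y) * n) (\<eta> * ln n)"
          by (simp_all add: good_tensor_def c1_def \<eta>_def mult.assoc)
        have deg: "ordered_degree A i \<le> nat \<lceil>c1 * ln n\<rceil>" if "i < n" for i
          using A(3)[OF that] by linarith
        have \<Delta>: "0 < ?\<Delta>" using \<delta> elim(4) by simp
        have r: "(\<theta> * sqrt n)\<^sup>2 \<le> exp (- Y) * n"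
          using \<theta> by (simp add: power_mult_distrib mult_right_mono)
        show "A \<in> ?good n Hs"
        proof (intro CollectI ballI impI)
          fix H0 assume H0: "H0 \<in> assignments n K"
            and near: "(MIN Q\<in>perm_mats K. frob_norm (H0 - Hs * Q)) \<le> \<theta> * sqrt (real n)"
          have "ptpm_outputs n d K A (iterations n) H0 \<subseteq> true_partitions K (assign_mat n K g) \<and>
            (\<forall>es. lists_nonzeros A es \<longrightarrow> (\<exists>T s. exec (ptpm_prog K d) (ptpm_input n d K (iterations n) es H0) T s \<and>
             ptpm_result n K s \<in> true_partitions K (assign_mat n K g) \<and>
             T \<le> (iterations n + 1) * (n + 1) * ((K + 1) * nat \<lceil>c1 * ln n\<rceil> + 1) * ptpm_const K d))"
            by (rule recovery_from_good_tensor[where \<Delta> = ?\<Delta> and Y = Y and L = "\<eta> * ln n"])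
               (use assms(1,2) dvd A g \<Delta> elim(2,3,4) Y(1) deg H0 near r in auto)
          then show "ptpm_outputs n d K A (iterations n) H0 \<subseteq> true_partitions K Hs \<and>
               (\<forall>es. lists_nonzeros A es \<longrightarrow>
                  (\<exists>T s. exec (ptpm_prog K d) (ptpm_input n d K (iterations n) es H0) T s \<and>
                     ptpm_result n K s \<in> true_partitions K Hs \<and>
                     real T \<le> C * (real n * (ln (real n))\<^sup>2 / ln (ln (real n)))))"
            unfolding g(2) using elim(2) by (meson of_nat_le_iff order_trans)
        qed
      qed
      then have "measure_pmf.prob ?P ?G \<le> measure_pmf.prob ?P (?good n Hs)"
        by (intro measure_pmf.finite_measure_mono) simp_all
      moreover have "1 - real n powr (- c) \<le> measure_pmf.prob ?P ?G"
        using elim(1) dvd g by blast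
      ultimately show "1 - real n powr (- c) \<le> measure_pmf.prob ?P (?good n Hs)" by linarith
    qed
  qed
  then show ?thesis
    unfolding \<theta>_def iterations_def
    using ptpm_prog_implements_ptpm[OF assms(2,1)] \<gamma> c C
    by (intro exI[of _ "ptpm_prog K d"] conjI exI[of _ \<gamma>] exI[of _ c] exI[of _ C]) (simp_all only: Let_def)
qed

end
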